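(* There exists a real number $x>0$ such that both $x$ and $1/x$ are continued fraction normal and absolutely normal, and both $x$ and $1/x$ are computable.
   Context: Continued fraction normality: write the continued fraction expansion of a real $x$ as $x=[a_0;a_1,a_2,\ldots]$ with $a_0=\lfloor x\rfloor$ and $a_1,a_2,\ldots$ positive integers. Let $\mu$ be the Gauss measure on $[0,1]$, $\mu(A)=\frac{1}{\log 2}\int_A\frac{1}{1+t}\,dt$, and for positive integers $v_1,\dots,v_k$ let $I_{[v_1,\dots,v_k]}$ be the set of numbers in $(0,1)$ whose first $k$ continued fraction digits (after the integer part) are $v_1,\dots,v_k$. The number $x$ is continued fraction normal if for every $k\ge1$ and every $(v_1,\dots,v_k)\in\mathbb N^k$, $\lim_{n\to\infty}\frac1n\#\{j:1\le j\le n,\ a_j=v_1,\dots,a_{j+k-1}=v_k\}=\mu(I_{[v_1,\dots,v_k]})$ (the integer part $a_0$ is ignored). Absolute normality: for an integer base $b\ge2$, a real number is simply normal to base $b$ if each digit $d\in\{0,\dots,b-1\}$ occurs in the (greedy) base-$b$ expansion of its fractional part with asymptotic frequency $1/b$; it is normal to base $b$ if it is simply normal to all bases $b,b^2,b^3,\dots$; it is absolutely normal if it is normal to every integer base $b\ge2$. A real number is computable if for some integer $b\ge2$ there is an algorithm that outputs the digits of its base-$b$ expansion one after another. *)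

theory Defs
  imports "HOL-Analysis.Analysis"
begin

text \<open>
  The complete quotients of \<open>x\<close>. If \<open>x\<close> is rational the expansion stops: since \<open>1 / 0 = 0\<close>, all
  complete quotients, and hence all digits, are \<open>0\<close> past its end. As \<open>0\<close> is not a legal digit at a
  positive position, this padding never matches a block of positive integers.
\<close>

primrec complete_quotient :: "real \<Rightarrow> nat \<Rightarrow> real" where
  "complete_quotient x 0 = x"
| "complete_quotient x (Suc n) = 1 / frac (complete_quotient x n)"

definition cf_digit :: "real \<Rightarrow> nat \<Rightarrow> int" where
  "cf_digit x n = \<lfloor>complete_quotient x n\<rfloor>"

definition gauss_measure :: "real measure" where
  "gauss_measure = density (restrict_space lborel {0..1}) (\<lambda>t. ennreal (1 / ln 2 * (1 / (1 + t))))"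

definition cf_cylinder :: "nat list \<Rightarrow> real set" where
  "cf_cylinder v = {t \<in> {0<..<1}. \<forall>i<length v. cf_digit t (i + 1) = int (v ! i)}"

definition cf_normal :: "real \<Rightarrow> bool" where
  "cf_normal x \<longleftrightarrow> (\<forall>v. v \<noteq> [] \<and> (\<forall>a\<in>set v. a > 0) \<longrightarrow>
     (\<lambda>n. real (card {j \<in> {1..n}. \<forall>i<length v. cf_digit x (j + i) = int (v ! i)}) / real n)
       \<longlonglongrightarrow> measure gauss_measure (cf_cylinder v))"

text \<open>
  The digit at position \<open>j \<ge> 1\<close> after the radix point in the greedy base-\<open>b\<close> expansion of the
  fractional part of \<open>x\<close>.
\<close>

definition base_digit :: "nat \<Rightarrow> real \<Rightarrow> nat \<Rightarrow> nat" where
  "base_digit b x j = nat (\<lfloor>real b ^ j * frac x\<rfloor> mod int b)"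

definition simply_normal :: "nat \<Rightarrow> real \<Rightarrow> bool" where
  "simply_normal b x \<longleftrightarrow>
     (\<forall>d<b. (\<lambda>n. real (card {j \<in> {1..n}. base_digit b x j = d}) / real n) \<longlonglongrightarrow> 1 / real b)"

definition base_normal :: "nat \<Rightarrow> real \<Rightarrow> bool" where
  "base_normal b x \<longleftrightarrow> (\<forall>k\<ge>1. simply_normal (b ^ k) x)"

definition absolutely_normal :: "real \<Rightarrow> bool" where
  "absolutely_normal x \<longleftrightarrow> (\<forall>b\<ge>2. base_normal b x)"

text \<open>
  Algorithms are modelled by partial recursive functions: \<open>computes p xs y\<close> says that program \<open>p\<close>
  halts on input \<open>xs\<close> with output \<open>y\<close>. Arities are not tracked syntactically; a program applied to
  too short an input just fails to halt. The recursion variable of \<open>Prec\<close> and the search variable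
  of \<open>Mu\<close> come first in the argument list.
\<close>

datatype recf = Zero | Succ | Proj nat | Comp recf "recf list" | Prec recf recf | Mu recf

inductive computes :: "recf \<Rightarrow> nat list \<Rightarrow> nat \<Rightarrow> bool" where
  zero: "computes Zero xs 0"
| succ: "computes Succ (x # xs) (Suc x)"
| proj: "i < length xs \<Longrightarrow> computes (Proj i) xs (xs ! i)"
| comp: "list_all2 (\<lambda>g y. computes g xs y) gs ys \<Longrightarrow> computes f ys z \<Longrightarrow> computes (Comp f gs) xs z"
| prec_0: "computes f xs y \<Longrightarrow> computes (Prec f g) (0 # xs) y"
| prec_Suc: "computes (Prec f g) (n # xs) r \<Longrightarrow> computes g (n # r # xs) y \<Longrightarrow>
    computes (Prec f g) (Suc n # xs) y"
| mu: "computes f (y # xs) 0 \<Longrightarrow> (\<forall>z<y. \<exists>r. computes f (z # xs) (Suc r)) \<Longrightarrow>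
    computes (Mu f) xs y"

definition computable :: "(nat \<Rightarrow> nat) \<Rightarrow> bool" where
  "computable f \<longleftrightarrow> (\<exists>p. \<forall>n. computes p [n] (f n))"

text \<open>
  Only the digits after the radix point need to be produced by the algorithm, because those of the
  integer part form a finite prefix.
\<close>

definition computable_real :: "real \<Rightarrow> bool" where
  "computable_real x \<longleftrightarrow> (\<exists>b\<ge>2. computable (\<lambda>n. base_digit b x (Suc n)))"

end

theory Submission
  imports Defs "HOL-Probability.Probability"
begin

text \<open>
  The number \<open>x \<in> (1, 2)\<close> is built bit by bit while avoiding a sequence of bad sets, the \<open>n\<close>-th of which
  has measure at most \<open>4\<^sup>-\<^sup>n / 16\<close>: there some base-\<open>b\<close> digit frequency of \<open>x\<close> or \<open>1 / x\<close>, or some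
  frequency with which the Gauss map orbit of \<open>x - 1\<close> visits an interval \<open>[0, d / b)\<close>, is off by more
  than about \<open>1 / n\<close> at some time \<open>j\<^sup>2\<close> with \<open>64\<^sup>n \<le> j < 64\<^sup>n\<^sup>+\<^sup>1\<close>. The measure bounds come from Chebyshev's
  inequality, given that correlations decay exponentially. Cylinders are intervals with rational
  end points, so visits to the intervals \<open>[0, d / b)\<close> determine all block frequencies; and the continued
  fraction of \<open>1 / x\<close> is that of \<open>x\<close> shifted by one.

  For the algorithm, a dyadic interval is certified if its two rational end points have the same
  data up to the relevant time (continued fraction digits by Euclid's algorithm, and \<open>\<lfloor>b\<^sup>i x\<rfloor>\<close>,
  \<open>\<lfloor>b\<^sup>i / x\<rfloor>\<close>) and good frequencies; then all points in between have the same data. Almost every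
  point outside the bad set eventually lies in a certified interval, so a level at which the
  uncertified intervals have measure at most \<open>4\<^sup>-\<^sup>n / 16\<close> can be found by unbounded search.
\<close>

text \<open>The bad sets are not given by a decidable condition, and no rate is established at which
  certified intervals fill their complements. The search for a level needs no rate: counting
  uncertified intervals is a finite exact computation, and measure theory guarantees that some level
  succeeds. Certificates also demand positive partial quotients, which forces the constructed number
  to be irrational; a statement about almost all points would say nothing about one particular
  point. Normality to a base is simple normality to its powers, so for digits it is enough to count
  visits to the intervals [d/b, (d+1)/b), for which correlations vanish at positive time
  differences. For continued fractions, intervals [0, r) are preferred to cylinders because their
  indicators are monotone, which is what the transfer operator turns into contraction. All bounds
  can be stated in Lebesgue measure on [0, 1): passing from the Gauss measure costs a factor 2, and
  the map u to 1 / (1 + u), which brings in the digits of 1 / x, a factor 4.\<close>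

section \<open>Closure properties of the total recursive functions\<close>

text \<open>
  A function of \<open>k\<close> arguments is written as a function of an environment \<open>nat \<Rightarrow> nat\<close>, so that
  under a binder the bound variable becomes \<open>e 0\<close> and \<open>e i\<close> becomes \<open>e (Suc i)\<close> by mere \<open>\<beta>\<close>-reduction.
\<close>

definition rec :: "nat \<Rightarrow> ((nat \<Rightarrow> nat) \<Rightarrow> nat) \<Rightarrow> bool" where
  "rec k f \<longleftrightarrow> (\<exists>p. \<forall>xs. length xs = k \<longrightarrow> computes p xs (f (\<lambda>i. xs ! i)))"

lemma rec_var: "i < k \<Longrightarrow> rec k (\<lambda>e. e i)"
  unfolding rec_def using computes.proj by metis

text \<open>The inner values are reread as an environment of the form \<open>(!) ys\<close>, because
  \<open>rec\<close> constrains a function only on such environments; beyond the length of the list,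
  \<open>xs ! i\<close> is an unspecified value.\<close>

lemma rec_comp:
  assumes "rec (length gs) f" "\<And>g. g \<in> set gs \<Longrightarrow> rec k g"
  shows "rec k (\<lambda>e. f (\<lambda>i. map (\<lambda>g. g e) gs ! i))"
proof -
  obtain p where p: "\<And>xs. length xs = length gs \<Longrightarrow> computes p xs (f (\<lambda>i. xs ! i))"
    using assms(1) unfolding rec_def by blast
  have "\<forall>g\<in>set gs. \<exists>q. \<forall>xs. length xs = k \<longrightarrow> computes q xs (g (\<lambda>i. xs ! i))"
    using assms(2) unfolding rec_def by blast
  then obtain q where q: "\<And>g xs. g \<in> set gs \<Longrightarrow> length xs = k \<Longrightarrow> computes (q g) xs (g (\<lambda>i. xs ! i))"
    by metis
  have "computes (Comp p (map q gs)) xs (f (\<lambda>i. map (\<lambda>g. g (\<lambda>i. xs ! i)) gs ! i))"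
    if "length xs = k" for xs
  proof (rule computes.comp)
    show "list_all2 (\<lambda>g y. computes g xs y) (map q gs) (map (\<lambda>g. g (\<lambda>i. xs ! i)) gs)"
      using q that by (auto simp: list_all2_conv_all_nth)
  qed (use p in simp)
  then show ?thesis unfolding rec_def by blast
qed

lemma rec_comp1: "rec 1 (\<lambda>e. F (e 0)) \<Longrightarrow> rec k a \<Longrightarrow> rec k (\<lambda>e. F (a e))"
  using rec_comp[of "[a]" "\<lambda>e. F (e 0)" k] by simp

lemma rec_comp2:
  "rec 2 (\<lambda>e. F (e 0) (e 1)) \<Longrightarrow> rec k a \<Longrightarrow> rec k b \<Longrightarrow> rec k (\<lambda>e. F (a e) (b e))"
  using rec_comp[of "[a, b]" "\<lambda>e. F (e 0) (e 1)" k] by (auto simp: numeral_2_eq_2)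

lemma rec_comp3:
  "rec 3 (\<lambda>e. F (e 0) (e 1) (e 2)) \<Longrightarrow> rec k a \<Longrightarrow> rec k b \<Longrightarrow> rec k c \<Longrightarrow>
    rec k (\<lambda>e. F (a e) (b e) (c e))"
  using rec_comp[of "[a, b, c]" "\<lambda>e. F (e 0) (e 1) (e 2)" k] by (auto simp: numeral_3_eq_3 numeral_2_eq_2)

lemma rec_Suc: "rec k a \<Longrightarrow> rec k (\<lambda>e. Suc (a e))"
proof (rule rec_comp1[where F = Suc])
  have "computes Succ xs (Suc (xs ! 0))" if "length xs = 1" for xs
    using that computes.succ by (cases xs) auto
  then show "rec 1 (\<lambda>e. Suc (e 0))" unfolding rec_def by blast
qed

lemma rec_const: "rec k (\<lambda>e. c)"
proof (induction c)
  case 0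
  then show ?case unfolding rec_def using computes.zero by blast
qed (rule rec_Suc)

lemma rec_prim:
  assumes g: "rec k g" and h: "rec (Suc (Suc k)) (\<lambda>e. h (e 0) (e 1) (\<lambda>i. e (Suc (Suc i))))"
    and n: "rec k n"
  shows "rec k (\<lambda>e. rec_nat (g e) (\<lambda>i r. h i r e) (n e))"
proof -
  obtain p where p: "\<And>xs. length xs = k \<Longrightarrow> computes p xs (g (\<lambda>i. xs ! i))"
    using g unfolding rec_def by blast
  obtain q where *: "\<And>xs. length xs = Suc (Suc k) \<Longrightarrow>
      computes q xs (h (xs ! 0) (xs ! 1) (\<lambda>i. xs ! Suc (Suc i)))"
    using h unfolding rec_def by blast
  have q: "computes q (i # r # xs) (h i r (\<lambda>i. xs ! i))" if "length xs = k" for i r xs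
  proof -
    have "computes q (i # r # xs) (h ((i # r # xs) ! 0) ((i # r # xs) ! 1) (\<lambda>j. (i # r # xs) ! Suc (Suc j)))"
      if "\<And>ys. length ys = Suc (Suc k) \<Longrightarrow> computes q ys (h (ys ! 0) (ys ! 1) (\<lambda>i. ys ! Suc (Suc i)))"
      by (rule that) (simp add: \<open>length xs = k\<close>)
    then show ?thesis using * by simp
  qed
  have *: "computes (Prec p q) (m # xs) (rec_nat (g (\<lambda>i. xs ! i)) (\<lambda>i r. h i r (\<lambda>i. xs ! i)) m)"
    if "length xs = k" for m xs
    by (induction m) (use p q that in \<open>auto intro: computes.intros\<close>)
  define F where "F e = rec_nat (g (\<lambda>i. e (Suc i))) (\<lambda>i r. h i r (\<lambda>i. e (Suc i))) (e 0)" for e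
  have "computes (Prec p q) ys (F (\<lambda>i. ys ! i))" if "length ys = Suc k" for ys
    using that *[of "tl ys" "hd ys"] unfolding F_def by (cases ys) auto
  then have "rec (Suc k) F" unfolding rec_def by blast
  \<comment> \<open>Composing with \<open>n\<close> and the \<open>k\<close> projections puts the
    number of iterations in front, where \<open>Prec\<close> expects it, and leaves the environment
    intact.\<close>
  then have "rec k (\<lambda>e. F (\<lambda>i. map (\<lambda>g. g e) (n # map (\<lambda>j e. e j) [0..<k]) ! i))"
    by (intro rec_comp) (use n in \<open>auto intro: rec_var\<close>)
  then obtain r where r: "\<And>xs. length xs = k \<Longrightarrow> computes r xs
      (F (\<lambda>i. map (\<lambda>g. g ((!) xs)) (n # map (\<lambda>j e. e j) [0..<k]) ! i))"
    unfolding rec_def by blast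
  have "computes r xs (rec_nat (g ((!) xs)) (\<lambda>i r. h i r ((!) xs)) (n ((!) xs)))"
    if "length xs = k" for xs
  proof -
    have "map (\<lambda>g. g ((!) xs)) (n # map (\<lambda>j e. e j) [0..<k]) = n ((!) xs) # xs"
      using that map_nth[of xs] by (simp add: o_def)
    then show ?thesis using r[OF that] unfolding F_def by simp
  qed
  then show ?thesis unfolding rec_def by blast
qed

text \<open>The search looks for a zero, so a predicate enters in the form
  \<open>of_bool (\<not> P)\<close>. The rule for \<open>Mu\<close> wants a positive result at every
  earlier candidate, which totality of \<open>F\<close> and minimality provide.\<close>

lemma rec_Least:
  assumes "rec (Suc k) (\<lambda>e. F (e 0) (\<lambda>i. e (Suc i)))" "\<And>e. \<exists>y. F y e = 0"
  shows "rec k (\<lambda>e. LEAST y. F y e = 0)"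
proof -
  obtain p where p: "\<And>xs. length xs = Suc k \<Longrightarrow> computes p xs (F (xs ! 0) (\<lambda>i. xs ! Suc i))"
    using assms(1) unfolding rec_def by blast
  have p': "computes p (y # xs) (F y ((!) xs))" if "length xs = k" for y xs
    using p[of "y # xs"] that by simp
  have "computes (Mu p) xs (LEAST y. F y ((!) xs) = 0)" if "length xs = k" for xs
  proof (rule computes.mu)
    show "computes p ((LEAST y. F y ((!) xs) = 0) # xs) 0"
      using p'[OF that, of "LEAST y. F y ((!) xs) = 0"] LeastI_ex[OF assms(2)[of "(!) xs"]] by simp
    show "\<forall>z<(LEAST y. F y ((!) xs) = 0). \<exists>r. computes p (z # xs) (Suc r)"
    proof (intro allI impI)
      fix z assume "z < (LEAST y. F y ((!) xs) = 0)"
      then have "F z ((!) xs) \<noteq> 0" by (rule not_less_Least)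
      then show "\<exists>r. computes p (z # xs) (Suc r)"
        using p'[OF that, of z] by (cases "F z ((!) xs)") auto
    qed
  qed
  then show ?thesis unfolding rec_def by blast
qed

lemma rec_add: "rec k a \<Longrightarrow> rec k b \<Longrightarrow> rec k (\<lambda>e. a e + b e)"
proof (rule rec_comp2[where F = "(+)"])
  have "rec 2 (\<lambda>e. rec_nat (e 1) (\<lambda>i r. Suc r) (e 0))"
    by (rule rec_prim) (auto intro!: rec_var rec_Suc)
  moreover have "rec_nat b (\<lambda>i r. Suc r) a = a + b" for a b by (induction a) auto
  ultimately show "rec 2 (\<lambda>e. e 0 + e 1)" by simp
qed

lemma rec_mult: "rec k a \<Longrightarrow> rec k b \<Longrightarrow> rec k (\<lambda>e. a e * b e)"
proof (rule rec_comp2[where F = "(*)"])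
  have "rec 2 (\<lambda>e. rec_nat 0 (\<lambda>i r. r + e 1) (e 0))"
    by (rule rec_prim) (auto intro!: rec_var rec_const rec_add)
  moreover have "rec_nat 0 (\<lambda>i r. r + b) a = a * b" for a b :: nat by (induction a) auto
  ultimately show "rec 2 (\<lambda>e. e 0 * e 1)" by simp
qed

lemma rec_power: "rec k a \<Longrightarrow> rec k b \<Longrightarrow> rec k (\<lambda>e. a e ^ b e)"
proof (rule rec_comp2[where F = "(^)"])
  have "rec 2 (\<lambda>e. rec_nat 1 (\<lambda>i r. r * e 0) (e 1))"
    by (rule rec_prim) (auto intro!: rec_var rec_const rec_mult)
  moreover have "rec_nat 1 (\<lambda>i r. r * a) b = a ^ b" for a b :: nat by (induction b) auto
  ultimately show "rec 2 (\<lambda>e. e 0 ^ e 1)" by simp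
qed

lemma rec_diff: "rec k a \<Longrightarrow> rec k b \<Longrightarrow> rec k (\<lambda>e. a e - b e)"
proof (rule rec_comp2[where F = "(-)"])
  have "rec 1 (\<lambda>e. rec_nat 0 (\<lambda>i r. i) (e 0))"
    by (rule rec_prim) (auto intro!: rec_var rec_const)
  moreover have "rec_nat 0 (\<lambda>i r. i) a = a - 1" for a by (cases a) auto
  ultimately have *: "rec 1 (\<lambda>e. e 0 - 1)" by simp
  have "rec 2 (\<lambda>e. rec_nat (e 0) (\<lambda>i r. r - 1) (e 1))"
    by (rule rec_prim) (auto intro!: rec_var rec_comp1[where F = "\<lambda>a. a - 1", OF *, simplified])
  moreover have "rec_nat a (\<lambda>i r. r - 1) b = a - b" for a b :: nat by (induction b) auto
  ultimately show "rec 2 (\<lambda>e. e 0 - e 1)" by simp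
qed

lemma rec_of_bool_not:
  assumes "rec k (\<lambda>e. of_bool (P e))" shows "rec k (\<lambda>e. of_bool (\<not> P e))"
proof -
  have "of_bool (\<not> b) = (1 :: nat) - of_bool b" for b by simp
  then show ?thesis using rec_diff[OF rec_const[of k 1] assms] by presburger
qed

lemma rec_of_bool_conj:
  "rec k (\<lambda>e. of_bool (P e)) \<Longrightarrow> rec k (\<lambda>e. of_bool (Q e)) \<Longrightarrow> rec k (\<lambda>e. of_bool (P e \<and> Q e))"
  using rec_mult[of k "\<lambda>e. of_bool (P e)" "\<lambda>e. of_bool (Q e)"] by (simp add: of_bool_conj)

lemma rec_of_bool_le:
  assumes "rec k a" "rec k b" shows "rec k (\<lambda>e. of_bool (a e \<le> b e))"
proof -
  have "1 - (a - b) = of_bool (a \<le> b)" for a b :: nat by auto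
  then show ?thesis using rec_diff[OF rec_const[of k 1] rec_diff[OF assms]] by simp
qed

lemma rec_of_bool_less:
  "rec k a \<Longrightarrow> rec k b \<Longrightarrow> rec k (\<lambda>e. of_bool (a e < b e))"
  unfolding Suc_le_eq[symmetric] by (intro rec_of_bool_le rec_Suc)

lemma rec_of_bool_eq:
  "rec k a \<Longrightarrow> rec k b \<Longrightarrow> rec k (\<lambda>e. of_bool (a e = b e))"
  unfolding order.eq_iff by (intro rec_of_bool_conj rec_of_bool_le)

lemma rec_of_bool_iff:
  assumes "rec k (\<lambda>e. of_bool (P e))" "rec k (\<lambda>e. of_bool (Q e))"
  shows "rec k (\<lambda>e. of_bool (P e \<longleftrightarrow> Q e))"
  using rec_of_bool_eq[OF assms] by (simp add: of_bool_eq_iff)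

lemma rec_of_bool_imp:
  "rec k (\<lambda>e. of_bool (P e)) \<Longrightarrow> rec k (\<lambda>e. of_bool (Q e)) \<Longrightarrow> rec k (\<lambda>e. of_bool (P e \<longrightarrow> Q e))"
  unfolding imp_conv_disj de_Morgan_conj[of P Q for P Q, symmetric]
  using rec_of_bool_not[OF rec_of_bool_conj[OF _ rec_of_bool_not], of k P Q] by simp

lemma rec_if:
  assumes "rec k (\<lambda>e. of_bool (P e))" "rec k a" "rec k b"
  shows "rec k (\<lambda>e. if P e then a e else b e)"
proof -
  have "of_bool P * a + of_bool (\<not> P) * b = (if P then a else b)" for P and a b :: nat by auto
  then show ?thesis
    using rec_add[OF rec_mult[OF assms(1,2)] rec_mult[OF rec_of_bool_not[OF assms(1)] assms(3)]] by simp
qed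

lemma rec_sum:
  assumes "rec k b" "rec (Suc k) (\<lambda>e. F (e 0) (\<lambda>i. e (Suc i)))"
  shows "rec k (\<lambda>e. \<Sum>t<b e. F t e)"
proof -
  have *: "rec_nat 0 (\<lambda>i r. r + F i e) m = (\<Sum>t<m. F t e)" for e m by (induction m) auto
  \<comment> \<open>Weakening: \<open>rec_prim\<close> hands its step function the accumulator at
    position 1, which the summand has to skip.\<close>
  have "rec (Suc (Suc k)) (\<lambda>e. F (e 0) (\<lambda>i. e (Suc (Suc i))))"
  proof -
    let ?gs = "(\<lambda>e. e 0) # map (\<lambda>j e. e (Suc (Suc j))) [0..<k]"
    have "rec (Suc (Suc k)) (\<lambda>e. F (map (\<lambda>g. g e) ?gs ! 0) (\<lambda>i. map (\<lambda>g. g e) ?gs ! Suc i))"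
      by (rule rec_comp[where gs = ?gs and f = "\<lambda>e. F (e 0) (\<lambda>i. e (Suc i))"])
        (use assms(2) in \<open>auto intro: rec_var\<close>)
    then obtain p where p: "\<And>xs. length xs = Suc (Suc k) \<Longrightarrow>
      computes p xs (F (map (\<lambda>g. g ((!) xs)) ?gs ! 0) (\<lambda>i. map (\<lambda>g. g ((!) xs)) ?gs ! Suc i))"
      unfolding rec_def by blast
    have "computes p xs (F (xs ! 0) (\<lambda>i. xs ! Suc (Suc i)))" if l: "length xs = Suc (Suc k)" for xs
    proof -
      obtain x y zs where xs: "xs = x # y # zs" "length zs = k" using l by (auto simp: length_Suc_conv)
      have "map ((!) zs) [0..<k] = zs" using xs map_nth by blast
      then show ?thesis using p[OF l] xs by (simp add: o_def)
    qed
    then show ?thesis unfolding rec_def by blast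
  qed
  then have "rec k (\<lambda>e. rec_nat 0 (\<lambda>i r. r + F i e) (b e))"
    by (intro rec_prim) (use assms in \<open>auto intro!: rec_add rec_var rec_const\<close>)
  then show ?thesis by (simp add: *)
qed

lemma rec_of_bool_all:
  assumes "rec k b" "rec (Suc k) (\<lambda>e. of_bool (P (e 0) (\<lambda>i. e (Suc i))))"
  shows "rec k (\<lambda>e. of_bool (\<forall>t<b e. P t e))"
proof -
  have *: "(\<forall>t<b. P t e) \<longleftrightarrow> (\<Sum>t<b. of_bool (\<not> P t e)) = (0::nat)" for b e
    by auto
  show ?thesis
    unfolding * by (intro rec_of_bool_eq rec_sum rec_const rec_of_bool_not assms)
qed

text \<open>The quotient counts the positive multiples of the divisor up to the dividend. The guard
  \<open>0 < b\<close> matters: for \<open>b = 0\<close> the count would be \<open>a\<close>,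
  whereas \<open>a div 0 = 0\<close>.\<close>

lemma rec_div: "rec k a \<Longrightarrow> rec k b \<Longrightarrow> rec k (\<lambda>e. a e div b e)"
proof (rule rec_comp2[where F = "(div)"])
  have "rec 2 (\<lambda>e. \<Sum>t<e 0. of_bool (Suc t * e 1 \<le> e 0 \<and> 0 < e 1))"
    by (intro rec_sum rec_of_bool_conj rec_of_bool_le rec_of_bool_less rec_mult rec_Suc rec_var rec_const) auto
  moreover have "(\<Sum>t<a. of_bool (Suc t * b \<le> a \<and> 0 < b)) = a div b" for a b :: nat
  proof (cases "b = 0")
    case False
    have "(t < a \<and> Suc t * b \<le> a) \<longleftrightarrow> t < a div b" for t
    proof -
      have "Suc t * b \<le> a \<longleftrightarrow> t < a div b"
        using False by (simp only: less_eq_div_iff_mult_less_eq[symmetric] Suc_le_eq)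
      moreover have "a div b \<le> a" by simp
      ultimately show ?thesis by (auto intro: less_le_trans)
    qed
    then have "{..<a} \<inter> {t. Suc t * b \<le> a} = {..<a div b}" by auto
    then show ?thesis using False by (simp add: of_bool_def sum.If_cases del: mult_Suc)
  qed simp
  ultimately show "rec 2 (\<lambda>e. e 0 div e 1)" by simp
qed

lemma rec_mod: "rec k a \<Longrightarrow> rec k b \<Longrightarrow> rec k (\<lambda>e. a e mod b e)"
  unfolding modulo_nat_def by (intro rec_diff rec_mult rec_div)

lemma computable_if_rec: "rec 1 (\<lambda>e. f (e 0)) \<Longrightarrow> computable f"
proof -
  assume "rec 1 (\<lambda>e. f (e 0))"
  then obtain p where p: "\<And>xs. length xs = 1 \<Longrightarrow> computes p xs (f (xs ! 0))"
    unfolding rec_def by blast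
  have "computes p [n] (f n)" for n using p[of "[n]"] by simp
  then show ?thesis unfolding computable_def by blast
qed

lemmas rec_intros = rec_var rec_Suc rec_const rec_add rec_mult rec_power rec_diff rec_div rec_mod
  rec_of_bool_not rec_of_bool_conj rec_of_bool_imp rec_of_bool_le rec_of_bool_less rec_of_bool_iff
  rec_of_bool_eq rec_if rec_sum rec_of_bool_all

section \<open>Computable avoidance of small sets\<close>

text \<open>If \<open>t\<close> indexes a dyadic interval, \<open>t div 2 ^ d\<close> indexes its
  ancestor \<open>d\<close> levels up. Refining by \<open>d\<close> levels thus multiplies every
  count by \<open>2 ^ d\<close>, which makes counts at different levels comparable.\<close>

lemma card_div_pow2:
  fixes a b d :: nat
  shows "card {t \<in> {a * 2 ^ d..<b * 2 ^ d}. P (t div 2 ^ d)} = 2 ^ d * card {s \<in> {a..<b}. P s}"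
proof -
  let ?f = "\<lambda>(s :: nat, i :: nat). s * 2 ^ d + i"
  have "bij_betw ?f ({s \<in> {a..<b}. P s} \<times> {..<2 ^ d}) {t \<in> {a * 2 ^ d..<b * 2 ^ d}. P (t div 2 ^ d)}"
    (is "bij_betw _ ?A ?B")
  proof (rule bij_betwI[where g = "\<lambda>t. (t div 2 ^ d, t mod 2 ^ d)"])
    show "?f \<in> ?A \<rightarrow> ?B"
    proof (clarsimp, intro conjI)
      fix s i :: nat assume *: "a \<le> s" "s < b" "i < 2 ^ d"
      show "a * 2 ^ d \<le> s * 2 ^ d + i" using * by (simp add: trans_le_add1)
      have "Suc s * 2 ^ d \<le> b * 2 ^ d" using * by (intro mult_le_mono1) simp
      then show "s * 2 ^ d + i < b * 2 ^ d" using *(3) by simp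
    qed
    show "(\<lambda>t. (t div 2 ^ d, t mod 2 ^ d)) \<in> ?B \<rightarrow> ?A"
      by (auto simp: less_eq_div_iff_mult_less_eq div_less_iff_less_mult)
  qed (auto simp: div_mult_mod_eq)
  then show ?thesis by (auto simp: card_cartesian_product mult.commute dest!: bij_betw_same_card)
qed

text \<open>Joins the two forms of a count: sums are recursive by \<open>rec_sum\<close>,
  cardinalities are easier to reason about.\<close>

lemma card_eq_sum_offset:
  fixes a L :: nat
  shows "card {t \<in> {a..<a + L}. P t} = (\<Sum>i<L. of_bool (P (a + i)))"
proof -
  have "(\<Sum>i<L. of_bool (P (a + i))) = (\<Sum>i\<in>{0..<L}. of_bool (P (i + a)))"
    by (simp add: add.commute lessThan_atLeast0)
  also have "\<dots> = (\<Sum>t\<in>{0 + a..<L + a}. of_bool (P t) :: nat)"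
    by (rule sum.shift_bounds_nat_ivl[symmetric])
  also have "\<dots> = card {t \<in> {a..<a + L}. P t}"
    by (simp add: add.commute Int_def conj_ac)
  finally show ?thesis by simp
qed

text \<open>
  Turing's bisection: with \<open>U\<^sub>n\<close> the set avoiding the first \<open>n + 1\<close> bad sets, always pass to the half
  on which \<open>U\<^sub>n\<close> is larger. The \<open>(n + 1)\<close>-st bad set has measure at most \<open>4\<^sup>-\<^sup>n / 64\<close>, hence relative
  measure at most \<open>2\<^sup>-\<^sup>n / 64\<close> in an interval of length \<open>2\<^sup>-\<^sup>n\<close>, so the relative measure of \<open>U\<^sub>n\<close>
  never drops below \<open>1/2\<close>.
\<close>

lemma computable_avoidance:
  fixes cert :: "nat \<Rightarrow> nat \<Rightarrow> nat \<Rightarrow> bool"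
  assumes cert: "rec 3 (\<lambda>e. of_bool (cert (e 0) (e 1) (e 2)))"
    and dens: "\<And>n. \<exists>m. 16 * 4 ^ n * card {s \<in> {2 ^ m..<2 ^ m + 2 ^ m}. \<not> cert n m s} \<le> (2 :: nat) ^ m"
  obtains s m where "s 0 = (1 :: nat)" "\<And>n. s (Suc n) div 2 = s n" "rec 1 (\<lambda>e. s (e 0))"
    "\<And>n :: nat. cert n (m n) (s (m n))"
proof -
  \<comment> \<open>The indices from \<open>2 ^ y\<close> up to \<open>2 ^ (y + 1)\<close> are the
    intervals of level \<open>y\<close> inside [1, 2). The condition is negated because the search
    looks for a zero.\<close>
  define m where "m n = (LEAST y. of_bool (\<not> 16 * 4 ^ n *
    (\<Sum>i<2 ^ y. of_bool (\<not> cert n y (2 ^ y + i))) \<le> (2 :: nat) ^ y) = (0 :: nat))" for n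
  \<comment> \<open>A common level, at least as fine as \<open>n\<close> and as every
    \<open>m k\<close> with \<open>k \<le> n\<close>, at which the first \<open>n + 1\<close>
    certificates can be tested together.\<close>
  define K where "K n = n + (\<Sum>k<Suc n. m k)" for n
  define ok where "ok n t \<longleftrightarrow> (\<forall>k<Suc n. cert k (m k) (t div 2 ^ (K n - m k)))" for n t
  \<comment> \<open>Here \<open>s\<close> is an index of level \<open>n\<close>; it has
    \<open>2 ^ (K n - n)\<close> descendants of level \<open>K n\<close>.\<close>
  define cnt where "cnt n s = (\<Sum>i<2 ^ (K n - n). of_bool (ok n (s * 2 ^ (K n - n) + i)) :: nat)" for n s
  define s where "s = rec_nat 1 (\<lambda>i r. if cnt (Suc i) (2 * r + 1) \<le> cnt (Suc i) (2 * r) then 2 * r else 2 * r + 1)"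
  have rec_cert: "rec k (\<lambda>e. of_bool (cert (a e) (b e) (c e)))" if "rec k a" "rec k b" "rec k c" for k a b c
    using rec_comp3[where F = "\<lambda>a b c. of_bool (cert a b c)", OF cert that] .
  have dens': "\<exists>y. of_bool (\<not> 16 * 4 ^ n *
    (\<Sum>i<2 ^ y. of_bool (\<not> cert n y (2 ^ y + i))) \<le> (2 :: nat) ^ y) = (0 :: nat)" for n
    using dens[of n] unfolding card_eq_sum_offset by simp
  have "rec 1 (\<lambda>e. m (e 0))"
    unfolding m_def by (intro rec_Least rec_intros rec_cert dens') auto
  from rec_comp1[OF this] have rec_m: "rec k (\<lambda>e. m (a e))" if "rec k a" for k a using that .
  have rec_K: "rec k (\<lambda>e. K (a e))" if "rec k a" for k a
  proof (rule rec_comp1[OF _ that])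
    show "rec 1 (\<lambda>e. K (e 0))" unfolding K_def by (intro rec_intros rec_m) auto
  qed
  have rec_cnt: "rec k (\<lambda>e. cnt (a e) (b e))" if "rec k a" "rec k b" for k a b
  proof (rule rec_comp2[OF _ that])
    show "rec 2 (\<lambda>e. cnt (e 0) (e 1))"
      unfolding cnt_def ok_def by (intro rec_intros rec_m rec_K rec_cert) auto
  qed
  have rec_s: "rec 1 (\<lambda>e. s (e 0))"
    unfolding s_def by (intro rec_prim rec_intros rec_cnt) auto
  have s_Suc: "s (Suc n) = (if cnt (Suc n) (2 * s n + 1) \<le> cnt (Suc n) (2 * s n) then 2 * s n else 2 * s n + 1)" for n
    by (simp add: s_def)
  have bad: "16 * 4 ^ n * card {s \<in> {2 ^ m n..<2 ^ m n + 2 ^ m n}. \<not> cert n (m n) s} \<le> (2 :: nat) ^ m n" for n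
    unfolding card_eq_sum_offset using LeastI_ex[OF dens'[of n], folded m_def] by simp
  have m_le: "m k \<le> K n" if "k < Suc n" for k n
    using member_le_sum[of k "{..<Suc n}" m] that unfolding K_def by auto
  have n_le: "n \<le> K n" for n by (simp add: K_def)
  have K_Suc: "K (Suc n) = Suc (K n + m (Suc n))" for n by (simp add: K_def)
  have cnt: "cnt n s = card {t \<in> {s * 2 ^ (K n - n)..<Suc s * 2 ^ (K n - n)}. ok n t}" for n s
    unfolding cnt_def card_eq_sum_offset[symmetric] by (simp add: add.commute)
  have s_range: "s n \<in> {2 ^ n..<2 ^ Suc n}" for n
  proof (induction n)
    case 0
    then show ?case by (simp add: s_def)
  qed (auto simp: s_Suc)
  \<comment> \<open>The surplus over 1/2 is allowed to shrink by 1 / (8 * 2 ^ n) from stage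
    \<open>n\<close> to the next. The new bad set costs only 1 / (64 * 2 ^ n) relative to the
    current interval, and the better half holds at least the average.\<close>
  have inv: "2 ^ n * cnt n (s n) \<ge> 2 ^ K n * (1 / 2 + 1 / (4 * 2 ^ n) :: real)" for n
  proof (induction n)
    case 0
    let ?c = "\<lambda>P. card {t \<in> {2 ^ m 0..<2 ^ m 0 + 2 ^ m 0}. P t}"
    have "?c (cert 0 (m 0)) + ?c (\<lambda>t. \<not> cert 0 (m 0) t) = card {2 ^ m 0..<2 ^ m 0 + (2 :: nat) ^ m 0}"
      by (subst card_Un_disjoint[symmetric]) (auto intro!: arg_cong[where f = card] simp del: card_atLeastLessThan)
    then have "?c (cert 0 (m 0)) + ?c (\<lambda>t. \<not> cert 0 (m 0) t) = 2 ^ m 0" by simp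
    moreover have "16 * ?c (\<lambda>t. \<not> cert 0 (m 0) t) \<le> 2 ^ m 0" using bad[of 0] by simp
    ultimately have "4 * ?c (cert 0 (m 0)) \<ge> 3 * 2 ^ m 0" by linarith
    then have "real (4 * ?c (cert 0 (m 0))) \<ge> real (3 * 2 ^ m 0)" by (simp only: of_nat_le_iff)
    then show ?case unfolding cnt by (simp add: s_def ok_def K_def mult_2 lessThan_Suc)
  next
    case (Suc n)
    define d where "d = K (Suc n) - Suc n"
    define r where "r = s n"
    let ?A = "{r * 2 ^ Suc d..<Suc r * 2 ^ Suc d}"
    have d: "K (Suc n) - n = Suc d" using n_le[of "Suc n"] unfolding d_def by simp
    \<comment> \<open>Ancestors of ancestors are ancestors, so the old conditions at the finer level
      are those of the ancestor of level \<open>K n\<close>.\<close>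
    have ok_Suc: "ok (Suc n) t \<longleftrightarrow>
      ok n (t div 2 ^ (K (Suc n) - K n)) \<and> cert (Suc n) (m (Suc n)) (t div 2 ^ (K (Suc n) - m (Suc n)))" for t
    proof -
      have "t div 2 ^ (K (Suc n) - m k) = t div 2 ^ (K (Suc n) - K n) div 2 ^ (K n - m k)" if "k < Suc n" for k
      proof -
        have "K (Suc n) - m k = (K (Suc n) - K n) + (K n - m k)"
          using m_le[OF that] K_Suc[of n] by simp
        then show ?thesis by (simp only: power_add div_mult2_eq)
      qed
      then show ?thesis unfolding ok_def by (auto simp: less_Suc_eq)
    qed
    have "Suc d = (K (Suc n) - K n) + (K n - n)"
      using d n_le[of n] K_Suc[of n] by simp
    then have "?A = {(r * 2 ^ (K n - n)) * 2 ^ (K (Suc n) - K n)..<(Suc r * 2 ^ (K n - n)) * 2 ^ (K (Suc n) - K n)}"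
      by (simp add: power_add mult_ac del: mult_Suc power_Suc)
    then have 1: "card {t \<in> ?A. ok n (t div 2 ^ (K (Suc n) - K n))} = 2 ^ (K (Suc n) - K n) * cnt n r"
      unfolding cnt by (simp only: card_div_pow2)
    let ?bad = "{t \<in> {2 ^ K (Suc n)..<2 ^ K (Suc n) + 2 ^ K (Suc n)}. \<not> cert (Suc n) (m (Suc n)) (t div 2 ^ (K (Suc n) - m (Suc n)))}"
    have "K (Suc n) = m (Suc n) + (K (Suc n) - m (Suc n))" using m_le[of "Suc n" "Suc n"] by simp
    then have Ksplit: "(2::nat) ^ K (Suc n) = 2 ^ m (Suc n) * 2 ^ (K (Suc n) - m (Suc n))"
      by (metis power_add)
    have 2: "card ?bad = 2 ^ (K (Suc n) - m (Suc n)) * card {s \<in> {2 ^ m (Suc n)..<2 ^ m (Suc n) + 2 ^ m (Suc n)}. \<not> cert (Suc n) (m (Suc n)) s}"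
      unfolding Ksplit distrib_right[symmetric] by (rule card_div_pow2)
    have 3: "16 * 4 ^ Suc n * card ?bad \<le> 2 ^ K (Suc n)"
    proof -
      let ?D = "2 ^ (K (Suc n) - m (Suc n)) :: nat"
      have "16 * 4 ^ Suc n * card ?bad = ?D * (16 * 4 ^ Suc n *
          card {s \<in> {2 ^ m (Suc n)..<2 ^ m (Suc n) + 2 ^ m (Suc n)}. \<not> cert (Suc n) (m (Suc n)) s})"
        by (simp only: 2 mult_ac)
      also have "\<dots> \<le> ?D * 2 ^ m (Suc n)" by (intro mult_le_mono2 bad)
      also have "\<dots> = 2 ^ K (Suc n)" by (simp only: Ksplit mult.commute)
      finally show ?thesis .
    qed
    have "?A = {(2 * r) * 2 ^ d..<Suc (2 * r) * 2 ^ d} \<union> {Suc (2 * r) * 2 ^ d..<Suc (Suc (2 * r)) * 2 ^ d}"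
      by (auto simp: algebra_simps)
    then have "card {t \<in> ?A. ok (Suc n) t} = card ({t \<in> {(2 * r) * 2 ^ d..<Suc (2 * r) * 2 ^ d}. ok (Suc n) t}
       \<union> {t \<in> {Suc (2 * r) * 2 ^ d..<Suc (Suc (2 * r)) * 2 ^ d}. ok (Suc n) t})"
      by (intro arg_cong[where f = card]) auto
    also have "\<dots> = cnt (Suc n) (2 * r) + cnt (Suc n) (Suc (2 * r))"
      unfolding cnt d_def[symmetric] by (rule card_Un_disjoint) auto
    finally have 4: "card {t \<in> ?A. ok (Suc n) t} = cnt (Suc n) (2 * r) + cnt (Suc n) (Suc (2 * r))" .
    have A: "?A \<subseteq> {2 ^ K (Suc n)..<2 ^ K (Suc n) + 2 ^ K (Suc n)}"
    proof -
      have *: "K (Suc n) = n + Suc d" using d n_le[of "Suc n"] by simp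
      have e1: "(2 :: nat) ^ K (Suc n) = 2 ^ n * 2 ^ Suc d" by (simp only: * power_add)
      have e2: "(2 :: nat) ^ K (Suc n) + 2 ^ K (Suc n) = 2 ^ Suc n * 2 ^ Suc d"
        unfolding e1 by simp
      have "2 ^ K (Suc n) \<le> r * 2 ^ Suc d"
        unfolding e1 using s_range[of n] by (intro mult_le_mono1) (simp add: r_def)
      moreover have "Suc r * 2 ^ Suc d \<le> 2 ^ K (Suc n) + 2 ^ K (Suc n)"
        unfolding e2 using s_range[of n] by (intro mult_le_mono1) (simp add: r_def)
      ultimately show ?thesis by (subst ivl_subset) blast
    qed
    have "{t \<in> ?A. ok n (t div 2 ^ (K (Suc n) - K n))} \<subseteq> {t \<in> ?A. ok (Suc n) t} \<union> ?bad"
      using A ok_Suc by blast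
    from card_mono[OF _ this] have 5: "card {t \<in> ?A. ok n (t div 2 ^ (K (Suc n) - K n))} \<le> card {t \<in> ?A. ok (Suc n) t} + card ?bad"
      by (rule order_trans) (use card_Un_le in auto)
    have "cnt (Suc n) (2 * r) + cnt (Suc n) (Suc (2 * r)) \<le> 2 * cnt (Suc n) (s (Suc n))"
      unfolding s_Suc r_def by auto
    with 1 4 5 have "2 ^ (K (Suc n) - K n) * cnt n r \<le> 2 * cnt (Suc n) (s (Suc n)) + card ?bad" by linarith
    then have "real (2 ^ (K (Suc n) - K n) * cnt n r) \<le> real (2 * cnt (Suc n) (s (Suc n)) + card ?bad)"
      by (simp only: of_nat_le_iff)
    from mult_left_mono[OF this, of "2 ^ n :: real"]
    have "2 ^ n * (2 ^ (K (Suc n) - K n) * cnt n r) \<le> 2 ^ Suc n * cnt (Suc n) (s (Suc n)) + 2 ^ n * real (card ?bad)"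
      by (simp add: algebra_simps)
    moreover have "2 ^ n * (2 ^ (K (Suc n) - K n) * cnt n r) \<ge> 2 ^ (K (Suc n) - K n) * (2 ^ K n * (1 / 2 + 1 / (4 * 2 ^ n) :: real))"
      using mult_left_mono[OF Suc.IH, of "2 ^ (K (Suc n) - K n)"] unfolding r_def by (simp add: mult_ac)
    moreover have "2 ^ (K (Suc n) - K n) * (2 ^ K n * (1 / 2 + 1 / (4 * 2 ^ n) :: real)) = 2 ^ K (Suc n) * (1 / 2 + 1 / (4 * 2 ^ n))"
      using K_Suc[of n] by (simp only: mult.assoc[symmetric] power_add[symmetric]) simp
    moreover have "2 ^ n * real (card ?bad) \<le> 2 ^ K (Suc n) * (1 / (64 * 2 ^ n))"
    proof -
      have "real (16 * 4 ^ Suc n * card ?bad) \<le> real (2 ^ K (Suc n))" using 3 by (simp only: of_nat_le_iff)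
      moreover have "(4 :: real) ^ n = 2 ^ n * 2 ^ n" by (simp flip: power_mult_distrib)
      ultimately show ?thesis by (simp add: field_simps)
    qed
    moreover have "(2::real) ^ K (Suc n) * (1 / 2 + 1 / (4 * 2 ^ n)) - 2 ^ K (Suc n) * (1 / (64 * 2 ^ n)) \<ge> 2 ^ K (Suc n) * (1 / 2 + 1 / (4 * 2 ^ Suc n))"
      unfolding right_diff_distrib[symmetric] by (rule mult_left_mono) (auto simp: field_simps)
    ultimately show ?case by linarith
  qed
  have s_div: "s (Suc n) div 2 = s n" for n by (simp add: s_Suc)
  have s_div_pow: "s (n + k) div 2 ^ k = s n" for n k
    by (induction k) (auto simp: div_mult2_eq s_div)
  have "cert n (m n) (s (m n))" for n
  proof -
    \<comment> \<open>\<open>m n\<close> may lie on either side of \<open>n\<close>. At stage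
      \<open>N\<close> both are reached, and since the count is positive some descendant of
      \<open>s N\<close> passes all tests; its ancestor of level \<open>m n\<close> is
      \<open>s (m n)\<close>.\<close>
    define N where "N = max n (m n)"
    have "(0::real) < 2 ^ K N * (1 / 2 + 1 / (4 * 2 ^ N))" by (simp add: add_pos_pos)
    then have "cnt N (s N) \<noteq> 0" using inv[of N] by (intro notI) simp
    then have "{t \<in> {s N * 2 ^ (K N - N)..<Suc (s N) * 2 ^ (K N - N)}. ok N t} \<noteq> {}"
      unfolding cnt by (metis card.empty)
    then obtain t where t: "s N * 2 ^ (K N - N) \<le> t" "t < Suc (s N) * 2 ^ (K N - N)" "ok N t" by auto
    have "t div 2 ^ (K N - N) = s N"
      using t(1,2) by (intro div_nat_eqI) (auto simp: mult_ac)
    moreover have "t div 2 ^ (K N - m n) = t div 2 ^ (K N - N) div 2 ^ (N - m n)"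
    proof -
      have "K N - m n = (K N - N) + (N - m n)" using n_le[of N] by (simp add: N_def)
      then show ?thesis by (simp only: power_add div_mult2_eq)
    qed
    moreover have "s N div 2 ^ (N - m n) = s (m n)" using s_div_pow[of "m n" "N - m n"] by (simp add: N_def)
    ultimately have "t div 2 ^ (K N - m n) = s (m n)" by simp
    then show ?thesis using t(3) unfolding ok_def N_def by (metis less_Suc_eq_le max.cobounded1)
  qed
  then show ?thesis using that[of s m] s_div rec_s by (simp add: s_def)
qed

section \<open>Deviations of visit frequencies\<close>

text \<open>With truncated subtraction, \<open>(i - j) + (j - i)\<close> is the distance of
  \<open>i\<close> and \<open>j\<close>. The geometric series give at most 1 for
  \<open>j < i\<close> and at most 2 for \<open>j \<ge> i\<close>.\<close>

lemma sum_half_power_dist_le: "(\<Sum>j<N. (1 / 2 :: real) ^ ((i - j) + (j - i))) \<le> 3"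
proof -
  have 1: "(\<Sum>j<N. (1 / 2 :: real) ^ ((i - j) + (j - i))) \<le> (1 / 2) ^ (i - N)" if "N \<le> i" for N
    using that
  proof (induction N)
    case (Suc N)
    then have "i - N = Suc (i - Suc N)" by simp
    then show ?case using Suc by simp
  qed simp
  have 2: "(\<Sum>j<i + k. (1 / 2 :: real) ^ ((i - j) + (j - i))) \<le> 3 - 2 * (1 / 2) ^ k" for k
    by (induction k) (use 1[of i] in auto)
  show ?thesis
  proof (cases "N \<le> i")
    case True
    then show ?thesis using 1[OF True] power_le_one[of "1 / 2 :: real" "i - N"] by simp
  next
    case False
    then have "i + (N - i) = N" by simp
    then show ?thesis
      using order_trans[OF 2[of "N - i"], of 3] zero_le_power[of "1 / 2 :: real" "N - i"] by simp
  qed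
qed

text \<open>The geometric decay makes the double sum over pairs of times exceed the squared mean by
  at most \<open>3 * N\<close>, so the variance grows only linearly. Since the variance is bounded
  from above only, a one-sided bound on the correlations of \<open>A\<close> with itself
  suffices.\<close>

lemma (in prob_space) prob_visits_deviation_le:
  assumes T[measurable]: "T \<in> measurable M M"
    and inv: "\<And>A. A \<in> sets M \<Longrightarrow> prob (T -` A \<inter> space M) = prob A"
    and A[measurable]: "A \<in> sets M"
    and corr: "\<And>n. prob (A \<inter> ((T ^^ n) -` A \<inter> space M)) \<le> (prob A)\<^sup>2 + (1 / 2) ^ n"
    and pos: "0 < \<epsilon>" "0 < N"
  shows "prob {x \<in> space M. \<epsilon> * real N \<le> \<bar>real (card {j. j < N \<and> (T ^^ j) x \<in> A}) - real N * prob A\<bar>}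
    \<le> 3 / (\<epsilon>\<^sup>2 * real N)"
proof -
  have Tn[measurable]: "T ^^ n \<in> measurable M M" for n
    by (induction n) (auto intro: measurable_comp[OF _ T])
  have inv': "prob ((T ^^ n) -` B \<inter> space M) = prob B" if "B \<in> sets M" for B n
    using that
  proof (induction n arbitrary: B)
    case 0
    then show ?case using sets.sets_into_space by (auto intro!: arg_cong[where f = prob])
  next
    case (Suc n)
    have "(T ^^ Suc n) -` B \<inter> space M = T -` ((T ^^ n) -` B \<inter> space M) \<inter> space M"
      using measurable_space[OF T] by (auto simp: funpow_swap1)
    moreover have "(T ^^ n) -` B \<inter> space M \<in> sets M" using Suc.prems by measurable
    ultimately show ?case using inv Suc by metis
  qed
  define X :: "nat \<Rightarrow> 'a \<Rightarrow> real" where "X j x = indicator A ((T ^^ j) x)" for j x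
  define S where "S x = (\<Sum>j<N. X j x)" for x
  have X[measurable]: "X j \<in> borel_measurable M" for j unfolding X_def by measurable
  have X_le: "norm (X j x) \<le> 1" "\<bar>X j x\<bar> \<le> 1" for j x by (auto simp: X_def indicator_def)
  have iX: "integrable M (X j)" for j
    by (rule integrable_const_bound[where B = 1]) (auto simp: X_le)
  have iXX: "integrable M (\<lambda>x. X i x * X j x)" for i j
    by (rule integrable_const_bound[where B = 1]) (auto simp: X_def indicator_def)
  have EX: "expectation (X j) = prob A" for j
  proof -
    have "expectation (X j) = expectation (indicator ((T ^^ j) -` A \<inter> space M))"
      by (intro Bochner_Integration.integral_cong refl) (simp add: X_def indicator_def)
    then show ?thesis using inv'[OF A] by (simp add: sets.sets_into_space)
  qed
  \<comment> \<open>By invariance the times \<open>i \<le> j\<close> can be replaced by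
    \<open>0\<close> and \<open>j - i\<close>.\<close>
  have EXX': "expectation (\<lambda>x. X i x * X j x) \<le> (prob A)\<^sup>2 + (1 / 2) ^ (j - i)" if "i \<le> j" for i j
  proof -
    let ?B = "A \<inter> ((T ^^ (j - i)) -` A \<inter> space M)"
    have "(T ^^ j) x = (T ^^ (j - i)) ((T ^^ i) x)" for x
      using that funpow_add[of "j - i" i T] by simp
    then have "expectation (\<lambda>x. X i x * X j x) = expectation (indicator ((T ^^ i) -` ?B \<inter> space M))"
      using measurable_space[OF Tn[of i]]
      by (intro Bochner_Integration.integral_cong refl) (simp add: X_def indicator_def)
    also have "\<dots> = prob ?B" using inv'[of ?B i] by simp
    finally show ?thesis using corr[of "j - i"] by simp
  qed
  have EXX: "expectation (\<lambda>x. X i x * X j x) \<le> (prob A)\<^sup>2 + (1 / 2) ^ ((i - j) + (j - i))" for i j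
    using EXX'[of i j] EXX'[of j i] by (cases "i \<le> j") (auto simp: mult.commute)
  have S2: "(S x)\<^sup>2 = (\<Sum>i<N. \<Sum>j<N. X i x * X j x)" for x
    by (simp add: S_def power2_eq_square sum_product)
  have ES: "expectation S = real N * prob A"
    unfolding S_def by (subst Bochner_Integration.integral_sum) (auto simp: iX EX)
  have "expectation (\<lambda>x. (S x)\<^sup>2) = (\<Sum>i<N. \<Sum>j<N. expectation (\<lambda>x. X i x * X j x))"
    unfolding S2 by (subst Bochner_Integration.integral_sum, intro Bochner_Integration.integrable_sum iXX)
      (intro sum.cong refl Bochner_Integration.integral_sum iXX)
  also have "\<dots> \<le> (\<Sum>i<N. \<Sum>j<N. (prob A)\<^sup>2 + (1 / 2) ^ ((i - j) + (j - i)))"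
    by (intro sum_mono EXX)
  also have "\<dots> \<le> (\<Sum>i<N. real N * (prob A)\<^sup>2 + 3)"
    by (intro sum_mono) (simp add: sum.distrib sum_half_power_dist_le)
  also have "\<dots> = (real N * prob A)\<^sup>2 + 3 * real N" by (simp add: power2_eq_square algebra_simps)
  finally have ES2: "expectation (\<lambda>x. (S x)\<^sup>2) \<le> (real N * prob A)\<^sup>2 + 3 * real N" .
  have iS: "integrable M S" unfolding S_def by (intro Bochner_Integration.integrable_sum iX)
  have iS2: "integrable M (\<lambda>x. (S x)\<^sup>2)" unfolding S2 by (intro Bochner_Integration.integrable_sum iXX)
  have S_card: "S x = real (card {j. j < N \<and> (T ^^ j) x \<in> A})" for x
    by (simp add: S_def X_def indicator_def sum.If_cases Int_def flip: sum.inter_filter)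
  have "prob {x \<in> space M. \<epsilon> * real N \<le> \<bar>S x - expectation S\<bar>} \<le> variance S / (\<epsilon> * real N)\<^sup>2"
    using iS pos by (intro Chebyshev_inequality iS2) auto
  also have "\<dots> \<le> 3 * real N / (\<epsilon> * real N)\<^sup>2"
    using variance_eq[OF iS iS2] ES ES2 by (intro divide_right_mono) auto
  also have "\<dots> = 3 / (\<epsilon>\<^sup>2 * real N)" using pos by (simp add: power2_eq_square field_simps)
  finally show ?thesis unfolding ES S_card .
qed

section \<open>The Gauss map\<close>

definition gauss_map :: "real \<Rightarrow> real" where "gauss_map t = frac (1 / t)"

text \<open>The conditional probability, under the Gauss measure, that a point with Gauss image
  \<open>y\<close> has first digit \<open>k + 1\<close>. With u = k + 1 + y it is the density 1 / (1
  + 1/u) at the branch point 1/u, times the Jacobian 1 / u^2, divided by the density 1 / (1 + y) at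
  \<open>y\<close>.\<close>

definition gauss_weight :: "nat \<Rightarrow> real \<Rightarrow> real" where
  "gauss_weight k y = (1 + y) / ((real k + 1 + y) * (real k + 2 + y))"

text \<open>
  The transfer operator of the Gauss map with respect to the Gauss measure. It maps monotone
  functions to monotone functions of at most half the oscillation, which makes the Gauss map mix
  exponentially fast on initial intervals.
\<close>

definition gauss_transfer :: "(real \<Rightarrow> real) \<Rightarrow> real \<Rightarrow> real" where
  "gauss_transfer f y = (\<Sum>k. gauss_weight k y * f (1 / (real k + 1 + y)))"

lemma gauss_weight_nonneg: "0 \<le> y \<Longrightarrow> 0 \<le> gauss_weight k y"
  by (simp add: gauss_weight_def)

text \<open>Partial fractions make the weights telescope, which gives their sum 1 and explicit
  tails.\<close>

lemma gauss_weight_eq: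
  assumes "0 \<le> y"
  shows "gauss_weight k y = (1 + y) / (real k + 1 + y) - (1 + y) / (real (Suc k) + 1 + y)"
proof -
  have "real k + 1 + y \<noteq> 0" "real (Suc k) + 1 + y \<noteq> 0" using assms by linarith+
  then show ?thesis by (simp add: gauss_weight_def diff_frac_eq algebra_simps)
qed

lemma sum_gauss_weight:
  assumes "0 \<le> y" shows "(\<Sum>k<n. gauss_weight k y) = 1 - (1 + y) / (real n + 1 + y)"
  using assms by (induction n) (auto simp: gauss_weight_eq)

lemma gauss_weight_sums: "0 \<le> y \<Longrightarrow> (\<lambda>k. gauss_weight k y) sums 1"
proof -
  assume y: "0 \<le> y"
  have "(\<lambda>n. (1 + y) / ((1 + y) + real n)) \<longlonglongrightarrow> 0"
    by (intro tendsto_divide_0[OF tendsto_const] filterlim_at_top_imp_at_infinity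
        filterlim_tendsto_add_at_top[OF tendsto_const] filterlim_real_sequentially)
  from tendsto_diff[OF tendsto_const this, of 1]
  show ?thesis unfolding sums_def sum_gauss_weight[OF y] by (simp add: add_ac)
qed

lemma inverse_branch_mem: "0 \<le> y \<Longrightarrow> 1 / (real k + 1 + y) \<in> {0..1}"
  by (simp add: divide_le_eq_1)

context
  fixes f :: "real \<Rightarrow> real"
  assumes f01: "\<And>x. x \<in> {0..1} \<Longrightarrow> f x \<in> {0..1}"
begin

lemma summable_gauss_transfer:
  assumes "0 \<le> y" shows "summable (\<lambda>k. gauss_weight k y * f (1 / (real k + 1 + y)))"
proof (rule summable_comparison_test'[where g = "\<lambda>k. gauss_weight k y" and N = 0])
  fix k
  show "norm (gauss_weight k y * f (1 / (real k + 1 + y))) \<le> gauss_weight k y"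
    using gauss_weight_nonneg[OF assms, of k] f01[OF inverse_branch_mem[OF assms, of k]]
    by (auto simp: abs_mult intro: mult_left_le)
qed (use gauss_weight_sums[OF assms] in \<open>simp add: sums_iff\<close>)

lemma gauss_transfer_mem:
  assumes "0 \<le> y" shows "gauss_transfer f y \<in> {0..1}"
proof -
  note w = gauss_weight_nonneg[OF assms] and f = f01[OF inverse_branch_mem[OF assms]]
  have "gauss_transfer f y \<le> (\<Sum>k. gauss_weight k y)"
    unfolding gauss_transfer_def using summable_gauss_transfer[OF assms] gauss_weight_sums[OF assms] w f
    by (intro suminf_le) (auto simp: sums_iff intro: mult_left_le)
  moreover have "0 \<le> gauss_transfer f y"
    unfolding gauss_transfer_def using summable_gauss_transfer[OF assms] w f
    by (intro suminf_nonneg) auto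
  ultimately show ?thesis using gauss_weight_sums[OF assms] by (simp add: sums_iff)
qed

text \<open>The operator reverses monotonicity, so both orientations occur under iteration.
  Reflection reduces decreasing functions to increasing ones while keeping the values in
  [0, 1].\<close>

lemma gauss_transfer_compl:
  assumes "0 \<le> y" shows "gauss_transfer (\<lambda>x. 1 - f x) y = 1 - gauss_transfer f y"
  using suminf_diff[OF sums_summable[OF gauss_weight_sums[OF assms]] summable_gauss_transfer[OF assms]]
    sums_unique[OF gauss_weight_sums[OF assms]]
  by (simp add: gauss_transfer_def right_diff_distrib)

text \<open>
  The tails \<open>(1 + y) / (n + 1 + y)\<close> of the weights increase with \<open>y\<close>, so that increasing \<open>y\<close> shifts
  mass to the branches closer to \<open>0\<close>, and it moves every branch point towards \<open>0\<close> as well.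
\<close>

lemma gauss_transfer_antimono:
  assumes mono: "mono_on {0..1} f" and xy: "0 \<le> x" "x \<le> y"
  shows "gauss_transfer f y \<le> gauss_transfer f x"
proof -
  define a where "a k = f (1 / (real k + 1 + x))" for k
  have y: "0 \<le> y" using xy by simp
  have a_nonneg: "0 \<le> a k" for k using f01[OF inverse_branch_mem[OF xy(1)]] by (auto simp: a_def)
  have a_Suc: "a (Suc k) \<le> a k" for k
    unfolding a_def using xy inverse_branch_mem[OF xy(1)]
    by (intro mono_onD[OF mono] inverse_branch_mem) (auto intro!: divide_left_mono mult_pos_pos)
  define D where "D n = (1 + y) / (real n + 1 + y) - (1 + x) / (real n + 1 + x)" for n
  have D: "0 \<le> D n" for n
  proof -
    have "real n + 1 + x > 0" "real n + 1 + y > 0" using xy by linarith+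
    moreover have "(1 + x) * (real n + 1 + y) \<le> (1 + y) * (real n + 1 + x)"
      using mult_left_mono[OF xy(2), of "real n"] by (simp add: algebra_simps)
    ultimately show ?thesis by (simp add: D_def divide_simps mult.commute)
  qed
  have D_Suc: "gauss_weight n x - gauss_weight n y = D (Suc n) - D n" for n
    using sum_gauss_weight[of x "Suc n"] sum_gauss_weight[of x n]
      sum_gauss_weight[of y "Suc n"] sum_gauss_weight[of y n] xy unfolding D_def by simp
  \<comment> \<open>Summation by parts as an induction: the partial sums of the weight differences
    are the nonnegative numbers \<open>D n\<close>, and the sequence \<open>a\<close> is
    nonincreasing.\<close>
  have "D n * a n \<le> (\<Sum>k<n. (gauss_weight k x - gauss_weight k y) * a k)" for n
  proof (induction n)
    case 0
    show ?case using xy by (simp add: D_def)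
  next
    case (Suc n)
    have "D (Suc n) * a (Suc n) \<le> D (Suc n) * a n" by (intro mult_left_mono a_Suc D)
    then show ?case using Suc unfolding sum.lessThan_Suc D_Suc left_diff_distrib by linarith
  qed
  then have "0 \<le> (\<Sum>k<n. (gauss_weight k x - gauss_weight k y) * a k)" for n
    using mult_nonneg_nonneg[OF D[of n] a_nonneg[of n]] by (rule order_trans[rotated])
  then have partial: "(\<Sum>k<n. gauss_weight k y * a k) \<le> (\<Sum>k<n. gauss_weight k x * a k)" for n
    by (simp add: left_diff_distrib sum_subtractf)
  have "(\<Sum>k<n. gauss_weight k y * f (1 / (real k + 1 + y))) \<le> (\<Sum>k<n. gauss_weight k y * a k)" for n
    unfolding a_def using xy y
    by (intro sum_mono mult_left_mono mono_onD[OF mono] inverse_branch_mem gauss_weight_nonneg)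
      (auto intro!: divide_left_mono mult_pos_pos)
  with partial have "(\<Sum>k<n. gauss_weight k y * f (1 / (real k + 1 + y)))
    \<le> (\<Sum>k<n. gauss_weight k x * f (1 / (real k + 1 + x)))" for n
    using order_trans unfolding a_def by blast
  then show ?thesis
    unfolding gauss_transfer_def using summable_gauss_transfer[OF y] summable_gauss_transfer[OF xy(1)]
    by (intro LIMSEQ_le[OF summable_LIMSEQ summable_LIMSEQ]) auto
qed

text \<open>At \<open>0\<close> the first branch has weight 1/2 and hits the point 1; the other
  branches are those at \<open>1\<close> with half the weight. So the difference equals
  \<open>f 1 / 2\<close> minus half of \<open>gauss_transfer f 1\<close>, and the latter half is at
  least \<open>f 0 / 2\<close>. This is where the contraction factor 1/2 comes from.\<close>

lemma gauss_transfer_osc: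
  assumes mono: "mono_on {0..1} f"
  shows "gauss_transfer f 0 - gauss_transfer f 1 \<le> (f 1 - f 0) / 2"
proof -
  define b where "b k = f (1 / (real k + 2))" for k
  define w where "w k = gauss_weight k 1 / 2" for k
  have "gauss_weight (Suc k) 0 = w k" for k by (simp add: gauss_weight_def w_def add_ac)
  then have "gauss_transfer f 0 = f 1 / 2 + (\<Sum>k. w k * b k)"
    unfolding gauss_transfer_def using suminf_split_head[OF summable_gauss_transfer[of 0]]
    by (simp add: b_def gauss_weight_def add.commute)
  moreover have "gauss_transfer f 1 = (\<Sum>k. 2 * (w k * b k))"
    by (simp add: gauss_transfer_def b_def w_def add.commute add.left_commute)
  moreover have summable: "summable (\<lambda>k. w k * b k)"
    using summable_divide[OF summable_gauss_transfer[of 1], of 2]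
    by (simp add: b_def w_def add.commute add.left_commute)
  moreover have "(\<Sum>k. 2 * (w k * b k)) = 2 * (\<Sum>k. w k * b k)"
    using summable by (rule suminf_mult)
  moreover have "f 0 / 2 \<le> (\<Sum>k. w k * b k)"
  proof -
    have sums: "(\<lambda>k. w k * f 0) sums (1 / 2 * f 0)"
      unfolding w_def using sums_divide[OF gauss_weight_sums[of 1], of 2] by (intro sums_mult2) simp
    have "w k * f 0 \<le> w k * b k" for k
      unfolding b_def w_def using gauss_weight_nonneg[of 1 k]
      by (intro mult_left_mono mono_onD[OF mono]) (auto simp: divide_le_eq_1)
    then have "(\<Sum>k. w k * f 0) \<le> (\<Sum>k. w k * b k)"
      using sums summable by (intro suminf_le) (auto simp: sums_iff)
    then show ?thesis using sums by (simp add: sums_iff)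
  qed
  ultimately show ?thesis by simp
qed

end

definition monotone_osc :: "real \<Rightarrow> (real \<Rightarrow> real) \<Rightarrow> bool" where
  "monotone_osc c f \<longleftrightarrow> f \<in> borel_measurable borel \<and> (\<forall>x\<in>{0..1}. f x \<in> {0..1}) \<and>
    (mono_on {0..1} f \<or> mono_on {0..1} (\<lambda>x. 1 - f x)) \<and> \<bar>f 1 - f 0\<bar> \<le> c"

lemma borel_measurable_gauss_transfer[measurable]:
  assumes [measurable]: "f \<in> borel_measurable borel"
  shows "gauss_transfer f \<in> borel_measurable borel"
  unfolding gauss_transfer_def[abs_def] gauss_weight_def by measurable

lemma monotone_osc_gauss_transfer:
  assumes "monotone_osc c f" shows "monotone_osc (c / 2) (gauss_transfer f)"
proof -
  have [measurable]: "f \<in> borel_measurable borel" and f01: "f x \<in> {0..1}" if "x \<in> {0..1}" for x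
    using assms that unfolding monotone_osc_def by auto
  have c: "\<bar>f 1 - f 0\<bar> \<le> c" using assms unfolding monotone_osc_def by simp
  have L: "gauss_transfer f x \<in> {0..1}" if "x \<in> {0..1}" for x
    using gauss_transfer_mem[OF f01] that by auto
  have mem: "gauss_transfer f \<in> borel_measurable borel" using assms unfolding monotone_osc_def by auto
  consider "mono_on {0..1} f" | "mono_on {0..1} (\<lambda>x. 1 - f x)"
    using assms unfolding monotone_osc_def by blast
  then show ?thesis
  proof cases
    case 1
    have "gauss_transfer f y \<le> gauss_transfer f x" if "x \<in> {0..1}" "y \<in> {0..1}" "x \<le> y" for x y
      using gauss_transfer_antimono[OF f01 1] that by auto
    moreover have "gauss_transfer f 0 - gauss_transfer f 1 \<le> (f 1 - f 0) / 2"
      using gauss_transfer_osc[OF f01 1] .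
    moreover have "gauss_transfer f 1 \<le> gauss_transfer f 0" using calculation(1)[of 0 1] by simp
    ultimately show ?thesis
      using L mem c by (auto simp: monotone_osc_def mono_on_def)
  next
    case 2
    have g01: "1 - f x \<in> {0..1}" if "x \<in> {0..1}" for x using f01[OF that] by auto
    have g: "gauss_transfer (\<lambda>x. 1 - f x) y = 1 - gauss_transfer f y" if "y \<ge> 0" for y
      using gauss_transfer_compl[OF f01 that] .
    have "gauss_transfer f x \<le> gauss_transfer f y" if "x \<in> {0..1}" "y \<in> {0..1}" "x \<le> y" for x y
      using gauss_transfer_antimono[OF g01 2, of x y] that g by auto
    moreover have "gauss_transfer f 1 - gauss_transfer f 0 \<le> (f 0 - f 1) / 2"
      using gauss_transfer_osc[OF g01 2] g by simp
    moreover have "gauss_transfer f 0 \<le> gauss_transfer f 1" using calculation(1)[of 0 1] by simp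
    ultimately show ?thesis
      using L mem c by (auto simp: monotone_osc_def mono_on_def)
  qed
qed

section \<open>Change of variables along the inverse branches of the Gauss map\<close>

lemma nn_integral_inverse_branch:
  assumes [measurable]: "h \<in> borel_measurable borel"
  shows "(\<integral>\<^sup>+x. h x * indicator {1 / (real k + 2)..1 / (real k + 1)} x \<partial>lborel) =
    (\<integral>\<^sup>+y. h (1 / (real k + 1 + y)) * ennreal (1 / (real k + 1 + y)\<^sup>2) * indicator {0..1} y \<partial>lborel)"
proof -
  \<comment> \<open>The branch decreases, whereas the substitution rule asks for a nonnegative
    derivative; hence the reflection \<open>z = -y\<close>, undone afterwards.\<close>
  let ?g = "\<lambda>z. 1 / (real k + 1 - z)" and ?g' = "\<lambda>z. 1 / (real k + 1 - z)\<^sup>2"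
  have "(\<integral>\<^sup>+x. h x * indicator {?g (-1)..?g 0} x \<partial>lborel) =
      (\<integral>\<^sup>+z. h (?g z) * ennreal (?g' z) * indicator {-1..0} z \<partial>lborel)"
  proof (rule nn_integral_substitution_aux)
    show "(?g has_real_derivative ?g' x) (at x)" if "x \<in> {-1..0}" for x
      using that by (auto intro!: derivative_eq_intros simp: power2_eq_square)
    show "continuous_on {-1..0} ?g'" by (auto intro!: continuous_intros)
  qed auto
  also have "\<dots> = (\<integral>\<^sup>+y. h (?g (-y)) * ennreal (?g' (-y)) * indicator {-1..0} (-y) \<partial>lborel)"
    by (subst nn_integral_real_affine[where c = "-1" and t = 0]) auto
  also have "\<dots> = (\<integral>\<^sup>+y. h (1 / (real k + 1 + y)) * ennreal (1 / (real k + 1 + y)\<^sup>2) * indicator {0..1} y \<partial>lborel)"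
    by (intro nn_integral_cong) (auto simp: indicator_def)
  finally show ?thesis by (simp add: add.commute)
qed

lemma ex1_inverse_branch:
  assumes "0 < x" "x \<le> (1 :: real)"
  shows "\<exists>k. x \<in> {1 / (real k + 2)<..1 / (real k + 1)}"
proof
  define n where "n = nat \<lfloor>1 / x\<rfloor>"
  have "1 \<le> 1 / x" using assms by simp
  then have "1 \<le> \<lfloor>1 / x\<rfloor>" by simp
  then have n: "1 \<le> n" "real n \<le> 1 / x" "1 / x < real n + 1"
    unfolding n_def by (auto simp: le_nat_iff) linarith+
  then show "x \<in> {1 / (real (n - 1) + 2)<..1 / (real (n - 1) + 1)}"
    using assms by (auto simp: field_simps of_nat_diff)
qed

text \<open>Half-open intervals partition (0, 1]. The closed ones in the statement differ from them
  by single points and fit the substitution rule.\<close>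

lemma nn_integral_unit_split:
  fixes h :: "real \<Rightarrow> ennreal"
  assumes [measurable]: "h \<in> borel_measurable borel"
  shows "(\<integral>\<^sup>+x. h x * indicator {0..1} x \<partial>lborel) =
    (\<Sum>k. \<integral>\<^sup>+x. h x * indicator {1 / (real k + 2)..1 / (real k + 1)} x \<partial>lborel)"
proof -
  let ?J = "\<lambda>k. {1 / (real k + 2)<..1 / (real k + 1)}"
  have disj: "disjoint_family ?J"
  proof -
    have "?J i \<inter> ?J j = {}" if "i < j" for i j
    proof -
      have "1 / (real j + 1) \<le> 1 / (real i + 2)" using that by (intro divide_left_mono) auto
      then show ?thesis by auto
    qed
    then show ?thesis unfolding disjoint_family_on_def by (metis inf_commute linorder_neqE_nat)
  qed
  have un: "(\<Union>k. ?J k) = {0<..1}"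
  proof
    show "{0<..1} \<subseteq> (\<Union>k. ?J k)" using ex1_inverse_branch by fastforce
    have "0 < 1 / (real k + 2)" "1 / (real k + 1) \<le> 1" for k by auto
    then show "(\<Union>k. ?J k) \<subseteq> {0<..1}"
      by (intro UN_least subsetI) (metis greaterThanAtMost_iff less_trans order_trans)
  qed
  have "(\<integral>\<^sup>+x. h x * indicator {0..1} x \<partial>lborel) = (\<integral>\<^sup>+x. h x * indicator (\<Union>k. ?J k) x \<partial>lborel)"
    unfolding un by (intro nn_integral_cong_AE AE_I[of _ _ "{0}"]) (auto simp: indicator_def)
  also have "\<dots> = (\<integral>\<^sup>+x. (\<Sum>k. h x * indicator (?J k) x) \<partial>lborel)"
    by (simp add: suminf_indicator[OF disj, symmetric])
  also have "\<dots> = (\<Sum>k. \<integral>\<^sup>+x. h x * indicator (?J k) x \<partial>lborel)"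
    by (intro nn_integral_suminf) measurable
  also have "\<dots> = (\<Sum>k. \<integral>\<^sup>+x. h x * indicator {1 / (real k + 2)..1 / (real k + 1)} x \<partial>lborel)"
  proof (intro suminf_cong)
    fix k
    show "(\<integral>\<^sup>+x. h x * indicator (?J k) x \<partial>lborel) =
        (\<integral>\<^sup>+x. h x * indicator {1 / (real k + 2)..1 / (real k + 1)} x \<partial>lborel)"
      by (intro nn_integral_cong_AE AE_I[of _ _ "{1 / (real k + 2)}"]) (auto simp: indicator_def)
  qed
  finally show ?thesis .
qed

lemma gauss_map_inverse_branch:
  assumes "y \<in> {0..<1}" shows "gauss_map (1 / (real k + 1 + y)) = y"
proof -
  have "frac (real k + 1 + y) = frac y"
    using frac_add_int_left[of "real (Suc k)" y] by (simp add: add_ac)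
  then show ?thesis using assms by (simp add: gauss_map_def frac_eq)
qed

lemma borel_measurable_gauss_map[measurable]: "gauss_map \<in> borel_measurable borel"
  unfolding gauss_map_def[abs_def] frac_def by measurable

lemma sets_gauss_measure[measurable_cong]: "sets gauss_measure = sets (restrict_space borel {0..1})"
  by (simp add: gauss_measure_def sets_restrict_space)

lemma space_gauss_measure: "space gauss_measure = {0..1}"
  by (simp add: gauss_measure_def space_restrict_space)

lemma nn_integral_gauss_measure:
  assumes [measurable]: "h \<in> borel_measurable borel"
  shows "(\<integral>\<^sup>+x. h x \<partial>gauss_measure) =
    (\<integral>\<^sup>+x. ennreal (1 / ln 2 * (1 / (1 + x))) * h x * indicator {0..1} x \<partial>lborel)"
proof -
  have "h \<in> borel_measurable (restrict_space lborel {0..1})"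
    "(\<lambda>t. ennreal (1 / ln 2 * (1 / (1 + t)))) \<in> borel_measurable (restrict_space lborel {0..1})"
    by (auto intro!: measurable_restrict_space1)
  then show ?thesis
    unfolding gauss_measure_def by (subst nn_integral_density) (auto simp: nn_integral_restrict_space)
qed

text \<open>The duality behind the operator: with respect to the Gauss measure it is adjoint to
  composition with the Gauss map. After substitution on each branch the Jacobians and densities
  combine to the weights.\<close>

lemma nn_integral_gauss_transfer:
  assumes f: "f \<in> borel_measurable borel" "\<And>x. x \<in> {0..1} \<Longrightarrow> f x \<in> {0..1}"
    and [measurable]: "g \<in> borel_measurable borel"
  shows "(\<integral>\<^sup>+x. ennreal (f x) * g (gauss_map x) \<partial>gauss_measure) =
    (\<integral>\<^sup>+x. ennreal (gauss_transfer f x) * g x \<partial>gauss_measure)"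
proof -
  note [measurable] = f(1)
  let ?d = "\<lambda>x. 1 / ln 2 * (1 / (1 + x)) :: real"
  let ?h = "\<lambda>x. ennreal (?d x) * (ennreal (f x) * g (gauss_map x))"
  let ?b = "\<lambda>k y. 1 / (real k + 1 + y)"
  \<comment> \<open>At \<open>y = 1\<close> the branch point \<open>1 / (real k + 2)\<close> is sent
    to 0 and not to 1, so this one point is left out.\<close>
  have branch: "?h (?b k y) * ennreal (1 / (real k + 1 + y)\<^sup>2) * indicator {0..1} y =
      ennreal (gauss_weight k y * f (?b k y)) * (ennreal (?d y) * g y * indicator {0..1} y)"
    if "y \<noteq> 1" for k y
  proof (cases "y \<in> {0..1}")
    case True
    define u where "u = real k + 1 + y"
    have u: "u > 0" "u + 1 > 0" "real k + 2 + y = u + 1" using True by (auto simp: u_def)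
    have fb: "0 \<le> f (1 / u)" using f(2)[OF inverse_branch_mem[of y k]] True by (auto simp: u_def)
    have "?d (1 / u) * (1 / u\<^sup>2) = gauss_weight k y * ?d y"
      unfolding gauss_weight_def u_def[symmetric] u(3) using u True
      by (simp add: divide_simps power2_eq_square)
    then have "?d (1 / u) * f (1 / u) * (1 / u\<^sup>2) = gauss_weight k y * f (1 / u) * ?d y"
      by (metis mult.assoc mult.commute)
    moreover have "0 \<le> gauss_weight k y" using True by (intro gauss_weight_nonneg) auto
    ultimately have "ennreal (?d (1 / u)) * ennreal (f (1 / u)) * ennreal (1 / u\<^sup>2) =
        ennreal (gauss_weight k y * f (1 / u)) * ennreal (?d y)"
      using u fb True by (simp add: ennreal_mult[symmetric] del: ennreal_mult')
    moreover have "gauss_map (1 / u) = y"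
      unfolding u_def using True that by (intro gauss_map_inverse_branch) auto
    ultimately show ?thesis using True unfolding u_def[symmetric] by (simp add: mult_ac)
  qed simp
  have "(\<integral>\<^sup>+x. ennreal (f x) * g (gauss_map x) \<partial>gauss_measure) = (\<integral>\<^sup>+x. ?h x * indicator {0..1} x \<partial>lborel)"
    by (subst nn_integral_gauss_measure) (auto simp: mult_ac)
  also have "\<dots> = (\<Sum>k. \<integral>\<^sup>+y. ?h (?b k y) * ennreal (1 / (real k + 1 + y)\<^sup>2) * indicator {0..1} y \<partial>lborel)"
    by (subst nn_integral_unit_split, measurable) (intro suminf_cong nn_integral_inverse_branch, measurable)
  also have "\<dots> = (\<Sum>k. \<integral>\<^sup>+y. ennreal (gauss_weight k y * f (?b k y)) * (ennreal (?d y) * g y * indicator {0..1} y) \<partial>lborel)"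
    by (intro suminf_cong nn_integral_cong_AE AE_I[of _ _ "{1}"]) (use branch in auto)
  also have "\<dots> = (\<integral>\<^sup>+y. (\<Sum>k. ennreal (gauss_weight k y * f (?b k y)) * (ennreal (?d y) * g y * indicator {0..1} y)) \<partial>lborel)"
    unfolding gauss_weight_def by (rule nn_integral_suminf[symmetric]) measurable
  also have "\<dots> = (\<integral>\<^sup>+y. ennreal (?d y) * (ennreal (gauss_transfer f y) * g y) * indicator {0..1} y \<partial>lborel)"
  proof (intro nn_integral_cong)
    fix y :: real
    show "(\<Sum>k. ennreal (gauss_weight k y * f (?b k y)) * (ennreal (?d y) * g y * indicator {0..1} y)) =
      ennreal (?d y) * (ennreal (gauss_transfer f y) * g y) * indicator {0..1} y"
    proof (cases "y \<in> {0..1}")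
      case True
      then have "(\<Sum>k. ennreal (gauss_weight k y * f (?b k y))) = ennreal (gauss_transfer f y)"
        unfolding gauss_transfer_def using f(2)[OF inverse_branch_mem[of y]]
        by (intro suminf_ennreal2 summable_gauss_transfer f(2)) (auto intro!: mult_nonneg_nonneg gauss_weight_nonneg)
      then show ?thesis by (simp add: mult_ac)
    qed simp
  qed
  also have "\<dots> = (\<integral>\<^sup>+x. ennreal (gauss_transfer f x) * g x \<partial>gauss_measure)"
    using f(1) by (subst nn_integral_gauss_measure) auto
  finally show ?thesis .
qed

section \<open>Invariance of the Gauss measure and decay of correlations\<close>

lemma null_sets_lborel_Rats: "(\<rat> :: real set) \<in> null_sets lborel"
  by (rule countable_imp_null_set_lborel) (rule countable_rat)

lemma sets_gauss_measureD: "A \<in> sets gauss_measure \<Longrightarrow> A \<in> sets borel"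
  and sets_gauss_measureI: "A \<in> sets borel \<Longrightarrow> A \<subseteq> {0..1} \<Longrightarrow> A \<in> sets gauss_measure"
  by (auto simp: sets_gauss_measure sets_restrict_space_iff)

text \<open>Agreement with an interval is required at irrational points only, the rationals being
  null. This spares tracking which end points belong to a cylinder.\<close>

lemma emeasure_gauss_measure_interval:
  assumes A: "A \<in> sets borel" "A \<subseteq> {0..1}" and ab: "0 \<le> a" "a \<le> b" "b \<le> 1"
    and int: "\<And>x. x \<notin> \<rat> \<Longrightarrow> x \<in> A \<longleftrightarrow> a < x \<and> x < b"
  shows "emeasure gauss_measure A = ennreal (log 2 (1 + b) - log 2 (1 + a))"
proof -
  note [measurable] = A(1)
  have "emeasure gauss_measure A = (\<integral>\<^sup>+x. indicator A x \<partial>gauss_measure)"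
    using sets_gauss_measureI[OF A] by simp
  also have "\<dots> = (\<integral>\<^sup>+x. ennreal (1 / ln 2 * (1 / (1 + x))) * indicator A x * indicator {0..1} x \<partial>lborel)"
    by (intro nn_integral_gauss_measure) measurable
  also have "\<dots> = (\<integral>\<^sup>+x. ennreal (1 / ln 2 * (1 / (1 + x))) * indicator {a..b} x \<partial>lborel)"
  proof (rule nn_integral_cong_AE)
    have "AE x::real in lborel. x \<notin> \<rat>" using null_sets_lborel_Rats by (rule AE_not_in)
    moreover have "AE x::real in lborel. x \<noteq> a \<and> x \<noteq> b"
      using AE_not_in[of "{a, b}" lborel] finite_imp_null_set_lborel[of "{a, b}"] by simp
    ultimately show "AE x in lborel. ennreal (1 / ln 2 * (1 / (1 + x))) * indicator A x * indicator {0..1} x =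
        ennreal (1 / ln 2 * (1 / (1 + x))) * indicator {a..b} x"
    proof eventually_elim
      case (elim x)
      then show ?case using int[of x] A(2) ab by (auto simp: indicator_def)
    qed
  qed
  also have "\<dots> = ennreal (ln (1 + b) / ln 2 - ln (1 + a) / ln 2)"
  proof (rule nn_integral_FTC_Icc)
    show "((\<lambda>x. ln (1 + x) / ln 2) has_real_derivative 1 / ln 2 * (1 / (1 + x))) (at x)"
      if "x \<in> {a..b}" for x
    proof -
      have "((\<lambda>x. ln (1 + x)) has_real_derivative 1 / (1 + x)) (at x)"
        using that ab by (auto intro!: derivative_eq_intros)
      from DERIV_cdivide[OF this, of "ln 2"] show ?thesis by (simp add: mult.commute)
    qed
  qed (use ab in auto)
  finally show ?thesis by (simp add: log_def)
qed

lemma prob_space_gauss_measure: "prob_space gauss_measure"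
proof
  show "emeasure gauss_measure (space gauss_measure) = 1"
    unfolding space_gauss_measure
    by (subst emeasure_gauss_measure_interval[of _ 0 1]) (auto simp: order_less_le)
qed

interpretation gauss: prob_space gauss_measure by (rule prob_space_gauss_measure)

lemma measure_gauss_measure_interval:
  assumes "A \<in> sets borel" "A \<subseteq> {0..1}" "0 \<le> a" "a \<le> b" "b \<le> 1"
    "\<And>x. x \<notin> \<rat> \<Longrightarrow> x \<in> A \<longleftrightarrow> a < x \<and> x < b"
  shows "measure gauss_measure A = log 2 (1 + b) - log 2 (1 + a)"
  using emeasure_gauss_measure_interval[OF assms] assms(3,4)
  by (simp add: gauss.emeasure_eq_measure)

lemma gauss_map_mem: "gauss_map x \<in> {0..1}"
  using frac_ge_0[of "1 / x"] frac_lt_1[of "1 / x"] by (simp add: gauss_map_def)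

lemma measurable_gauss_map: "gauss_map \<in> measurable gauss_measure gauss_measure"
proof -
  have "gauss_map \<in> measurable (restrict_space borel {0..1}) (restrict_space borel {0..1})"
    by (intro measurable_restrict_space3) (use gauss_map_mem in auto)
  then show ?thesis by (simp cong: measurable_cong_sets add: sets_gauss_measure)
qed

text \<open>The duality applied to the constant function 1, which the operator fixes because the
  weights sum to 1.\<close>

lemma gauss_map_preserves_measure:
  assumes "A \<in> sets gauss_measure"
  shows "measure gauss_measure (gauss_map -` A \<inter> space gauss_measure) = measure gauss_measure A"
proof -
  note [measurable] = sets_gauss_measureD[OF assms]
  have A': "gauss_map -` A \<inter> space gauss_measure \<in> sets gauss_measure"
    using measurable_gauss_map assms by (rule measurable_sets)
  have one: "gauss_transfer (\<lambda>_. 1) x = 1" if "0 \<le> x" for x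
    using gauss_weight_sums[OF that] by (simp add: gauss_transfer_def sums_iff)
  have "emeasure gauss_measure (gauss_map -` A \<inter> space gauss_measure) =
      (\<integral>\<^sup>+x. indicator (gauss_map -` A \<inter> space gauss_measure) x \<partial>gauss_measure)"
    using A' by simp
  also have "\<dots> = (\<integral>\<^sup>+x. ennreal 1 * indicator A (gauss_map x) \<partial>gauss_measure)"
    by (intro nn_integral_cong) (auto simp: indicator_def)
  also have "\<dots> = (\<integral>\<^sup>+x. ennreal (gauss_transfer (\<lambda>_. 1) x) * indicator A x \<partial>gauss_measure)"
    by (rule nn_integral_gauss_transfer) auto
  also have "\<dots> = (\<integral>\<^sup>+x. indicator A x \<partial>gauss_measure)"
    by (intro nn_integral_cong) (auto simp: space_gauss_measure one)
  also have "\<dots> = emeasure gauss_measure A" using assms by simp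
  finally show ?thesis by (simp add: gauss.emeasure_eq_measure)
qed

lemma nn_integral_gauss_transfer_pow:
  assumes "monotone_osc c f" "g \<in> borel_measurable borel"
  shows "monotone_osc (c / 2 ^ n) ((gauss_transfer ^^ n) f) \<and>
    (\<integral>\<^sup>+x. ennreal (f x) * g ((gauss_map ^^ n) x) \<partial>gauss_measure) =
    (\<integral>\<^sup>+x. ennreal ((gauss_transfer ^^ n) f x) * g x \<partial>gauss_measure)"
  using assms
proof (induction n arbitrary: f c)
  case (Suc n)
  have pow[measurable]: "gauss_map ^^ n \<in> borel_measurable borel"
    by (induction n) (auto intro: measurable_comp[OF _ borel_measurable_gauss_map])
  note [measurable] = Suc.prems(2)
  have "(\<integral>\<^sup>+x. ennreal (f x) * g ((gauss_map ^^ n) (gauss_map x)) \<partial>gauss_measure) =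
      (\<integral>\<^sup>+x. ennreal (gauss_transfer f x) * g ((gauss_map ^^ n) x) \<partial>gauss_measure)"
    using Suc.prems(1) unfolding monotone_osc_def by (intro nn_integral_gauss_transfer) auto
  then show ?case
    using Suc.IH[OF monotone_osc_gauss_transfer[OF Suc.prems(1)] Suc.prems(2)]
    by (simp add: funpow_swap1 field_simps)
qed simp

text \<open>Applied \<open>n\<close> times to the indicator of \<open>[0, r)\<close>, the operator
  yields a function of oscillation at most 2^-n with unchanged integral \<open>p\<close>. Averaging
  over the second point shows that it is at most p + 2^-n everywhere; integrating it over
  \<open>A\<close> gives the bound.\<close>

lemma gauss_map_correlation:
  assumes r: "0 \<le> r" "r \<le> 1"
  defines "A \<equiv> {0..<r}"
  shows "measure gauss_measure (A \<inter> ((gauss_map ^^ n) -` A \<inter> space gauss_measure)) \<le>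
    (measure gauss_measure A)\<^sup>2 + (1 / 2) ^ n"
proof -
  define p where "p = measure gauss_measure A"
  define f :: "real \<Rightarrow> real" where "f = indicator {..<r}"
  define F where "F = (gauss_transfer ^^ n) f"
  have p0: "0 \<le> p" by (simp add: p_def)
  have [measurable]: "A \<in> sets borel" by (simp add: A_def)
  have A: "A \<in> sets gauss_measure" using r by (intro sets_gauss_measureI) (auto simp: A_def)
  have osc: "monotone_osc 1 f"
    unfolding monotone_osc_def f_def by (auto simp: mono_on_def indicator_def)
  note pow = nn_integral_gauss_transfer_pow[OF osc, where n = n, folded F_def]
  have osc_F: "monotone_osc (1 / 2 ^ n) F" using pow[of "\<lambda>_. 0"] by (simp only: borel_measurable_const simp_thms)
  then have F[measurable]: "F \<in> borel_measurable borel" and F01: "\<And>x. x \<in> {0..1} \<Longrightarrow> F x \<in> {0..1}"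
    and F10: "\<bar>F 1 - F 0\<bar> \<le> 1 / 2 ^ n"
    and F_mono: "mono_on {0..1} F \<or> mono_on {0..1} (\<lambda>x. 1 - F x)"
    unfolding monotone_osc_def by blast+
  have F_diff: "F x \<le> F y + 1 / 2 ^ n" if "x \<in> {0..1}" "y \<in> {0..1}" for x y
    using F_mono
  proof
    assume "mono_on {0..1} F"
    from mono_onD[OF this, of 0 y] mono_onD[OF this, of x 1] show ?thesis using that F10 by auto
  next
    assume "mono_on {0..1} (\<lambda>x. 1 - F x)"
    from mono_onD[OF this, of 0 x] mono_onD[OF this, of y 1] show ?thesis using that F10 by auto
  qed
  have f_ind: "ennreal (f x) = indicator A x" if "x \<in> space gauss_measure" for x
    using that by (auto simp: f_def A_def space_gauss_measure indicator_def)
  have "(\<integral>\<^sup>+x. ennreal (F x) * 1 \<partial>gauss_measure) = (\<integral>\<^sup>+x. ennreal (f x) * 1 \<partial>gauss_measure)"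
    using pow[of "\<lambda>_. 1"] by simp
  also have "\<dots> = (\<integral>\<^sup>+x. indicator A x \<partial>gauss_measure)"
    by (intro nn_integral_cong) (simp add: f_ind)
  finally have int_F: "(\<integral>\<^sup>+x. ennreal (F x) \<partial>gauss_measure) = ennreal p"
    using A by (simp add: p_def gauss.emeasure_eq_measure)
  have F_gauss: "(\<lambda>y. ennreal (F y)) \<in> borel_measurable gauss_measure"
    using F by (simp cong: measurable_cong_sets add: sets_gauss_measure measurable_restrict_space1)
  have F_le: "ennreal (F x) \<le> ennreal (p + 1 / 2 ^ n)" if "x \<in> {0..1}" for x
  proof -
    have "ennreal (F x) = (\<integral>\<^sup>+y. ennreal (F x) \<partial>gauss_measure)"
      by (simp add: gauss.emeasure_space_1)
    also have "\<dots> \<le> (\<integral>\<^sup>+y. ennreal (F y) + ennreal (1 / 2 ^ n) \<partial>gauss_measure)"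
      using F_diff[OF that] F01
      by (intro nn_integral_mono) (auto simp: space_gauss_measure ennreal_plus[symmetric] simp del: ennreal_plus intro!: ennreal_leI)
    also have "\<dots> = ennreal (p + 1 / 2 ^ n)"
      using F_gauss by (subst nn_integral_add) (auto simp: int_F gauss.emeasure_space_1 p_def)
    finally show ?thesis .
  qed
  let ?B = "A \<inter> ((gauss_map ^^ n) -` A \<inter> space gauss_measure)"
  have "gauss_map ^^ n \<in> measurable gauss_measure gauss_measure"
    by (induction n) (auto intro: measurable_compose[OF _ measurable_gauss_map])
  then have B: "?B \<in> sets gauss_measure" using A by measurable
  have "emeasure gauss_measure ?B = (\<integral>\<^sup>+x. indicator ?B x \<partial>gauss_measure)" using B by simp
  also have "\<dots> = (\<integral>\<^sup>+x. ennreal (f x) * indicator A ((gauss_map ^^ n) x) \<partial>gauss_measure)"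
    by (intro nn_integral_cong) (simp add: f_ind indicator_def)
  also have "\<dots> = (\<integral>\<^sup>+x. ennreal (F x) * indicator A x \<partial>gauss_measure)"
    using pow[of "indicator A"] by simp
  also have "\<dots> \<le> (\<integral>\<^sup>+x. ennreal (p + 1 / 2 ^ n) * indicator A x \<partial>gauss_measure)"
    using F_le by (intro nn_integral_mono mult_right_mono) (auto simp: space_gauss_measure)
  also have "\<dots> = ennreal ((p + 1 / 2 ^ n) * p)"
    using A p0 by (simp add: nn_integral_cmult_indicator gauss.emeasure_eq_measure p_def[symmetric] ennreal_mult'')
  finally have "measure gauss_measure ?B \<le> (p + 1 / 2 ^ n) * p"
    by (simp add: gauss.emeasure_eq_measure p_def)
  moreover have "1 / 2 ^ n * p \<le> (1 / 2) ^ n"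
    using mult_left_mono[OF gauss.prob_le_1[of A], of "1 / 2 ^ n"] by (simp add: p_def power_divide)
  ultimately show ?thesis unfolding p_def[symmetric] by (simp add: power2_eq_square algebra_simps)
qed

section \<open>Lebesgue measure on the unit interval\<close>

definition unit_lborel :: "real measure" where "unit_lborel = restrict_space lborel {0..<1}"

lemma space_unit_lborel: "space unit_lborel = {0..<1}"
  by (simp add: unit_lborel_def space_restrict_space)

lemma sets_unit_lborel: "sets unit_lborel = sets (restrict_space borel {0..<1})"
  by (simp add: unit_lborel_def sets_restrict_space)

lemma sets_unit_lborelD: "A \<in> sets unit_lborel \<Longrightarrow> A \<in> sets borel \<and> A \<subseteq> {0..<1}"
  and sets_unit_lborelI: "A \<in> sets borel \<Longrightarrow> A \<subseteq> {0..<1} \<Longrightarrow> A \<in> sets unit_lborel"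
  by (auto simp: sets_unit_lborel sets_restrict_space_iff)

lemma emeasure_unit_lborel: "A \<subseteq> {0..<1} \<Longrightarrow> emeasure unit_lborel A = emeasure lborel A"
  unfolding unit_lborel_def by (rule emeasure_restrict_space) auto

lemma nn_integral_unit_lborel: "(\<integral>\<^sup>+x. h x \<partial>unit_lborel) = (\<integral>\<^sup>+x. h x * indicator {0..<1} x \<partial>lborel)"
  unfolding unit_lborel_def by (rule nn_integral_restrict_space) auto

interpretation unit: prob_space unit_lborel
  by standard (simp add: space_unit_lborel emeasure_unit_lborel)

lemma sets_Collect_unit_lborel:
  assumes [measurable]: "Measurable.pred borel P"
  shows "{u \<in> {0..<1}. P u} \<in> sets unit_lborel"
proof (rule sets_unit_lborelI)
  have "{u \<in> {0..<1}. P u} = {0..<1} \<inter> {u \<in> space borel. P u}" by auto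
  then show "{u \<in> {0..<1}. P u} \<in> sets borel" by simp
qed auto

text \<open>On [0, 1) the density of the Gauss measure is at least \<open>1 / (2 * ln 2)\<close>,
  hence at least 1/2.\<close>

lemma measure_unit_lborel_le_gauss:
  assumes A: "A \<in> sets borel" "A \<subseteq> {0..<1}"
  shows "measure unit_lborel A \<le> 2 * measure gauss_measure A"
proof -
  note [measurable] = A(1)
  have A': "A \<in> sets gauss_measure" using A by (intro sets_gauss_measureI) auto
  have "ennreal (1 / 2) * emeasure unit_lborel A = (\<integral>\<^sup>+x. ennreal (1 / 2) * indicator A x \<partial>lborel)"
    using A by (subst nn_integral_cmult_indicator) (auto simp: emeasure_unit_lborel)
  also have "\<dots> \<le> (\<integral>\<^sup>+x. ennreal (1 / ln 2 * (1 / (1 + x))) * indicator A x * indicator {0..1} x \<partial>lborel)"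
  proof (intro nn_integral_mono)
    fix x :: real
    have "1 / 2 \<le> 1 / ln 2 * (1 / (1 + x))" if "x \<in> A"
    proof -
      have "ln 2 * (1 + x) \<le> 1 * (2 :: real)"
        using that A(2) ln_2_less_1 by (intro mult_mono) auto
      moreover have "0 < ln 2 * (1 + x)" using that A(2) by (intro mult_pos_pos) auto
      ultimately show ?thesis by (simp add: field_simps)
    qed
    then have *: "ennreal (1 / 2) \<le> ennreal (1 / ln 2 * (1 / (1 + x)))" if "x \<in> A"
      using that by (intro ennreal_leI)
    show "ennreal (1 / 2) * indicator A x \<le> ennreal (1 / ln 2 * (1 / (1 + x))) * indicator A x * indicator {0..1} x"
    proof (cases "x \<in> A")
      case True
      then have "x \<in> {0..1}" using A(2) by auto
      with * True show ?thesis by (simp only: indicator_simps mult_1_right)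
    qed simp
  qed
  also have "\<dots> = (\<integral>\<^sup>+x. indicator A x \<partial>gauss_measure)"
    by (rule nn_integral_gauss_measure[symmetric]) measurable
  also have "\<dots> = emeasure gauss_measure A" using A' by simp
  finally have "ennreal (1 / 2) * ennreal (measure unit_lborel A) \<le> ennreal (measure gauss_measure A)"
    unfolding unit.emeasure_eq_measure gauss.emeasure_eq_measure .
  moreover have "ennreal (1 / 2 * measure unit_lborel A) = ennreal (1 / 2) * ennreal (measure unit_lborel A)"
    by (rule ennreal_mult) auto
  ultimately have "ennreal (1 / 2 * measure unit_lborel A) \<le> ennreal (measure gauss_measure A)"
    by (simp only:)
  then show ?thesis by (subst (asm) ennreal_le_iff) auto
qed

lemma measure_gauss_visits_deviation_le:
  assumes r: "0 \<le> r" "r \<le> 1" and pos: "0 < \<epsilon>" "0 < N"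
  shows "measure unit_lborel {u \<in> {0..<1}. \<epsilon> * real N \<le>
    \<bar>real (card {j. j < N \<and> (gauss_map ^^ j) u < r}) - real N * log 2 (1 + r)\<bar>} \<le> 6 / (\<epsilon>\<^sup>2 * real N)"
    (is "measure unit_lborel ?B \<le> _")
proof -
  let ?A = "{0..<r}"
  let ?P = "\<lambda>u. \<epsilon> * real N \<le> \<bar>real (card {j. j < N \<and> (gauss_map ^^ j) u < r}) - real N * log 2 (1 + r)\<bar>"
  have A: "?A \<in> sets gauss_measure" using r by (intro sets_gauss_measureI) auto
  have meas_A: "measure gauss_measure ?A = log 2 (1 + r)"
    using r by (subst measure_gauss_measure_interval[of _ 0 r]) (auto simp: order_less_le)
  have pow[measurable]: "gauss_map ^^ j \<in> borel_measurable borel" for j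
    by (induction j) (auto intro: measurable_comp[OF _ borel_measurable_gauss_map])
  have card: "real (card {j. j < N \<and> (gauss_map ^^ j) u < r}) = (\<Sum>j<N. indicator {..<r} ((gauss_map ^^ j) u))" for u
    by (simp add: indicator_def sum.If_cases Int_def)
  have "Measurable.pred borel ?P" unfolding card by measurable
  then have B: "?B \<in> sets borel" using sets_unit_lborelD[OF sets_Collect_unit_lborel] by blast
  have mem: "(gauss_map ^^ j) u \<ge> 0" if "u \<in> {0..1}" for u j
    using that gauss_map_mem by (induction j) auto
  have "measure unit_lborel ?B \<le> 2 * measure gauss_measure ?B"
    by (intro measure_unit_lborel_le_gauss B) auto
  also have "measure gauss_measure ?B \<le> measure gauss_measure {u \<in> space gauss_measure. \<epsilon> * real N \<le>
    \<bar>real (card {j. j < N \<and> (gauss_map ^^ j) u \<in> ?A}) - real N * measure gauss_measure ?A\<bar>}"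
    (is "_ \<le> measure _ ?C")
  proof (rule gauss.finite_measure_mono)
    show "?B \<subseteq> ?C" using mem by (auto simp: space_gauss_measure meas_A)
    have "?C = {u \<in> space gauss_measure. ?P u}"
      using mem by (auto simp: space_gauss_measure meas_A)
    also have "\<dots> \<in> sets gauss_measure"
    proof (rule sets_gauss_measureI)
      have "{u \<in> space gauss_measure. ?P u} = {0..1} \<inter> {u \<in> space borel. ?P u}"
        by (auto simp: space_gauss_measure)
      then show "{u \<in> space gauss_measure. ?P u} \<in> sets borel" unfolding card by simp
    qed (auto simp: space_gauss_measure)
    finally show "?C \<in> sets gauss_measure" .
  qed
  also have "\<dots> \<le> 3 / (\<epsilon>\<^sup>2 * real N)"
    by (rule gauss.prob_visits_deviation_le[OF measurable_gauss_map gauss_map_preserves_measure A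
          gauss_map_correlation[OF r] pos])
  finally show ?thesis by simp
qed

section \<open>Digits as visits under multiplication by \<open>b\<close> modulo 1\<close>

lemma floor_mult_mod_eq_iff:
  assumes "2 \<le> b" "d < b"
  shows "\<lfloor>real b * z\<rfloor> mod int b = int d \<longleftrightarrow> frac z \<in> {real d / real b..<(real d + 1) / real b}"
proof -
  have "real b * z = real b * frac z + of_int (int b * \<lfloor>z\<rfloor>)" by (simp add: frac_def algebra_simps)
  then have "\<lfloor>real b * z\<rfloor> = \<lfloor>real b * frac z\<rfloor> + int b * \<lfloor>z\<rfloor>" by linarith
  then have "\<lfloor>real b * z\<rfloor> mod int b = \<lfloor>real b * frac z\<rfloor> mod int b" by simp
  also have "\<dots> = \<lfloor>real b * frac z\<rfloor>"
  proof (rule mod_pos_pos_trivial)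
    show "0 \<le> \<lfloor>real b * frac z\<rfloor>" using frac_ge_0[of z] by simp
    have "real b * frac z < real b * 1" using assms frac_lt_1[of z] by (intro mult_strict_left_mono) auto
    then show "\<lfloor>real b * frac z\<rfloor> < int b" by (simp add: floor_less_iff)
  qed
  also have "(\<dots> = int d) \<longleftrightarrow> real d \<le> real b * frac z \<and> real b * frac z < real d + 1"
    by (simp add: floor_eq_iff)
  also have "\<dots> \<longleftrightarrow> frac z \<in> {real d / real b..<(real d + 1) / real b}"
    using assms by (simp add: field_simps)
  finally show ?thesis .
qed

lemma base_interval_subset:
  assumes "d < b" shows "{real d / real b..<(real d + 1) / real b} \<subseteq> {0..<1}"
proof
  fix x assume *: "x \<in> {real d / real b..<(real d + 1) / real b}"
  have "0 \<le> real d / real b" "(real d + 1) / real b \<le> 1" using assms by (auto simp: field_simps)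
  with * show "x \<in> {0..<1}" unfolding atLeastLessThan_iff by linarith
qed

text \<open>On the interval of one digit the map is affine onto [0, 1), so the first digit is
  independent of everything after it. Summed over \<open>d\<close> this gives invariance; for a
  fixed \<open>d\<close> it gives the vanishing of correlations.\<close>

lemma nn_integral_base_branch:
  assumes [measurable]: "g \<in> borel_measurable borel" and b: "2 \<le> (b :: nat)" "d < b"
  shows "(\<integral>\<^sup>+x. indicator {real d / real b..<(real d + 1) / real b} x * g (frac (real b * x)) \<partial>lborel) =
    ennreal (1 / real b) * (\<integral>\<^sup>+x. g x \<partial>unit_lborel)"
proof -
  let ?h = "\<lambda>x. indicator {real d / real b..<(real d + 1) / real b} x * g (frac (real b * x))"
  have [measurable]: "frac \<in> borel_measurable (borel :: real measure)" unfolding frac_def[abs_def] by measurable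
  have "?h (real d / real b + 1 / real b * y) = g y * indicator {0..<1} y" for y
  proof -
    have 1: "real d / real b + 1 / real b * y \<in> {real d / real b..<(real d + 1) / real b} \<longleftrightarrow> y \<in> {0..<1}"
      using b by (auto simp: field_simps)
    have 2: "frac (real b * (real d / real b + 1 / real b * y)) = y" if "y \<in> {0..<1}"
    proof -
      have "real b * (real d / real b + 1 / real b * y) = real d + y" using b by (simp add: field_simps)
      moreover have "frac (real d + y) = frac y" by (rule frac_add_int_left) simp
      ultimately show ?thesis using that by (simp add: frac_eq)
    qed
    show ?thesis
    proof (cases "y \<in> {0..<1}")
      case True
      then show ?thesis by (simp only: indicator_def 1 2[OF True] of_bool_eq if_True) simp
    next
      case False
      then show ?thesis by (simp only: indicator_def 1 of_bool_eq if_False) simp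
    qed
  qed
  then show ?thesis
    unfolding nn_integral_unit_lborel
    by (subst nn_integral_real_affine[where c = "1 / real b" and t = "real d / real b"]) (use b in auto)
qed

lemma nn_integral_base_map:
  assumes [measurable]: "g \<in> borel_measurable borel" and b: "2 \<le> (b :: nat)"
  shows "(\<integral>\<^sup>+x. g (frac (real b * x)) \<partial>unit_lborel) = (\<integral>\<^sup>+x. g x \<partial>unit_lborel)"
proof -
  let ?I = "\<lambda>d. {real d / real b..<(real d + 1) / real b}"
  have [measurable]: "frac \<in> borel_measurable (borel :: real measure)" unfolding frac_def[abs_def] by measurable
  have split: "indicator {0..<1} x = (\<Sum>d<b. indicator (?I d) x :: ennreal)" for x
  proof (cases "x \<in> {0..<1}")
    case True
    have "x \<in> ?I d \<longleftrightarrow> d = nat \<lfloor>real b * x\<rfloor>" for d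
    proof -
      have "x \<in> ?I d \<longleftrightarrow> \<lfloor>real b * x\<rfloor> = int d"
        using b by (simp add: floor_eq_iff field_simps)
      also have "\<dots> \<longleftrightarrow> d = nat \<lfloor>real b * x\<rfloor>" using True by auto
      finally show ?thesis .
    qed
    moreover have "nat \<lfloor>real b * x\<rfloor> < b"
    proof -
      have "real b * x < real b * 1" using True b by (intro mult_strict_left_mono) auto
      then have "\<lfloor>real b * x\<rfloor> < int b" by (simp add: floor_less_iff)
      then show ?thesis using b by linarith
    qed
    ultimately show ?thesis using True by (simp add: indicator_def)
  next
    case False
    have "x \<notin> ?I d" if "d < b" for d
      using False base_interval_subset[OF that] by blast
    then have "(\<Sum>d<b. indicator (?I d) x) = (0 :: ennreal)" by (intro sum.neutral) (simp add: indicator_def)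
    then show ?thesis by (simp only: indicator_simps(2)[OF False])
  qed
  have "(\<integral>\<^sup>+x. g (frac (real b * x)) \<partial>unit_lborel) = (\<integral>\<^sup>+x. (\<Sum>d<b. indicator (?I d) x * g (frac (real b * x))) \<partial>lborel)"
    unfolding nn_integral_unit_lborel split by (simp add: sum_distrib_left mult.commute)
  also have "\<dots> = (\<Sum>d<b. ennreal (1 / real b) * (\<integral>\<^sup>+x. g x \<partial>unit_lborel))"
    by (subst nn_integral_sum, measurable) (intro sum.cong refl nn_integral_base_branch, use b in auto)
  also have "\<dots> = (\<integral>\<^sup>+x. g x \<partial>unit_lborel)"
  proof -
    have "of_nat b * ennreal (1 / real b) = 1"
      using b by (simp add: ennreal_of_nat_eq_real_of_nat ennreal_mult'[symmetric])
    then show ?thesis by (simp add: mult.assoc[symmetric])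
  qed
  finally show ?thesis .
qed

lemma measure_base_visits_deviation_le:
  assumes b: "2 \<le> b" "d < b" and pos: "0 < \<epsilon>" "0 < N"
  shows "measure unit_lborel {u \<in> {0..<1}. \<epsilon> * real N \<le>
    \<bar>real (card {j. j < N \<and> \<lfloor>real b ^ Suc j * u\<rfloor> mod int b = int d}) - real N * (1 / real b)\<bar>} \<le> 3 / (\<epsilon>\<^sup>2 * real N)"
proof -
  define T where "T u = frac (real b * u)" for u
  let ?A = "{real d / real b..<(real d + 1) / real b}"
  have [measurable]: "frac \<in> borel_measurable (borel :: real measure)" unfolding frac_def[abs_def] by measurable
  have T_borel[measurable]: "T \<in> borel_measurable borel" unfolding T_def[abs_def] by measurable
  have "T \<in> measurable (restrict_space borel {0..<1}) (restrict_space borel {0..<1})"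
    by (intro measurable_restrict_space3) (auto simp: T_def frac_ge_0 frac_lt_1)
  then have T: "T \<in> measurable unit_lborel unit_lborel"
    by (simp cong: measurable_cong_sets add: sets_unit_lborel)
  have A: "?A \<in> sets unit_lborel" "?A \<subseteq> {0..<1}"
    by (rule sets_unit_lborelI[OF _ base_interval_subset[OF b(2)]], simp) (rule base_interval_subset[OF b(2)])
  have inv: "measure unit_lborel (T -` B \<inter> space unit_lborel) = measure unit_lborel B" if B: "B \<in> sets unit_lborel" for B
  proof -
    have [measurable]: "B \<in> sets borel" using sets_unit_lborelD[OF B] by simp
    have "emeasure unit_lborel (T -` B \<inter> space unit_lborel) = (\<integral>\<^sup>+x. indicator (T -` B \<inter> space unit_lborel) x \<partial>unit_lborel)"
      using measurable_sets[OF T B] by simp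
    also have "\<dots> = (\<integral>\<^sup>+x. indicator B (frac (real b * x)) \<partial>unit_lborel)"
      by (intro nn_integral_cong) (simp add: T_def indicator_def)
    also have "\<dots> = (\<integral>\<^sup>+x. indicator B x \<partial>unit_lborel)"
      by (rule nn_integral_base_map) (use b in auto)
    also have "\<dots> = emeasure unit_lborel B" using B by simp
    finally show ?thesis by (simp add: unit.emeasure_eq_measure)
  qed
  have meas_A: "measure unit_lborel ?A = 1 / real b"
  proof -
    have "emeasure unit_lborel ?A = ennreal ((real d + 1) / real b - real d / real b)"
      unfolding emeasure_unit_lborel[OF A(2)] using b by (subst emeasure_lborel_Ico) (auto simp: divide_right_mono)
    then show ?thesis by (simp add: unit.emeasure_eq_measure diff_divide_distrib[symmetric])
  qed
  have Tn: "T ^^ n \<in> measurable unit_lborel unit_lborel" for n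
    by (induction n) (auto intro: measurable_compose[OF _ T])
  \<comment> \<open>For \<open>n > 0\<close> the correlation is exactly the product; the error term
    is spent at \<open>n = 0\<close> only.\<close>
  have corr: "measure unit_lborel (?A \<inter> ((T ^^ n) -` ?A \<inter> space unit_lborel)) \<le> (measure unit_lborel ?A)\<^sup>2 + (1 / 2) ^ n" for n
  proof (cases n)
    case 0
    have "measure unit_lborel (?A \<inter> ((T ^^ n) -` ?A \<inter> space unit_lborel)) \<le> 1" by simp
    then show ?thesis using 0 by (simp add: power2_eq_square add_increasing)
  next
    case (Suc m)
    let ?C = "(T ^^ m) -` ?A \<inter> space unit_lborel"
    have C: "?C \<in> sets unit_lborel" using measurable_sets[OF Tn A(1)] .
    then have [measurable]: "?C \<in> sets borel" using sets_unit_lborelD by blast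
    have meas_C: "measure unit_lborel ?C = 1 / real b"
    proof -
      have "measure unit_lborel ((T ^^ m) -` ?A \<inter> space unit_lborel) = measure unit_lborel ?A" for m
      proof (induction m)
        case 0
        then show ?case using A by (auto simp: space_unit_lborel intro!: arg_cong[where f = "measure _"])
      next
        case (Suc m)
        have "(T ^^ Suc m) -` ?A \<inter> space unit_lborel = T -` ((T ^^ m) -` ?A \<inter> space unit_lborel) \<inter> space unit_lborel"
          using measurable_space[OF T] by (auto simp: funpow_swap1)
        then have "measure unit_lborel ((T ^^ Suc m) -` ?A \<inter> space unit_lborel) =
            measure unit_lborel (T -` ((T ^^ m) -` ?A \<inter> space unit_lborel) \<inter> space unit_lborel)"
          by (simp only:)
        also have "\<dots> = measure unit_lborel ?A"
          using inv[OF measurable_sets[OF Tn A(1)]] Suc by (rule trans)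
        finally show ?case .
      qed
      then show ?thesis using meas_A by simp
    qed
    have "?A \<inter> ((T ^^ n) -` ?A \<inter> space unit_lborel) \<in> sets unit_lborel"
      using measurable_sets[OF Tn A(1)] A(1) by blast
    then have "emeasure unit_lborel (?A \<inter> ((T ^^ n) -` ?A \<inter> space unit_lborel)) =
      (\<integral>\<^sup>+x. indicator (?A \<inter> ((T ^^ n) -` ?A \<inter> space unit_lborel)) x \<partial>unit_lborel)" by simp
    also have "\<dots> = (\<integral>\<^sup>+x. indicator ?A x * indicator ?C (frac (real b * x)) \<partial>lborel)"
      unfolding nn_integral_unit_lborel
    proof (intro nn_integral_cong)
      fix x :: real
      have "frac (real b * x) \<in> space unit_lborel" by (simp add: space_unit_lborel frac_ge_0 frac_lt_1)
      then show "indicator (?A \<inter> ((T ^^ n) -` ?A \<inter> space unit_lborel)) x * indicator {0..<1} x =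
        (indicator ?A x * indicator ?C (frac (real b * x)) :: ennreal)"
        using subsetD[OF A(2), of x] by (auto simp: indicator_def Suc funpow_swap1 space_unit_lborel T_def[symmetric])
    qed
    also have "\<dots> = ennreal (1 / real b) * (\<integral>\<^sup>+x. indicator ?C x \<partial>unit_lborel)"
      using b by (intro nn_integral_base_branch) measurable
    also have "\<dots> = ennreal (1 / real b) * ennreal (1 / real b)"
      using C by (simp add: unit.emeasure_eq_measure meas_C)
    also have "\<dots> = ennreal (1 / real b * (1 / real b))"
      by (rule ennreal_mult[symmetric]) auto
    finally show ?thesis
      unfolding meas_A by (simp add: unit.emeasure_eq_measure power2_eq_square)
  qed
  have pow: "(T ^^ j) u = frac (real b ^ j * u)" if "u \<in> {0..<1}" for j u
  proof (induction j)
    case 0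
    then show ?case using that by (simp add: frac_eq)
  next
    case (Suc j)
    have "real b * (real b ^ j * u) = of_int (int b * \<lfloor>real b ^ j * u\<rfloor>) + real b * frac (real b ^ j * u)"
      by (simp add: frac_def algebra_simps)
    then have "frac (real b * (real b ^ j * u)) = frac (real b * frac (real b ^ j * u))"
      using frac_add_int_left[OF Ints_of_int] by metis
    then show ?case using Suc by (simp add: T_def mult.assoc)
  qed
  have "{u \<in> {0..<1}. \<epsilon> * real N \<le> \<bar>real (card {j. j < N \<and> \<lfloor>real b ^ Suc j * u\<rfloor> mod int b = int d}) - real N * (1 / real b)\<bar>}
    = {u \<in> space unit_lborel. \<epsilon> * real N \<le> \<bar>real (card {j. j < N \<and> (T ^^ j) u \<in> ?A}) - real N * measure unit_lborel ?A\<bar>}"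
    unfolding space_unit_lborel meas_A using pow floor_mult_mod_eq_iff[OF b] by (auto simp: mult.assoc)
  then show ?thesis
    using unit.prob_visits_deviation_le[OF T inv A(1) corr pos] by simp
qed

text \<open>The map u to 1 / (1 + u) is the inverse branch of the Gauss map for
  \<open>k = 0\<close>, injective with derivative at least 1/4 in absolute value, so it shrinks
  measures by a factor of at most 4.\<close>

lemma measure_inverse_le:
  assumes [measurable]: "Measurable.pred borel P"
  shows "measure unit_lborel {u \<in> {0..<1}. P (1 / (1 + u))} \<le> 4 * measure unit_lborel {u \<in> {0..<1}. P u}"
proof -
  let ?A = "{u \<in> {0..<1}. P u}" and ?B = "{u \<in> {0..<1}. P (1 / (1 + u))}"
  have A: "?A \<in> sets unit_lborel" by (intro sets_Collect_unit_lborel) measurable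
  have B: "?B \<in> sets unit_lborel" by (intro sets_Collect_unit_lborel) measurable
  have [measurable]: "?A \<in> sets borel" "?B \<in> sets borel" using sets_unit_lborelD A B by blast+
  have "ennreal (1 / 4) * emeasure unit_lborel ?B = (\<integral>\<^sup>+u. ennreal (1 / 4) * indicator ?B u \<partial>lborel)"
  proof -
    have "emeasure unit_lborel ?B = emeasure lborel ?B" by (intro emeasure_unit_lborel) auto
    then show ?thesis by (subst nn_integral_cmult_indicator) auto
  qed
  also have "\<dots> \<le> (\<integral>\<^sup>+y. indicator ?A (1 / (real 0 + 1 + y)) * ennreal (1 / (real 0 + 1 + y)\<^sup>2) * indicator {0..1} y \<partial>lborel)"
  proof (rule nn_integral_mono_AE)
    \<comment> \<open>The point 0 is dropped because its image 1 lies outside [0, 1).\<close>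
    have "AE y :: real in lborel. y \<noteq> 0" using AE_lborel_singleton by blast
    then show "AE y in lborel. ennreal (1 / 4) * indicator ?B y \<le>
      indicator ?A (1 / (real 0 + 1 + y)) * ennreal (1 / (real 0 + 1 + y)\<^sup>2) * indicator {0..1} y"
    proof eventually_elim
      case (elim y)
      show ?case
      proof (cases "y \<in> ?B")
        case True
        then have "1 / (1 + y) \<in> ?A" using elim by (auto simp: divide_less_eq_1)
        moreover have "(1 + y)\<^sup>2 \<le> 2\<^sup>2" using True by (intro power_mono) auto
        then have "1 / 4 \<le> 1 / (1 + y)\<^sup>2" using True by (intro divide_left_mono) auto
        ultimately show ?thesis using True by (auto simp: indicator_def intro!: ennreal_leI)
      qed simp
    qed
  qed
  also have "\<dots> = (\<integral>\<^sup>+x. indicator ?A x * indicator {1 / (real 0 + 2)..1 / (real 0 + 1)} x \<partial>lborel)"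
    by (rule nn_integral_inverse_branch[symmetric]) measurable
  also have "\<dots> \<le> (\<integral>\<^sup>+x. indicator ?A x \<partial>lborel)"
    by (intro nn_integral_mono) (auto simp: indicator_def)
  also have "\<dots> = emeasure lborel ?A" by simp
  also have "\<dots> = emeasure unit_lborel ?A" by (intro emeasure_unit_lborel[symmetric]) auto
  finally have "ennreal (1 / 4) * ennreal (measure unit_lborel ?B) \<le> ennreal (measure unit_lborel ?A)"
    unfolding unit.emeasure_eq_measure .
  moreover have "ennreal (1 / 4 * measure unit_lborel ?B) = ennreal (1 / 4) * ennreal (measure unit_lborel ?B)"
    by (rule ennreal_mult) auto
  ultimately have "ennreal (1 / 4 * measure unit_lborel ?B) \<le> ennreal (measure unit_lborel ?A)"
    by (simp only:)
  then show ?thesis by (subst (asm) ennreal_le_iff) auto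
qed

section \<open>Typical points\<close>

text \<open>Digits are read off \<open>x\<close> itself and not off \<open>frac x\<close>, so that
  for a rational \<open>x\<close> they come from one integer division. The integer part only adds a
  multiple of \<open>b\<close>, because the exponent is positive.\<close>

definition digit_visits :: "nat \<Rightarrow> nat \<Rightarrow> real \<Rightarrow> nat \<Rightarrow> nat" where
  "digit_visits b d x N = card {i. i < N \<and> \<lfloor>real b ^ Suc i * x\<rfloor> mod int b = int d}"

definition cf_visits :: "real \<Rightarrow> real \<Rightarrow> nat \<Rightarrow> nat" where
  "cf_visits r x N = card {i. i < N \<and> frac (complete_quotient x i) < r}"

definition near_mean :: "nat \<Rightarrow> nat \<Rightarrow> nat \<Rightarrow> real \<Rightarrow> bool" where
  "near_mean n N C p \<longleftrightarrow> \<bar>real C - real N * p\<bar> \<le> real N / real (Suc n)"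

definition typical_at :: "nat \<Rightarrow> nat \<Rightarrow> nat \<Rightarrow> nat \<Rightarrow> real \<Rightarrow> bool" where
  "typical_at n N b d x \<longleftrightarrow> near_mean n N (digit_visits b d x N) (1 / real b) \<and>
    near_mean n N (digit_visits b d (1 / x) N) (1 / real b) \<and>
    near_mean n N (cf_visits (real d / real b) x N) (log 2 (1 + real d / real b))"

text \<open>
  The check times \<open>j\<^sup>2\<close> are sparse enough for Chebyshev bounds of order \<open>1 / j\<^sup>2\<close> to be summable, and
  dense enough to control all times in between.
\<close>

definition typical :: "nat \<Rightarrow> real \<Rightarrow> bool" where
  "typical n x \<longleftrightarrow> (\<forall>j\<in>{64 ^ n..<64 ^ Suc n}. \<forall>b\<in>{2..n}. \<forall>d<b. typical_at n (j\<^sup>2) b d x)"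

lemma digit_visits_eq_sum: "real (digit_visits b d x N) = (\<Sum>i<N. of_bool (\<lfloor>real b ^ Suc i * x\<rfloor> mod int b = int d))"
  by (simp add: digit_visits_def of_bool_def sum.If_cases Int_def)

lemma measurable_digit_visits[measurable (raw)]:
  assumes "f \<in> borel_measurable M"
  shows "(\<lambda>x. real (digit_visits b d (f x) N)) \<in> borel_measurable M"
proof -
  have [measurable]: "Measurable.pred M (\<lambda>x. \<lfloor>real b ^ Suc i * f x\<rfloor> mod int b = int d)" for i
  proof -
    note [measurable] = assms
    have "(\<lambda>x. \<lfloor>real b ^ Suc i * f x\<rfloor>) \<in> measurable M (count_space UNIV)" by measurable
    then show ?thesis by (rule measurable_compose) auto
  qed
  show ?thesis unfolding digit_visits_eq_sum of_bool_def by measurable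
qed

lemma measurable_near_mean[measurable (raw)]:
  assumes [measurable]: "(\<lambda>x. real (C x)) \<in> borel_measurable M"
  shows "Measurable.pred M (\<lambda>x. near_mean n N (C x) p)"
  unfolding near_mean_def by measurable

lemma digit_visits_add_1:
  assumes "2 \<le> b" shows "digit_visits b d (1 + u) N = digit_visits b d u N"
proof -
  have "\<lfloor>real b ^ Suc i * (1 + u)\<rfloor> mod int b = \<lfloor>real b ^ Suc i * u\<rfloor> mod int b" for i
  proof -
    have "real b ^ Suc i * (1 + u) = real b ^ Suc i * u + of_int (int b * int b ^ i)"
      by (simp add: algebra_simps)
    then have "\<lfloor>real b ^ Suc i * (1 + u)\<rfloor> = \<lfloor>real b ^ Suc i * u\<rfloor> + int b * int b ^ i" by linarith
    then show ?thesis by simp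
  qed
  then show ?thesis unfolding digit_visits_def by simp
qed

lemma frac_complete_quotient_add_1:
  assumes "u \<in> {0..<1}" shows "frac (complete_quotient (1 + u) i) = (gauss_map ^^ i) u"
proof (induction i)
  case 0
  have "frac (1 + u) = frac u" by (rule frac_add_int_left) simp
  then show ?case using assms by (simp add: frac_eq)
qed (simp add: gauss_map_def)

lemma cf_visits_add_1:
  "u \<in> {0..<1} \<Longrightarrow> cf_visits r (1 + u) N = card {j. j < N \<and> (gauss_map ^^ j) u < r}"
  by (simp add: cf_visits_def frac_complete_quotient_add_1)

lemma measurable_gauss_visits[measurable]:
  "(\<lambda>u. real (card {j. j < N \<and> (gauss_map ^^ j) u < r})) \<in> borel_measurable borel"
proof -
  have pow[measurable]: "gauss_map ^^ j \<in> borel_measurable borel" for j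
    by (induction j) (auto intro: measurable_comp[OF _ borel_measurable_gauss_map])
  have "real (card {j. j < N \<and> (gauss_map ^^ j) u < r}) = (\<Sum>j<N. indicator {..<r} ((gauss_map ^^ j) u))" for u
    by (simp add: indicator_def sum.If_cases Int_def)
  then show ?thesis by simp
qed

lemma not_near_mean_subset:
  "\<not> near_mean n N C p \<Longrightarrow> 1 / real (Suc n) * real N \<le> \<bar>real C - real N * p\<bar>"
  by (simp add: near_mean_def)

lemma not_typical_at_Un:
  assumes "2 \<le> b"
  shows "{u \<in> {0..<1}. \<not> typical_at n N b d (1 + u)} =
     {u \<in> {0..<1}. \<not> near_mean n N (digit_visits b d u N) (1 / real b)} \<union>
     {u \<in> {0..<1}. \<not> near_mean n N (digit_visits b d (1 / (1 + u)) N) (1 / real b)} \<union>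
     {u \<in> {0..<1}. \<not> near_mean n N (card {j. j < N \<and> (gauss_map ^^ j) u < real d / real b}) (log 2 (1 + real d / real b))}"
  using assms by (auto simp: typical_at_def digit_visits_add_1 cf_visits_add_1)

lemma sets_not_typical_at:
  assumes "2 \<le> b" shows "{u \<in> {0..<1}. \<not> typical_at n N b d (1 + u)} \<in> sets unit_lborel"
proof -
  have "Measurable.pred borel (\<lambda>u. \<not> near_mean n N (digit_visits b d u N) (1 / real b))"
    "Measurable.pred borel (\<lambda>u. \<not> near_mean n N (digit_visits b d (1 / (1 + u)) N) (1 / real b))"
    "Measurable.pred borel (\<lambda>u. \<not> near_mean n N (card {j. j < N \<and> (gauss_map ^^ j) u < real d / real b}) (log 2 (1 + real d / real b)))"
    by measurable
  then show ?thesis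
    unfolding not_typical_at_Un[OF assms] by (intro sets.Un sets_Collect_unit_lborel)
qed

text \<open>21 = 3 + 4 * 3 + 6: the digits of \<open>u\<close>, the digits of
  \<open>1 / (1 + u)\<close> with the distortion factor 4, and the orbit of the Gauss map with the
  factor 2 between the measures.\<close>

lemma measure_not_typical_at_le:
  assumes b: "2 \<le> b" "d < b" and N: "0 < N"
  shows "measure unit_lborel {u \<in> {0..<1}. \<not> typical_at n N b d (1 + u)} \<le> 21 * (real (Suc n))\<^sup>2 / real N"
proof -
  let ?\<epsilon> = "1 / real (Suc n)"
  let ?P = "\<lambda>u. \<not> near_mean n N (digit_visits b d u N) (1 / real b)"
  let ?A = "{u \<in> {0..<1}. ?P u}"
  let ?B = "{u \<in> {0..<1}. ?P (1 / (1 + u))}"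
  let ?C = "{u \<in> {0..<1}. \<not> near_mean n N (card {j. j < N \<and> (gauss_map ^^ j) u < real d / real b}) (log 2 (1 + real d / real b))}"
  have P: "Measurable.pred borel ?P" "Measurable.pred borel (\<lambda>u. ?P (1 / (1 + u)))"
    "Measurable.pred borel (\<lambda>u. \<not> near_mean n N (card {j. j < N \<and> (gauss_map ^^ j) u < real d / real b}) (log 2 (1 + real d / real b)))"
    by measurable
  note sets = P[THEN sets_Collect_unit_lborel]
  have r: "0 \<le> real d / real b" "real d / real b \<le> 1" using b by auto
  have "measure unit_lborel ?A \<le> measure unit_lborel {u \<in> {0..<1}.
      ?\<epsilon> * real N \<le> \<bar>real (digit_visits b d u N) - real N * (1 / real b)\<bar>}"
  proof (rule unit.finite_measure_mono)
    show "?A \<subseteq> {u \<in> {0..<1}. ?\<epsilon> * real N \<le> \<bar>real (digit_visits b d u N) - real N * (1 / real b)\<bar>}"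
      using not_near_mean_subset by blast
  qed (rule sets_Collect_unit_lborel, measurable)
  also have "\<dots> \<le> 3 / (?\<epsilon>\<^sup>2 * real N)"
    unfolding digit_visits_def by (rule measure_base_visits_deviation_le[OF b _ N]) simp
  finally have "measure unit_lborel ?A \<le> 3 / (?\<epsilon>\<^sup>2 * real N)" .
  moreover have "measure unit_lborel ?B \<le> 4 * measure unit_lborel ?A"
    by (rule measure_inverse_le) measurable
  moreover have "measure unit_lborel ?C \<le> 6 / (?\<epsilon>\<^sup>2 * real N)"
  proof -
    have "measure unit_lborel ?C \<le> measure unit_lborel {u \<in> {0..<1}. ?\<epsilon> * real N \<le> \<bar>real (card {j. j < N \<and> (gauss_map ^^ j) u < real d / real b})
         - real N * log 2 (1 + real d / real b)\<bar>}" (is "_ \<le> measure _ ?D")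
    proof (rule unit.finite_measure_mono)
      show "?C \<subseteq> ?D" using not_near_mean_subset by blast
    qed (rule sets_Collect_unit_lborel, measurable)
    also have "\<dots> \<le> 6 / (?\<epsilon>\<^sup>2 * real N)"
      by (rule measure_gauss_visits_deviation_le[OF r _ N]) simp
    finally show ?thesis .
  qed
  moreover have "measure unit_lborel (?A \<union> ?B \<union> ?C) \<le> measure unit_lborel ?A + measure unit_lborel ?B + measure unit_lborel ?C"
    using measure_Un_le[of "?A \<union> ?B" unit_lborel ?C] measure_Un_le[of ?A unit_lborel ?B] sets by simp
  moreover have "1 / (?\<epsilon>\<^sup>2 * real N) = (real (Suc n))\<^sup>2 / real N" by (simp add: power2_eq_square)
  ultimately show ?thesis unfolding not_typical_at_Un[OF b(1)] by (simp add: field_simps)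
qed

text \<open>1 / j^2 is at most 2 / (j (j + 1)), which telescopes.\<close>

lemma sum_inverse_squares_le:
  assumes "0 < M" shows "(\<Sum>j\<in>{M..<K}. 1 / (real j)\<^sup>2) \<le> 2 / real M"
proof -
  have *: "(\<Sum>j\<in>{M..<M + k}. 1 / (real j)\<^sup>2) \<le> 2 / real M - 2 / real (M + k)" for k
  proof (induction k)
    case (Suc k)
    define t where "t = real (M + k)"
    have t: "t \<ge> 1" using assms by (simp add: t_def)
    have "1 / t\<^sup>2 \<le> 2 / t - 2 / (t + 1)"
    proof -
      have "1 / t\<^sup>2 = 2 / (2 * t\<^sup>2)" by simp
      also have "\<dots> \<le> 2 / (t * (t + 1))"
      proof (rule divide_left_mono)
        show "t * (t + 1) \<le> 2 * t\<^sup>2"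
          using t mult_left_mono[OF t, of t] by (simp add: power2_eq_square algebra_simps)
        show "0 < 2 * t\<^sup>2 * (t * (t + 1))" using t by (intro mult_pos_pos) auto
      qed simp
      also have "\<dots> = 2 / t - 2 / (t + 1)" using t by (simp add: diff_frac_eq)
      finally show ?thesis .
    qed
    moreover have "real (M + Suc k) = t + 1" by (simp add: t_def)
    ultimately show ?case using Suc by (simp add: t_def[symmetric] add.commute)
  qed simp
  show ?thesis
  proof (cases "M \<le> K")
    case True
    then show ?thesis using *[of "K - M"] by (simp add: field_simps) (smt (verit) divide_nonneg_nonneg of_nat_0_le_iff)
  qed simp
qed

text \<open>With this shift, the bound \<open>42 (n + 1)\<^sup>4 / 64\<^sup>n\<close> below drops under \<open>4\<^sup>-\<^sup>n / 16\<close>.\<close>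

definition stage_shift :: nat where "stage_shift = 6"

text \<open>A union bound. One factor (n + 1)^2 comes from the tolerance 1 / (n + 1) in Chebyshev's
  inequality, the other bounds the number of pairs of base and digit; summing 1 / j^2 from j = 64^n
  on turns 21 into 42 / 64^n.\<close>

lemma sets_not_typical: "{u \<in> {0..<1}. \<not> typical n (1 + u)} \<in> sets unit_lborel"
  and measure_not_typical_le: "measure unit_lborel {u \<in> {0..<1}. \<not> typical n (1 + u)} \<le> 42 * (real (Suc n)) ^ 4 / 64 ^ n"
proof -
  define J where "J = {64 ^ n..<64 ^ Suc n :: nat}"
  define D where "D = (SIGMA b:{2..n}. {..<b})"
  let ?E = "\<lambda>(j, b, d). {u \<in> {0..<1}. \<not> typical_at n (j\<^sup>2) b d (1 + u)}"
  have fin: "finite J" "finite D" by (auto simp: J_def D_def)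
  have Un: "{u \<in> {0..<1}. \<not> typical n (1 + u)} = (\<Union>i\<in>J \<times> D. ?E i)"
    unfolding typical_def J_def D_def by auto
  have sets: "?E ` (J \<times> D) \<subseteq> sets unit_lborel"
    by (auto simp: D_def intro!: sets_not_typical_at[simplified])
  then show "{u \<in> {0..<1}. \<not> typical n (1 + u)} \<in> sets unit_lborel"
    unfolding Un using fin by (intro sets.finite_UN) auto
  have "D \<subseteq> {..<Suc n} \<times> {..<Suc n}" by (auto simp: D_def)
  from card_mono[OF _ this] have card_D: "card D \<le> Suc n * Suc n" by (simp only: card_cartesian_product card_lessThan finite_cartesian_product finite_lessThan)
  have "measure unit_lborel {u \<in> {0..<1}. \<not> typical n (1 + u)} \<le> (\<Sum>i\<in>J \<times> D. measure unit_lborel (?E i))"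
    unfolding Un using fin sets by (intro unit.finite_measure_subadditive_finite) auto
  also have "\<dots> \<le> (\<Sum>i\<in>J \<times> D. 21 * (real (Suc n))\<^sup>2 * (1 / (real (fst i))\<^sup>2))"
  proof (intro sum_mono)
    fix i assume "i \<in> J \<times> D"
    then obtain j b d where i: "i = (j, b, d)" "64 ^ n \<le> j" "2 \<le> b" "d < b" by (auto simp: J_def D_def)
    have "0 < j" using i(2) by (rule less_le_trans[rotated]) simp
    then have "measure unit_lborel (?E i) \<le> 21 * (real (Suc n))\<^sup>2 / real (j\<^sup>2)"
      unfolding i prod.case using i by (intro measure_not_typical_at_le) auto
    then show "measure unit_lborel (?E i) \<le> 21 * (real (Suc n))\<^sup>2 * (1 / (real (fst i))\<^sup>2)"
      by (simp add: i)
  qed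
  also have "\<dots> = 21 * (real (Suc n))\<^sup>2 * real (card D) * (\<Sum>j\<in>J. 1 / (real j)\<^sup>2)"
    by (simp add: sum.cartesian_product' sum_distrib_left mult_ac)
  also have "\<dots> \<le> 21 * (real (Suc n))\<^sup>2 * (real (Suc n))\<^sup>2 * (2 / 64 ^ n)"
  proof (intro mult_mono)
    have "real (card D) \<le> real (Suc n * Suc n)" using card_D by (simp only: of_nat_le_iff)
    then show "real (card D) \<le> (real (Suc n))\<^sup>2" by (simp only: power2_eq_square of_nat_mult)
    show "(\<Sum>j\<in>J. 1 / (real j)\<^sup>2) \<le> 2 / 64 ^ n"
      using sum_inverse_squares_le[of "64 ^ n" "64 ^ Suc n"] unfolding J_def by simp
  qed (auto intro!: sum_nonneg)
  also have "\<dots> = 42 * (real (Suc n)) ^ 4 / 64 ^ n"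
    by (simp add: power2_eq_square power4_eq_xxxx)
  finally show "measure unit_lborel {u \<in> {0..<1}. \<not> typical n (1 + u)} \<le> 42 * (real (Suc n)) ^ 4 / 64 ^ n" .
qed

text \<open>Since n + 7 is at most 7 * 2^n, the polynomial factor costs at most 7^4 * 16^n. As 64^n
  = 16^n * 4^n, this leaves 4^-n, and 64^6 absorbs the constants.\<close>

lemma measure_not_typical_shift_le:
  "measure unit_lborel {u \<in> {0..<1}. \<not> typical (n + stage_shift) (1 + u)} < 1 / (16 * 4 ^ n)"
proof -
  have "real n + 7 \<le> 7 * 2 ^ n"
    by (induction n) auto
  then have "(real n + 7) ^ 4 \<le> (7 * 2 ^ n) ^ 4" by (intro power_mono) auto
  also have "\<dots> = 2401 * 16 ^ n" by (simp add: power_mult_distrib power_mult[symmetric] mult.commute[of n] power_mult)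
  finally have "42 * (real (Suc (n + stage_shift))) ^ 4 / 64 ^ (n + stage_shift) \<le> 42 * (2401 * 16 ^ n) / 64 ^ (n + stage_shift)"
    by (intro divide_right_mono mult_left_mono) (simp_all add: stage_shift_def add_ac)
  also have "\<dots> < 1 / (16 * 4 ^ n)"
  proof -
    have "(64 :: real) ^ n = 16 ^ n * 4 ^ n" by (simp flip: power_mult_distrib)
    then show ?thesis by (simp add: stage_shift_def power_add divide_simps)
  qed
  finally show ?thesis using measure_not_typical_le[of "n + stage_shift"] by simp
qed

section \<open>Rational approximations of typical points\<close>

fun euclid :: "nat \<Rightarrow> nat \<Rightarrow> nat \<Rightarrow> nat" where
  "euclid p q 0 = p"
| "euclid p q (Suc 0) = q"
| "euclid p q (Suc (Suc i)) = euclid p q i mod euclid p q (Suc i)"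

lemma frac_of_nat_divide: "frac (real a / real b) = real (a mod b) / real b"
proof (cases "b = 0")
  case False
  have "real a = real b * real (a div b) + real (a mod b)" by (metis mult_div_mod_eq of_nat_add of_nat_mult)
  then have "real a / real b = real (a div b) + real (a mod b) / real b"
    using False by (metis add_divide_distrib nonzero_mult_div_cancel_left of_nat_eq_0_iff)
  then show ?thesis unfolding frac_def floor_divide_of_nat_eq by simp
qed simp

text \<open>This also holds past the end of the expansion: there \<open>a mod 0 = a\<close> makes
  the remainders alternate between 0 and a fixed number, so every quotient is 0, in accordance with
  \<open>1 / 0 = 0\<close>.\<close>

lemma complete_quotient_rational:
  "complete_quotient (real p / real q) i = real (euclid p q i) / real (euclid p q (Suc i))"
  by (induction i) (auto simp: frac_of_nat_divide)

text \<open>A bound for all check times j^2 of stage \<open>n\<close>.\<close>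

definition horizon :: "nat \<Rightarrow> nat" where "horizon n = (64 ^ Suc n)\<^sup>2"

text \<open>All the data that \<open>typical n\<close> depends on. Frequencies need not vary
  monotonically between two points, but equality of these data passes to every point in between once
  the digits are positive.\<close>

definition agree :: "nat \<Rightarrow> real \<Rightarrow> real \<Rightarrow> bool" where
  "agree n x y \<longleftrightarrow> (\<forall>i<Suc (horizon n).
     \<lfloor>complete_quotient x i\<rfloor> = \<lfloor>complete_quotient y i\<rfloor> \<and>
     (\<forall>b<Suc n. 2 \<le> b \<longrightarrow> \<lfloor>real b ^ i * x\<rfloor> = \<lfloor>real b ^ i * y\<rfloor> \<and>
       \<lfloor>real b ^ i * (1 / x)\<rfloor> = \<lfloor>real b ^ i * (1 / y)\<rfloor> \<and>
       (\<forall>d<b. frac (complete_quotient x i) < real d / real b \<longleftrightarrow>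
         frac (complete_quotient y i) < real d / real b)))"

text \<open>A digit 0 at a positive position signals an expansion that has ended. Positivity keeps
  two points with equal digits on common branches; holding for every \<open>n\<close>, it excludes
  rational numbers.\<close>

definition cf_digits_pos :: "nat \<Rightarrow> real \<Rightarrow> bool" where
  "cf_digits_pos n x \<longleftrightarrow> (\<forall>i<Suc (horizon n). 1 \<le> \<lfloor>complete_quotient x i\<rfloor>)"

lemma agreeD:
  assumes "agree n x y" "i < Suc (horizon n)"
  shows "\<lfloor>complete_quotient x i\<rfloor> = \<lfloor>complete_quotient y i\<rfloor>"
    and "b < Suc n \<Longrightarrow> 2 \<le> b \<Longrightarrow> \<lfloor>real b ^ i * x\<rfloor> = \<lfloor>real b ^ i * y\<rfloor>"
    and "b < Suc n \<Longrightarrow> 2 \<le> b \<Longrightarrow> \<lfloor>real b ^ i * (1 / x)\<rfloor> = \<lfloor>real b ^ i * (1 / y)\<rfloor>"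
    and "b < Suc n \<Longrightarrow> 2 \<le> b \<Longrightarrow> d < b \<Longrightarrow>
      frac (complete_quotient x i) < real d / real b \<longleftrightarrow> frac (complete_quotient y i) < real d / real b"
  using assms by (simp_all add: agree_def)

lemma agree_sym: "agree n x y \<Longrightarrow> agree n y x"
  unfolding agree_def by simp

lemma agree_trans: "agree n x y \<Longrightarrow> agree n y z \<Longrightarrow> agree n x z"
  unfolding agree_def by simp

lemma typical_agree:
  assumes "agree n x y" shows "typical n x \<longleftrightarrow> typical n y"
proof -
  have "typical_at n (j\<^sup>2) b d x \<longleftrightarrow> typical_at n (j\<^sup>2) b d y"
    if j: "j < 64 ^ Suc n" and b: "2 \<le> b" "b < Suc n" "d < b" for j b d
  proof -
    have "j\<^sup>2 \<le> horizon n" unfolding horizon_def using j by (intro power_mono) auto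
    then have i: "i < Suc (horizon n)" "Suc i < Suc (horizon n)" if "i < j\<^sup>2" for i
      using that by linarith+
    have *: "\<lfloor>real b ^ Suc i * x\<rfloor> = \<lfloor>real b ^ Suc i * y\<rfloor>" "\<lfloor>real b ^ Suc i * (1 / x)\<rfloor> = \<lfloor>real b ^ Suc i * (1 / y)\<rfloor>"
      "frac (complete_quotient x i) < real d / real b \<longleftrightarrow> frac (complete_quotient y i) < real d / real b"
      if "i < j\<^sup>2" for i
      using agreeD[OF assms i(1)[OF that]] agreeD[OF assms i(2)[OF that]] b by blast+
    have "digit_visits b d x (j\<^sup>2) = digit_visits b d y (j\<^sup>2)"
      "digit_visits b d (1 / x) (j\<^sup>2) = digit_visits b d (1 / y) (j\<^sup>2)"
      unfolding digit_visits_def by (intro arg_cong[where f = card] Collect_cong conj_cong refl; simp only: *)+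
    moreover have "cf_visits (real d / real b) x (j\<^sup>2) = cf_visits (real d / real b) y (j\<^sup>2)"
      unfolding cf_visits_def by (intro arg_cong[where f = card] Collect_cong conj_cong refl *)
    ultimately show ?thesis by (simp add: typical_at_def)
  qed
  then show ?thesis unfolding typical_def by (auto simp: less_Suc_eq_le)
qed

lemma cf_digits_pos_agree: "agree n x y \<Longrightarrow> cf_digits_pos n x \<longleftrightarrow> cf_digits_pos n y"
  unfolding agree_def cf_digits_pos_def by simp

text \<open>Symmetric in the end points, because every passage to the reciprocal swaps their
  order.\<close>

definition between :: "real \<Rightarrow> real \<Rightarrow> real \<Rightarrow> bool" where
  "between u w x \<longleftrightarrow> u \<le> x \<and> x \<le> w \<or> w \<le> x \<and> x \<le> u"

lemma between_floor:
  assumes "between u w x" "\<lfloor>u\<rfloor> = \<lfloor>w\<rfloor>"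
  shows "\<lfloor>x\<rfloor> = \<lfloor>u\<rfloor>" "between (frac u) (frac w) (frac x)"
proof -
  have "between (of_int \<lfloor>u\<rfloor>) (of_int \<lfloor>w\<rfloor>) (of_int \<lfloor>x\<rfloor>)"
    using assms(1) unfolding between_def by (auto intro: floor_mono)
  then show *: "\<lfloor>x\<rfloor> = \<lfloor>u\<rfloor>" using assms(2) unfolding between_def by auto
  show "between (frac u) (frac w) (frac x)"
    using assms * unfolding between_def frac_def by auto
qed

lemma between_less_iff: "between u w x \<Longrightarrow> (u < r \<longleftrightarrow> w < r) \<Longrightarrow> x < r \<longleftrightarrow> u < r"
  unfolding between_def by auto

lemma between_mult: "0 \<le> c \<Longrightarrow> between u w x \<Longrightarrow> between (c * u) (c * w) (c * x)"
  unfolding between_def by (auto intro: mult_left_mono)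

lemma between_inverse: "between u w x \<Longrightarrow> 0 < u \<Longrightarrow> 0 < w \<Longrightarrow> between (1 / u) (1 / w) (1 / x)"
  unfolding between_def by (auto intro!: divide_left_mono mult_pos_pos)

text \<open>
  The branches of the Gauss map are monotone, so a point between two points with the same digits
  has complete quotients between theirs.
\<close>

lemma between_complete_quotient:
  assumes "between u w x" "\<And>j. j \<le> i \<Longrightarrow> \<lfloor>complete_quotient u j\<rfloor> = \<lfloor>complete_quotient w j\<rfloor>"
    "\<And>j. j \<le> i \<Longrightarrow> 1 \<le> \<lfloor>complete_quotient u j\<rfloor>"
  shows "between (complete_quotient u i) (complete_quotient w i) (complete_quotient x i)"
  using assms(2,3)
proof (induction i)
  case 0
  then show ?case using assms(1) by simp
next
  case (Suc i)
  have pos: "0 < frac (complete_quotient z i)" if "1 \<le> \<lfloor>complete_quotient z (Suc i)\<rfloor>" for z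
  proof -
    have "frac (complete_quotient z i) \<noteq> 0" using that by (intro notI) (simp del: frac_eq_0_iff)
    then show ?thesis using frac_ge_0[of "complete_quotient z i"] by linarith
  qed
  have "0 < frac (complete_quotient u i)" using Suc.prems(2)[of "Suc i"] by (intro pos) simp
  moreover have "0 < frac (complete_quotient w i)" using Suc.prems[of "Suc i"] by (intro pos) simp
  moreover have "between (frac (complete_quotient u i)) (frac (complete_quotient w i)) (frac (complete_quotient x i))"
    using Suc.prems by (intro between_floor(2) Suc.IH) (simp_all del: complete_quotient.simps)
  ultimately show ?case unfolding complete_quotient.simps by (intro between_inverse)
qed

lemma agree_between:
  assumes uw: "agree n u w" and pos: "cf_digits_pos n u" and x: "between u w x" and u: "0 < u" "0 < w"
  shows "agree n u x"
  unfolding agree_def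
proof (intro allI impI conjI)
  fix i assume i: "i < Suc (horizon n)"
  have CQ: "between (complete_quotient u i) (complete_quotient w i) (complete_quotient x i)"
    using agreeD(1)[OF uw] pos i unfolding cf_digits_pos_def by (intro between_complete_quotient[OF x]) auto
  have eq: "\<lfloor>complete_quotient u i\<rfloor> = \<lfloor>complete_quotient w i\<rfloor>" using agreeD(1)[OF uw i] .
  show "\<lfloor>complete_quotient u i\<rfloor> = \<lfloor>complete_quotient x i\<rfloor>" using between_floor(1)[OF CQ eq] by simp
  fix b assume b: "b < Suc n" "2 \<le> b"
  show "\<lfloor>real b ^ i * u\<rfloor> = \<lfloor>real b ^ i * x\<rfloor>"
    by (rule between_floor(1)[OF between_mult[OF _ x], symmetric]) (use agreeD[OF uw i] b in auto)
  show "\<lfloor>real b ^ i * (1 / u)\<rfloor> = \<lfloor>real b ^ i * (1 / x)\<rfloor>"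
    by (rule between_floor(1)[OF between_mult[OF _ between_inverse[OF x u]], symmetric])
      (use agreeD[OF uw i] b in auto)
  fix d assume "d < b"
  then show "frac (complete_quotient u i) < real d / real b \<longleftrightarrow> frac (complete_quotient x i) < real d / real b"
    using between_less_iff[OF between_floor(2)[OF CQ eq]] agreeD(4)[OF uw i b] by blast
qed

section \<open>Local constancy of the data at irrational points\<close>

lemma irrational_complete_quotient:
  assumes "x \<notin> \<rat>" shows "complete_quotient x i \<notin> \<rat>"
proof (induction i)
  case (Suc i)
  show ?case
  proof
    assume "complete_quotient x (Suc i) \<in> \<rat>"
    then have "1 / complete_quotient x (Suc i) \<in> \<rat>" by (intro Rats_divide Rats_1)
    then have "frac (complete_quotient x i) + of_int \<lfloor>complete_quotient x i\<rfloor> \<in> \<rat>"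
      by (intro Rats_add Rats_of_int) simp
    then show False using Suc by (simp add: frac_def)
  qed
qed (use assms in simp)

lemma irrational_inverse:
  fixes z :: real
  assumes "z \<notin> \<rat>" shows "1 / z \<notin> \<rat>"
proof
  assume "1 / z \<in> \<rat>"
  then have "1 / (1 / z) \<in> \<rat>" by (rule Rats_divide[OF Rats_1])
  then show False using assms by simp
qed

lemma irrational_frac:
  fixes z :: real
  assumes "z \<notin> \<rat>" shows "frac z \<notin> \<rat>"
proof -
  have "z = frac z + of_int \<lfloor>z\<rfloor>" by (simp add: frac_def)
  then show ?thesis using assms by (metis Rats_add Rats_of_int)
qed

lemma frac_pos_if_irrational:
  assumes "z \<notin> \<rat>" shows "0 < frac z"
proof -
  have "z \<notin> \<int>" using assms Ints_subset_Rats by blast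
  then show ?thesis using frac_gt_0_iff by blast
qed

lemma complete_quotient_gt_1:
  assumes "x \<notin> \<rat>" "1 < x" shows "1 < complete_quotient x i"
proof (cases i)
  case (Suc j)
  then show ?thesis
    using frac_pos_if_irrational[OF irrational_complete_quotient[OF assms(1)]] frac_lt_1 by simp
qed (use assms in simp)

lemma eventually_floor_eq:
  fixes f :: "real \<Rightarrow> real"
  assumes "isCont f x" "f x \<notin> \<rat>"
  shows "eventually (\<lambda>y. \<lfloor>f y\<rfloor> = \<lfloor>f x\<rfloor>) (nhds x)"
proof -
  have lim: "(f \<longlongrightarrow> f x) (nhds x)" using assms(1) by (simp add: isCont_def tendsto_at_iff_tendsto_nhds)
  have "of_int \<lfloor>f x\<rfloor> \<noteq> f x" using assms(2) by (metis Rats_of_int)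
  then have "of_int \<lfloor>f x\<rfloor> < f x" "f x < of_int \<lfloor>f x\<rfloor> + 1" by linarith+
  then have "eventually (\<lambda>y. of_int \<lfloor>f x\<rfloor> < f y \<and> f y < of_int \<lfloor>f x\<rfloor> + 1) (nhds x)"
    using order_tendstoD[OF lim] by (intro eventually_conj) auto
  then show ?thesis by eventually_elim (simp add: floor_eq_iff)
qed

lemma isCont_frac:
  assumes "z \<notin> \<rat>" shows "isCont frac (z :: real)"
proof -
  have "eventually (\<lambda>y. frac y = y - of_int \<lfloor>z\<rfloor>) (nhds z)"
    using eventually_floor_eq[where f = "\<lambda>y. y" and x = z] assms by (auto elim: eventually_mono simp: frac_def)
  then show ?thesis by (subst isCont_cong) (auto intro!: continuous_intros)
qed

lemma isCont_complete_quotient: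
  assumes "x \<notin> \<rat>" shows "isCont (\<lambda>y. complete_quotient y i) x"
proof (induction i)
  case (Suc i)
  have "isCont (\<lambda>y. frac (complete_quotient y i)) x"
    using isCont_o2[OF Suc isCont_frac[OF irrational_complete_quotient[OF assms]]] .
  then show ?case
    using frac_pos_if_irrational[OF irrational_complete_quotient[OF assms, of i]] by (auto intro!: continuous_intros)
qed simp

lemma irrational_of_int_mult_iff: "z \<notin> \<rat> \<Longrightarrow> 0 < b \<Longrightarrow> real b ^ i * z \<notin> \<rat>"
  using Rats_divide[of "real b ^ i * z" "real b ^ i"] by (auto simp: Rats_power)

text \<open>The data jump only where some complete quotient or scaled number meets an integer, or a
  fractional part meets some \<open>d / b\<close>. At an irrational \<open>x\<close> none of these
  rational thresholds is attained, and only finitely many conditions occur.\<close>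

lemma eventually_agree:
  assumes x: "x \<notin> \<rat>" shows "eventually (agree n x) (nhds x)"
proof -
  have nz: "x \<noteq> 0" using x by auto
  note inv = irrational_inverse[OF x]
  have CQ: "eventually (\<lambda>y. \<lfloor>complete_quotient y i\<rfloor> = \<lfloor>complete_quotient x i\<rfloor>) (nhds x)" for i
    by (intro eventually_floor_eq isCont_complete_quotient irrational_complete_quotient x)
  have D: "eventually (\<lambda>y. \<lfloor>real b ^ i * y\<rfloor> = \<lfloor>real b ^ i * x\<rfloor>) (nhds x)" if "2 \<le> b" for b i
    using that by (intro eventually_floor_eq irrational_of_int_mult_iff x) auto
  have I: "eventually (\<lambda>y. \<lfloor>real b ^ i * (1 / y)\<rfloor> = \<lfloor>real b ^ i * (1 / x)\<rfloor>) (nhds x)" if "2 \<le> b" for b i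
    using that nz by (intro eventually_floor_eq irrational_of_int_mult_iff inv) (auto intro!: continuous_intros)
  have H: "eventually (\<lambda>y. frac (complete_quotient y i) < real d / real b \<longleftrightarrow> frac (complete_quotient x i) < real d / real b) (nhds x)" for i d b
  proof -
    let ?f = "\<lambda>y. frac (complete_quotient y i)"
    have "isCont ?f x"
      using isCont_o2[OF isCont_complete_quotient[OF x] isCont_frac[OF irrational_complete_quotient[OF x]]] .
    then have lim: "(?f \<longlongrightarrow> ?f x) (nhds x)"
      unfolding isCont_def tendsto_at_iff_tendsto_nhds[where g = ?f and l = x] .
    have "?f x \<noteq> real d / real b"
      using irrational_frac[OF irrational_complete_quotient[OF x, of i]] by (metis Rats_divide Rats_of_nat)
    then consider "?f x < real d / real b" | "real d / real b < ?f x" by linarith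
    then show ?thesis
    proof cases
      case 1
      from order_tendstoD(2)[OF lim this] show ?thesis by eventually_elim (use 1 in simp)
    next
      case 2
      from order_tendstoD(1)[OF lim this] show ?thesis by eventually_elim (use 2 in simp)
    qed
  qed
  have fin: "eventually (\<lambda>y. \<forall>i<m. P i y) (nhds x)" if "\<And>i. i < m \<Longrightarrow> eventually (P i) (nhds x)"
    for m :: nat and P
    using eventually_ball_finite[of "{..<m}" "\<lambda>y i. P i y" "nhds x"] that by (simp add: Ball_def)
  have imp: "eventually (\<lambda>y. A \<longrightarrow> P y) (nhds x)" if "A \<Longrightarrow> eventually P (nhds x)" for A P
    using that by (cases A) auto
  have "eventually (\<lambda>y. agree n y x) (nhds x)"
    unfolding agree_def by (intro fin imp eventually_conj CQ D I H)
  then show ?thesis by (rule eventually_mono) (rule agree_sym)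
qed

section \<open>Certificates\<close>

text \<open>
  The integer forms of the inequalities of \<open>near_mean\<close> for the two kinds of means that occur,
  \<open>1 / b\<close> and \<open>log\<^sub>2 (1 + d / b)\<close>.
\<close>

definition nat_near_mean :: "nat \<Rightarrow> nat \<Rightarrow> nat \<Rightarrow> nat \<Rightarrow> bool" where
  "nat_near_mean n N C b \<longleftrightarrow> Suc n * N \<le> Suc n * (b * C) + b * N \<and> Suc n * (b * C) \<le> Suc n * N + b * N"

definition nat_near_log :: "nat \<Rightarrow> nat \<Rightarrow> nat \<Rightarrow> nat \<Rightarrow> nat \<Rightarrow> bool" where
  "nat_near_log n N C b d \<longleftrightarrow> 2 ^ (Suc n * C) * b ^ (Suc n * N) \<le> (b + d) ^ (Suc n * N) * 2 ^ N \<and>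
    (b + d) ^ (Suc n * N) \<le> b ^ (Suc n * N) * 2 ^ (Suc n * C + N)"

lemma near_mean_iff:
  "near_mean n N C p \<longleftrightarrow> real (Suc n * C) \<le> real (Suc n * N) * p + real N \<and> real (Suc n * N) * p \<le> real (Suc n * C + N)"
proof -
  have "near_mean n N C p \<longleftrightarrow> \<bar>real C - real N * p\<bar> * real (Suc n) \<le> real N"
    unfolding near_mean_def by (rule pos_le_divide_eq) simp
  also have "\<bar>real C - real N * p\<bar> * real (Suc n) = \<bar>real (Suc n * C) - real (Suc n * N) * p\<bar>"
  proof -
    have "\<bar>real C - real N * p\<bar> * real (Suc n) = \<bar>(real C - real N * p) * real (Suc n)\<bar>" by (simp add: abs_mult)
    also have "(real C - real N * p) * real (Suc n) = real (Suc n * C) - real (Suc n * N) * p"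
      by (simp add: algebra_simps)
    finally show ?thesis .
  qed
  finally show ?thesis unfolding of_nat_add by linarith
qed

lemma near_mean_iff_nat:
  assumes "0 < b" shows "near_mean n N C (1 / real b) \<longleftrightarrow> nat_near_mean n N C b"
proof -
  have b: "0 < real b" using assms by simp
  have "near_mean n N C (1 / real b) \<longleftrightarrow>
      real b * real (Suc n * C) \<le> real b * (real (Suc n * N) * (1 / real b) + real N) \<and>
      real b * (real (Suc n * N) * (1 / real b)) \<le> real b * real (Suc n * C + N)"
    unfolding near_mean_iff mult_le_cancel_left_pos[OF b] ..
  also have "real b * real (Suc n * C) = real (Suc n * (b * C))" by (simp add: algebra_simps)
  also have "real b * (real (Suc n * N) * (1 / real b) + real N) = real (Suc n * N + b * N)"
    using b by (simp add: distrib_left del: mult_Suc)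
  also have "real b * (real (Suc n * N) * (1 / real b)) = real (Suc n * N)"
    using b by simp
  also have "real b * real (Suc n * C + N) = real (Suc n * (b * C) + b * N)" by (simp add: algebra_simps)
  finally show ?thesis unfolding nat_near_mean_def of_nat_le_iff by blast
qed

text \<open>Raising 2 to both sides removes the logarithm and leaves a comparison of powers of
  natural numbers, hence a decidable one.\<close>

lemma near_mean_iff_log:
  assumes "0 < b" shows "near_mean n N C (log 2 (1 + real d / real b)) \<longleftrightarrow> nat_near_log n N C b d"
proof -
  let ?l = "log 2 (1 + real d / real b)" and ?S = "Suc n"
  have l: "2 powr (real (?S * N) * ?l) = (real (b + d)) ^ (?S * N) / real b ^ (?S * N)"
  proof -
    have "2 powr ?l = 1 + real d / real b" by (simp add: add_pos_nonneg)
    also have "\<dots> = real (b + d) / real b" using assms by (simp add: field_simps)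
    finally have "(2 powr ?l) ^ (?S * N) = (real (b + d) / real b) ^ (?S * N)" by (simp only:)
    moreover have "2 powr (real (?S * N) * ?l) = (2 powr ?l) ^ (?S * N)"
      by (subst mult.commute, subst powr_powr[symmetric], subst powr_realpow) auto
    ultimately show ?thesis by (simp only: power_divide)
  qed
  have two: "2 powr real k = 2 ^ k" for k by (simp add: powr_realpow)
  have pos: "0 < real b ^ (?S * N)" using assms by simp
  have g1: "X \<le> A / B * Y \<longleftrightarrow> X * B \<le> A * Y" if "0 < B" for X A B Y :: real using that by (simp add: field_simps)
  have g2: "A / B \<le> Y \<longleftrightarrow> A \<le> B * Y" if "0 < B" for A B Y :: real using that by (simp add: field_simps)
  have "near_mean n N C ?l \<longleftrightarrow> real (?S * C) \<le> real (?S * N) * ?l + real N \<and> real (?S * N) * ?l \<le> real (?S * C + N)"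
    by (rule near_mean_iff)
  also have "real (?S * C) \<le> real (?S * N) * ?l + real N \<longleftrightarrow> 2 powr real (?S * C) \<le> 2 powr (real (?S * N) * ?l + real N)"
    by (simp only: powr_le_cancel_iff[of 2])
  also have "\<dots> \<longleftrightarrow> 2 ^ (?S * C) * real b ^ (?S * N) \<le> (real (b + d)) ^ (?S * N) * 2 ^ N"
    unfolding powr_add l two by (rule g1[OF pos])
  also have "\<dots> \<longleftrightarrow> real (2 ^ (?S * C) * b ^ (?S * N)) \<le> real ((b + d) ^ (?S * N) * 2 ^ N)"
    by (simp only: of_nat_mult of_nat_power of_nat_numeral)
  also have "real (?S * N) * ?l \<le> real (?S * C + N) \<longleftrightarrow> 2 powr (real (?S * N) * ?l) \<le> 2 powr real (?S * C + N)"
    by (simp only: powr_le_cancel_iff[of 2])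
  also have "\<dots> \<longleftrightarrow> (real (b + d)) ^ (?S * N) \<le> real b ^ (?S * N) * 2 ^ (?S * C + N)"
    unfolding l two by (rule g2[OF pos])
  also have "\<dots> \<longleftrightarrow> real ((b + d) ^ (?S * N)) \<le> real (b ^ (?S * N) * 2 ^ (?S * C + N))"
    by (simp only: of_nat_mult of_nat_power of_nat_numeral)
  finally show ?thesis unfolding nat_near_log_def of_nat_le_iff .
qed

definition nat_digit_visits :: "nat \<Rightarrow> nat \<Rightarrow> nat \<Rightarrow> nat \<Rightarrow> nat \<Rightarrow> nat" where
  "nat_digit_visits b d p q N = (\<Sum>i<N. of_bool ((b ^ Suc i * p) div q mod b = d))"

definition nat_cf_visits :: "nat \<Rightarrow> nat \<Rightarrow> nat \<Rightarrow> nat \<Rightarrow> nat \<Rightarrow> nat" where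
  "nat_cf_visits b d p q N = (\<Sum>i<N. of_bool (euclid p q (Suc (Suc i)) * b < d * euclid p q (Suc i)))"

definition nat_typical :: "nat \<Rightarrow> nat \<Rightarrow> nat \<Rightarrow> bool" where
  "nat_typical n p q \<longleftrightarrow> (\<forall>j<64 ^ Suc n. 64 ^ n \<le> j \<longrightarrow> (\<forall>b<Suc n. 2 \<le> b \<longrightarrow> (\<forall>d<b.
     nat_near_mean n (j\<^sup>2) (nat_digit_visits b d p q (j\<^sup>2)) b \<and>
     nat_near_mean n (j\<^sup>2) (nat_digit_visits b d q p (j\<^sup>2)) b \<and>
     nat_near_log n (j\<^sup>2) (nat_cf_visits b d p q (j\<^sup>2)) b d)))"

definition nat_agree :: "nat \<Rightarrow> nat \<Rightarrow> nat \<Rightarrow> nat \<Rightarrow> bool" where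
  "nat_agree n p p' q \<longleftrightarrow> (\<forall>i<Suc (horizon n).
     euclid p q i div euclid p q (Suc i) = euclid p' q i div euclid p' q (Suc i) \<and>
     1 \<le> euclid p q i div euclid p q (Suc i) \<and>
     (\<forall>b<Suc n. 2 \<le> b \<longrightarrow> (b ^ i * p) div q = (b ^ i * p') div q \<and> (b ^ i * q) div p = (b ^ i * q) div p' \<and>
       (\<forall>d<b. euclid p q (Suc (Suc i)) * b < d * euclid p q (Suc i) \<longleftrightarrow>
         euclid p' q (Suc (Suc i)) * b < d * euclid p' q (Suc i))))"

text \<open>Index \<open>s\<close> at level \<open>m\<close> stands for the interval from
  \<open>s / 2 ^ m\<close> to \<open>Suc s / 2 ^ m\<close>. Typicality is tested at the left end
  point only; agreement carries it to the rest.\<close>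

definition certificate :: "nat \<Rightarrow> nat \<Rightarrow> nat \<Rightarrow> bool" where
  "certificate n m s \<longleftrightarrow> nat_agree n s (Suc s) (2 ^ m) \<and> nat_typical n s (2 ^ m)"

lemma floor_power_mult_rational: "\<lfloor>real b ^ i * (real p / real q)\<rfloor> = int (b ^ i * p div q)"
  using floor_divide_of_nat_eq[of "b ^ i * p" q, where ?'a = real] by simp

lemma floor_complete_quotient_rational:
  "\<lfloor>complete_quotient (real p / real q) i\<rfloor> = int (euclid p q i div euclid p q (Suc i))"
  unfolding complete_quotient_rational floor_divide_of_nat_eq ..

text \<open>A positive digit excludes the denominator 0, for which the left side would become
  \<open>0 < d / b\<close> while the right side is false.\<close>

lemma frac_complete_quotient_rational_less_iff:
  assumes "1 \<le> euclid p q i div euclid p q (Suc i)" "0 < b"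
  shows "frac (complete_quotient (real p / real q) i) < real d / real b \<longleftrightarrow>
    euclid p q (Suc (Suc i)) * b < d * euclid p q (Suc i)"
proof -
  have "euclid p q (Suc i) \<noteq> 0" using assms(1) by (intro notI) simp
  then have "frac (complete_quotient (real p / real q) i) < real d / real b \<longleftrightarrow>
      real (euclid p q (Suc (Suc i))) * real b < real d * real (euclid p q (Suc i))"
    using assms(2) unfolding complete_quotient_rational frac_of_nat_divide by (simp add: divide_less_eq field_simps)
  then show ?thesis unfolding of_nat_mult[symmetric] of_nat_less_iff .
qed

lemma digit_visits_rational: "digit_visits b d (real p / real q) N = nat_digit_visits b d p q N"
proof -
  have "\<lfloor>real b ^ Suc i * (real p / real q)\<rfloor> mod int b = int d \<longleftrightarrow> (b ^ Suc i * p) div q mod b = d" for i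
    unfolding floor_power_mult_rational by (metis of_nat_eq_iff of_nat_mod)
  then show ?thesis
    by (simp add: digit_visits_def nat_digit_visits_def of_bool_def sum.If_cases Int_def)
qed

lemma cf_visits_rational:
  assumes "\<And>i. i < N \<Longrightarrow> 1 \<le> euclid p q i div euclid p q (Suc i)" "0 < b"
  shows "cf_visits (real d / real b) (real p / real q) N = nat_cf_visits b d p q N"
proof -
  have "{i. i < N \<and> frac (complete_quotient (real p / real q) i) < real d / real b} =
    {i. i < N \<and> euclid p q (Suc (Suc i)) * b < d * euclid p q (Suc i)}"
    using frac_complete_quotient_rational_less_iff[OF assms(1) assms(2)] by blast
  then show ?thesis
    by (simp add: cf_visits_def nat_cf_visits_def of_bool_def sum.If_cases Int_def)
qed

lemma cf_digits_pos_rational: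
  "cf_digits_pos n (real p / real q) \<longleftrightarrow> (\<forall>i<Suc (horizon n). 1 \<le> euclid p q i div euclid p q (Suc i))"
  unfolding cf_digits_pos_def floor_complete_quotient_rational by (metis of_nat_1 of_nat_le_iff)

lemma ball_bounds_cong:
  fixes P Q :: "nat \<Rightarrow> nat \<Rightarrow> nat \<Rightarrow> bool"
  assumes "\<And>j b d. j < l \<Longrightarrow> 2 \<le> b \<Longrightarrow> P j b d \<longleftrightarrow> Q j b d"
  shows "(\<forall>j\<in>{k..<l}. \<forall>b\<in>{2..n}. \<forall>d<b. P j b d) \<longleftrightarrow>
      (\<forall>j<l. k \<le> j \<longrightarrow> (\<forall>b<Suc n. 2 \<le> b \<longrightarrow> (\<forall>d<b. Q j b d)))"
proof -
  have "(\<forall>j\<in>{k..<l}. \<forall>b\<in>{2..n}. \<forall>d<b. P j b d) \<longleftrightarrow> (\<forall>j\<in>{k..<l}. \<forall>b\<in>{2..n}. \<forall>d<b. Q j b d)"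
    using assms by (intro ball_cong all_cong refl) auto
  then show ?thesis by (auto simp: less_Suc_eq_le)
qed

lemma typical_rational:
  assumes "cf_digits_pos n (real p / real q)"
  shows "typical n (real p / real q) \<longleftrightarrow> nat_typical n p q"
proof -
  have "typical_at n (j\<^sup>2) b d (real p / real q) \<longleftrightarrow>
     nat_near_mean n (j\<^sup>2) (nat_digit_visits b d p q (j\<^sup>2)) b \<and>
     nat_near_mean n (j\<^sup>2) (nat_digit_visits b d q p (j\<^sup>2)) b \<and>
     nat_near_log n (j\<^sup>2) (nat_cf_visits b d p q (j\<^sup>2)) b d"
    if j: "j < 64 ^ Suc n" and b: "2 \<le> b" for j b d
  proof -
    have "j\<^sup>2 \<le> horizon n" unfolding horizon_def using j by (intro power_mono) auto
    then have "1 \<le> euclid p q i div euclid p q (Suc i)" if "i < j\<^sup>2" for i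
      using assms that unfolding cf_digits_pos_rational by (meson le_imp_less_Suc less_imp_le less_le_trans)
    then have "cf_visits (real d / real b) (real p / real q) (j\<^sup>2) = nat_cf_visits b d p q (j\<^sup>2)"
      using b by (intro cf_visits_rational) auto
    moreover have "1 / (real p / real q) = real q / real p" by simp
    moreover have "0 < b" using b by simp
    ultimately show ?thesis
      unfolding typical_at_def by (simp only: digit_visits_rational near_mean_iff_nat near_mean_iff_log)
  qed
  then show ?thesis unfolding typical_def nat_typical_def by (rule ball_bounds_cong)
qed

lemma agree_rational:
  "nat_agree n p p' q \<longleftrightarrow> agree n (real p / real q) (real p' / real q) \<and> cf_digits_pos n (real p / real q)"
proof -
  have "(\<lfloor>complete_quotient (real p / real q) i\<rfloor> = \<lfloor>complete_quotient (real p' / real q) i\<rfloor> \<and>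
     (\<forall>b<Suc n. 2 \<le> b \<longrightarrow> \<lfloor>real b ^ i * (real p / real q)\<rfloor> = \<lfloor>real b ^ i * (real p' / real q)\<rfloor> \<and>
       \<lfloor>real b ^ i * (1 / (real p / real q))\<rfloor> = \<lfloor>real b ^ i * (1 / (real p' / real q))\<rfloor> \<and>
       (\<forall>d<b. frac (complete_quotient (real p / real q) i) < real d / real b \<longleftrightarrow>
         frac (complete_quotient (real p' / real q) i) < real d / real b))) \<and>
      1 \<le> \<lfloor>complete_quotient (real p / real q) i\<rfloor> \<longleftrightarrow>
    euclid p q i div euclid p q (Suc i) = euclid p' q i div euclid p' q (Suc i) \<and>
     1 \<le> euclid p q i div euclid p q (Suc i) \<and>
     (\<forall>b<Suc n. 2 \<le> b \<longrightarrow> (b ^ i * p) div q = (b ^ i * p') div q \<and> (b ^ i * q) div p = (b ^ i * q) div p' \<and>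
       (\<forall>d<b. euclid p q (Suc (Suc i)) * b < d * euclid p q (Suc i) \<longleftrightarrow>
         euclid p' q (Suc (Suc i)) * b < d * euclid p' q (Suc i)))" (is "?L i \<longleftrightarrow> ?R i") for i
  \<comment> \<open>The translation of the visit condition needs positive digits at both points.
    Equal digits that are positive at one point provide this; in the other case both sides are
    false.\<close>
  proof (cases "euclid p q i div euclid p q (Suc i) = euclid p' q i div euclid p' q (Suc i) \<and> 1 \<le> euclid p q i div euclid p q (Suc i)")
    case True
    then have e: "1 \<le> euclid p q i div euclid p q (Suc i)" "1 \<le> euclid p' q i div euclid p' q (Suc i)"
      "euclid p q i div euclid p q (Suc i) = euclid p' q i div euclid p' q (Suc i)" by auto
    have inv: "1 / (real p / real q) = real q / real p" "1 / (real p' / real q) = real q / real p'" by auto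
    have h: "(frac (complete_quotient (real p / real q) i) < real d / real b \<longleftrightarrow>
         frac (complete_quotient (real p' / real q) i) < real d / real b) \<longleftrightarrow>
         (euclid p q (Suc (Suc i)) * b < d * euclid p q (Suc i) \<longleftrightarrow>
         euclid p' q (Suc (Suc i)) * b < d * euclid p' q (Suc i))" if "d < b" for d b
    proof -
      have "0 < b" using that by simp
      then show ?thesis using frac_complete_quotient_rational_less_iff[OF e(1), of b d]
        frac_complete_quotient_rational_less_iff[OF e(2), of b d] by simp
    qed
    have h': "(\<forall>d<b. frac (complete_quotient (real p / real q) i) < real d / real b \<longleftrightarrow>
         frac (complete_quotient (real p' / real q) i) < real d / real b) \<longleftrightarrow>
         (\<forall>d<b. euclid p q (Suc (Suc i)) * b < d * euclid p q (Suc i) \<longleftrightarrow>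
         euclid p' q (Suc (Suc i)) * b < d * euclid p' q (Suc i))" for b
      using h by (intro all_cong)
    have one: "1 \<le> int k \<longleftrightarrow> 1 \<le> k" for k by auto
    have swap: "(A \<and> B) \<and> C \<longleftrightarrow> A \<and> C \<and> B" for A B C by blast
    show ?thesis
      unfolding inv h' floor_complete_quotient_rational floor_power_mult_rational of_nat_eq_iff one by (rule swap)
  next
    case False
    have one: "1 \<le> int k \<longleftrightarrow> 1 \<le> k" for k by auto
    have taut: "\<not> (A \<and> C) \<Longrightarrow> (A \<and> B) \<and> C \<longleftrightarrow> A \<and> C \<and> D" for A B C D by blast
    show ?thesis
      unfolding floor_complete_quotient_rational of_nat_eq_iff one by (rule taut[OF False])
  qed
  note eq = this
  have conj_all: "(\<forall>i<K. P i) \<and> (\<forall>i<K. Q i) \<longleftrightarrow> (\<forall>i<K. P i \<and> Q i)" for K :: nat and P Q by blast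
  have "agree n (real p / real q) (real p' / real q) \<and> cf_digits_pos n (real p / real q) \<longleftrightarrow> (\<forall>i<Suc (horizon n). ?L i)"
    unfolding agree_def cf_digits_pos_def by (rule conj_all)
  also have "\<dots> \<longleftrightarrow> (\<forall>i<Suc (horizon n). ?R i)" by (intro all_cong eq)
  finally show ?thesis unfolding nat_agree_def by (rule sym)
qed

lemma certificate_iff:
  "certificate n m s \<longleftrightarrow> agree n (real s / 2 ^ m) (real (Suc s) / 2 ^ m) \<and>
    cf_digits_pos n (real s / 2 ^ m) \<and> typical n (real s / 2 ^ m)"
  using agree_rational[of n s "Suc s" "2 ^ m"] typical_rational[of n s "2 ^ m"]
  unfolding certificate_def by auto

lemma certificate_sound:
  assumes "certificate n m s" "0 < s" "real s / 2 ^ m \<le> x" "x \<le> real (Suc s) / 2 ^ m"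
  shows "typical n x" "cf_digits_pos n x"
proof -
  have c: "agree n (real s / 2 ^ m) (real (Suc s) / 2 ^ m)" "cf_digits_pos n (real s / 2 ^ m)" "typical n (real s / 2 ^ m)"
    using assms(1) unfolding certificate_iff by blast+
  have "agree n (real s / 2 ^ m) x"
  proof (rule agree_between[OF c(1,2)])
    show "between (real s / 2 ^ m) (real (Suc s) / 2 ^ m) x" using assms(3,4) unfolding between_def by blast
  qed (use assms(2) in simp_all)
  from typical_agree[OF this] cf_digits_pos_agree[OF this] c show "typical n x" "cf_digits_pos n x" by blast+
qed

lemma tendsto_dyadic:
  assumes "\<And>m. real (s m) / 2 ^ m \<le> x" "\<And>m. x \<le> real (Suc (s m)) / 2 ^ m"
  shows "(\<lambda>m. real (s m) / 2 ^ m) \<longlonglongrightarrow> x" "(\<lambda>m. real (Suc (s m)) / 2 ^ m) \<longlonglongrightarrow> x"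
proof -
  have half: "(\<lambda>m. 1 / 2 ^ m :: real) \<longlonglongrightarrow> 0"
    using LIMSEQ_power_zero[of "1 / 2 :: real"] by (simp add: power_divide)
  show lim: "(\<lambda>m. real (s m) / 2 ^ m) \<longlonglongrightarrow> x"
  proof (rule tendsto_sandwich[of "\<lambda>m. x - 1 / 2 ^ m" _ _ "\<lambda>_. x"])
    show "eventually (\<lambda>m. x - 1 / 2 ^ m \<le> real (s m) / 2 ^ m) sequentially"
      using assms(2) by (auto simp: add_divide_distrib diff_le_eq add.commute)
    show "eventually (\<lambda>m. real (s m) / 2 ^ m \<le> x) sequentially" using assms(1) by auto
    show "(\<lambda>m. x - 1 / 2 ^ m) \<longlonglongrightarrow> x" using tendsto_diff[OF tendsto_const half, of x] by simp
  qed auto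
  show "(\<lambda>m. real (Suc (s m)) / 2 ^ m) \<longlonglongrightarrow> x"
    using tendsto_add[OF lim half] by (simp add: add_divide_distrib add.commute)
qed

text \<open>Both end points of the dyadic interval around \<open>x\<close> converge to
  \<open>x\<close>, so eventually both share its data.\<close>

lemma eventually_certificate:
  assumes x: "x \<notin> \<rat>" "1 < x" and ty: "typical n x"
  shows "eventually (\<lambda>m. certificate n m (nat \<lfloor>2 ^ m * x\<rfloor>)) sequentially"
proof -
  define s where "s m = nat \<lfloor>2 ^ m * x\<rfloor>" for m :: nat
  have s: "real (s m) \<le> 2 ^ m * x" "2 ^ m * x < real (s m) + 1" for m
    using x(2) unfolding s_def by auto
  have "real (s m) / 2 ^ m \<le> x" "x \<le> real (Suc (s m)) / 2 ^ m" for m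
    using s[of m] by (auto simp: divide_le_eq le_divide_eq mult.commute)
  note lim = tendsto_dyadic[OF this]
  have pos: "cf_digits_pos n x"
    unfolding cf_digits_pos_def using complete_quotient_gt_1[OF x] by (auto simp: le_floor_iff less_imp_le)
  have "eventually (\<lambda>m. agree n x (real (s m) / 2 ^ m) \<and> agree n x (real (Suc (s m)) / 2 ^ m)) sequentially"
    using lim eventually_agree[OF x(1), of n] by (intro eventually_conj) (auto simp: filterlim_iff)
  then show ?thesis
    unfolding s_def[symmetric] certificate_iff
  proof eventually_elim
    case (elim m)
    have "agree n (real (s m) / 2 ^ m) (real (Suc (s m)) / 2 ^ m)"
      by (rule agree_trans[OF agree_sym]) (use elim in blast)+
    moreover have "cf_digits_pos n (real (s m) / 2 ^ m)" "typical n (real (s m) / 2 ^ m)"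
      using elim pos ty typical_agree[of n x "real (s m) / 2 ^ m"] cf_digits_pos_agree[of n x "real (s m) / 2 ^ m"] by blast+
    ultimately show ?case by blast
  qed
qed

lemma euclid_le: "euclid p q i \<le> p + q"
proof (induction p q i rule: euclid.induct)
  case (3 p q i)
  then show ?case using le_trans[OF mod_less_eq_dividend] by simp
qed auto

text \<open>Two consecutive remainders are packed into one number in base \<open>p + q + 1\<close>.\<close>

lemma euclid_packed:
  "rec_nat (p + Suc (p + q) * q) (\<lambda>i z. z div Suc (p + q) + Suc (p + q) * (z mod Suc (p + q) mod (z div Suc (p + q)))) i
    = euclid p q i + Suc (p + q) * euclid p q (Suc i)"
proof (induction i)
  case (Suc i)
  have lt: "euclid p q i < Suc (p + q)" using euclid_le by (simp add: less_Suc_eq_le)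
  have "(euclid p q i + Suc (p + q) * euclid p q (Suc i)) div Suc (p + q) = euclid p q (Suc i)"
    using div_mult_self2[of "Suc (p + q)" "euclid p q i" "euclid p q (Suc i)"] div_less[OF lt] by (simp only:)
  moreover have "(euclid p q i + Suc (p + q) * euclid p q (Suc i)) mod Suc (p + q) = euclid p q i"
    using mod_less[OF lt] by (simp only: mod_mult_self2)
  ultimately show ?case unfolding old.nat.simps(7) Suc euclid.simps(3) by (simp only:)
qed simp

lemma rec_euclid:
  assumes "rec k a" "rec k b" "rec k c" shows "rec k (\<lambda>e. euclid (a e) (b e) (c e))"
proof (rule rec_comp3[OF _ assms])
  have eq: "euclid p q i = rec_nat (p + Suc (p + q) * q)
      (\<lambda>i z. z div Suc (p + q) + Suc (p + q) * (z mod Suc (p + q) mod (z div Suc (p + q)))) i mod Suc (p + q)" for p q i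
    unfolding euclid_packed mod_mult_self2 using euclid_le[of p q i] by simp
  show "rec 3 (\<lambda>e. euclid (e 0) (e 1) (e 2))"
    unfolding eq by (intro rec_intros rec_prim) auto
qed

text \<open>This is what the bounded quantifiers, sums and natural number inequalities in the
  ingredients of \<open>certificate\<close> are for: each is covered by a closure rule.\<close>

lemma rec_certificate: "rec 3 (\<lambda>e. of_bool (certificate (e 0) (e 1) (e 2)))"
  unfolding certificate_def nat_agree_def nat_typical_def nat_near_mean_def nat_near_log_def
    nat_digit_visits_def nat_cf_visits_def horizon_def
  by (intro rec_intros rec_euclid) auto

section \<open>The measure of the uncertified intervals\<close>

lemma measure_dyadic:
  "measure unit_lborel {u \<in> {0..<1}. P (nat \<lfloor>2 ^ m * (1 + u :: real)\<rfloor>)} =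
    real (card {s \<in> {2 ^ m..<2 ^ m + 2 ^ m}. P s}) / 2 ^ m"
proof -
  let ?S = "{s \<in> {2 ^ m..<2 ^ m + 2 ^ m}. P s}"
  define I where "I s = {real s / 2 ^ m - 1..<(real s + 1) / 2 ^ m - 1}" for s :: nat
  have I_iff: "u \<in> I s \<longleftrightarrow> real s \<le> 2 ^ m * (1 + u) \<and> 2 ^ m * (1 + u) < real s + 1" for u s
    by (auto simp: I_def field_simps)
  have I_iff': "u \<in> I s \<longleftrightarrow> nat \<lfloor>2 ^ m * (1 + u :: real)\<rfloor> = s" if "0 \<le> u" for u s
  proof -
    have "0 \<le> 2 ^ m * (1 + u)" using that by simp
    then have "nat \<lfloor>2 ^ m * (1 + u :: real)\<rfloor> = s \<longleftrightarrow> \<lfloor>2 ^ m * (1 + u)\<rfloor> = int s"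
      by (metis int_nat_eq nat_int zero_le_floor)
    then show ?thesis unfolding I_iff by (simp add: floor_eq_iff)
  qed
  have sub: "I s \<subseteq> {0..<1}" if "s \<in> ?S" for s
  proof -
    have "real (2 ^ m) \<le> real s" "real (s + 1) \<le> real (2 ^ m + 2 ^ m)"
      using that unfolding of_nat_le_iff by auto
    then have "0 \<le> real s / 2 ^ m - 1" "(real s + 1) / 2 ^ m - 1 \<le> 1" by (auto simp: field_simps)
    then show ?thesis unfolding I_def by auto
  qed
  have range: "nat \<lfloor>2 ^ m * (1 + u :: real)\<rfloor> \<in> {2 ^ m..<2 ^ m + 2 ^ m}" if "u \<in> {0..<1}" for u
  proof -
    have "2 ^ m * 1 \<le> 2 ^ m * (1 + u)" "2 ^ m * (1 + u) < 2 ^ m * 2" using that by (intro mult_left_mono mult_strict_left_mono; simp)+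
    then have "int (2 ^ m) \<le> \<lfloor>2 ^ m * (1 + u)\<rfloor>" "\<lfloor>2 ^ m * (1 + u)\<rfloor> < int (2 ^ m + 2 ^ m)"
      by (simp_all add: le_floor_iff floor_less_iff)
    then show ?thesis unfolding atLeastLessThan_iff by linarith
  qed
  have Un: "{u \<in> {0..<1}. P (nat \<lfloor>2 ^ m * (1 + u :: real)\<rfloor>)} = (\<Union>s\<in>?S. I s)"
  proof (intro set_eqI iffI)
    fix u assume "u \<in> {u \<in> {0..<1}. P (nat \<lfloor>2 ^ m * (1 + u :: real)\<rfloor>)}"
    then show "u \<in> (\<Union>s\<in>?S. I s)" using range[of u] I_iff'[of u] by auto
  next
    fix u assume "u \<in> (\<Union>s\<in>?S. I s)"
    then obtain s where s: "s \<in> ?S" "u \<in> I s" by blast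
    then have "u \<in> {0..<1}" using sub by blast
    then show "u \<in> {u \<in> {0..<1}. P (nat \<lfloor>2 ^ m * (1 + u :: real)\<rfloor>)}" using s I_iff'[of u s] by auto
  qed
  have meas: "measure unit_lborel (I s) = 1 / 2 ^ m" if "s \<in> ?S" for s
  proof -
    have "emeasure unit_lborel (I s) = ennreal ((real s + 1) / 2 ^ m - 1 - (real s / 2 ^ m - 1))"
      unfolding emeasure_unit_lborel[OF sub[OF that]] unfolding I_def
      by (rule emeasure_lborel_Ico) (simp add: divide_right_mono)
    then show ?thesis by (simp add: unit.emeasure_eq_measure diff_divide_distrib[symmetric])
  qed
  have "measure unit_lborel (\<Union>s\<in>?S. I s) = (\<Sum>s\<in>?S. measure unit_lborel (I s))"
  proof (rule unit.finite_measure_finite_Union)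
    show "I ` ?S \<subseteq> sets unit_lborel"
      by (intro image_subsetI sets_unit_lborelI sub) (auto simp: I_def)
    show "disjoint_family_on I ?S"
      unfolding disjoint_family_on_def
    proof (intro ballI impI equals0I)
      fix s t u assume "s \<in> ?S" "t \<in> ?S" "s \<noteq> t" "u \<in> I s \<inter> I t"
      moreover from this have "0 \<le> u" using sub by force
      ultimately show False using I_iff'[of u] by auto
    qed
  qed simp
  also have "\<dots> = (\<Sum>s\<in>?S. 1 / 2 ^ m)" by (intro sum.cong refl meas)
  finally show ?thesis unfolding Un by simp
qed

text \<open>Continuity from above: outside \<open>B\<close>, the points that meet some
  \<open>E k\<close> with \<open>k \<ge> m\<close> decrease to a null set as \<open>m\<close> grows.
  The gap between \<open>prob B\<close> and \<open>c\<close> absorbs the remainder at some finite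
  \<open>m\<close>.\<close>

lemma (in prob_space) ex_prob_less_if_eventually:
  assumes E: "\<And>m. E m \<in> events" and B: "B \<in> events"
    and ae: "AE x in M. x \<notin> B \<longrightarrow> eventually (\<lambda>m :: nat. x \<notin> E m) sequentially"
    and c: "prob B < c"
  shows "\<exists>m. prob (E m) < c"
proof -
  define D where "D m = (\<Union>k. E (m + k)) - B" for m
  have D: "D m \<in> events" for m unfolding D_def using E B by auto
  have "decseq D"
  proof (rule decseq_SucI)
    fix m
    have "E (Suc m + k) \<subseteq> (\<Union>k. E (m + k))" for k using UN_upper[of "Suc k" UNIV "\<lambda>k. E (m + k)"] by simp
    then show "D (Suc m) \<subseteq> D m" unfolding D_def by blast
  qed
  then have lim: "(\<lambda>m. prob (D m)) \<longlonglongrightarrow> prob (\<Inter>m. D m)"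
    using D by (intro finite_Lim_measure_decseq) auto
  have "AE x in M. x \<notin> (\<Inter>m. D m)"
    using ae
  proof eventually_elim
    case (elim x)
    show ?case
    proof
      assume x: "x \<in> (\<Inter>m. D m)"
      then have "x \<notin> B" by (auto simp: D_def)
      with elim obtain m where "\<And>k. m \<le> k \<Longrightarrow> x \<notin> E k" unfolding eventually_sequentially by blast
      then have "x \<notin> D m" by (auto simp: D_def)
      with x show False by blast
    qed
  qed
  then have "prob (\<Inter>m. D m) = 0"
    using D by (subst prob_eq_0) auto
  with lim have "eventually (\<lambda>m. prob (D m) < c - prob B) sequentially"
    using c by (intro order_tendstoD(2)) auto
  then obtain m where m: "prob (D m) < c - prob B" by (meson eventually_sequentially order_refl)
  have "E m \<subseteq> B \<union> D m" unfolding D_def using UN_upper[of 0 UNIV "\<lambda>k. E (m + k)"] by auto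
  then have "prob (E m) \<le> prob (B \<union> D m)" using B D by (intro finite_measure_mono) auto
  also have "\<dots> \<le> prob B + prob (D m)" using B D by (intro measure_Un_le) auto
  finally show ?thesis using m by (intro exI[of _ m]) simp
qed

text \<open>Untypical points have measure strictly below the bound, and irrational typical ones are
  eventually certified. Counting indices of level \<open>m\<close> turns the measure bound into an
  inequality of natural numbers.\<close>

lemma certificate_density:
  "\<exists>m. 16 * 4 ^ n * card {s \<in> {2 ^ m..<2 ^ m + 2 ^ m}. \<not> certificate (n + stage_shift) m s} \<le> (2 :: nat) ^ m"
proof -
  let ?N = "n + stage_shift"
  let ?E = "\<lambda>m. {u \<in> {0..<1}. \<not> certificate ?N m (nat \<lfloor>2 ^ m * (1 + u :: real)\<rfloor>)}"
  let ?B = "{u \<in> {0..<1}. \<not> typical ?N (1 + u)}"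
  have "\<exists>m. measure unit_lborel (?E m) < 1 / (16 * 4 ^ n)"
  proof (rule unit.ex_prob_less_if_eventually)
    show "?E m \<in> sets unit_lborel" for m
    proof (rule sets_Collect_unit_lborel)
      have "(\<lambda>u. \<lfloor>2 ^ m * (1 + u :: real)\<rfloor>) \<in> measurable borel (count_space UNIV)" by measurable
      then show "Measurable.pred borel (\<lambda>u. \<not> certificate ?N m (nat \<lfloor>2 ^ m * (1 + u :: real)\<rfloor>))"
        by (rule measurable_compose) auto
    qed
    show "?B \<in> sets unit_lborel" by (rule sets_not_typical)
    have "{0..<1} \<inter> \<rat> \<in> null_sets unit_lborel"
    proof -
      have "{0..<1} \<inter> \<rat> \<in> null_sets (lborel :: real measure)"
        by (intro countable_imp_null_set_lborel countable_Int2 countable_rat)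
      then show ?thesis by (auto simp: null_sets_def emeasure_unit_lborel intro!: sets_unit_lborelI)
    qed
    then have "AE u in unit_lborel. u \<notin> {0..<1} \<inter> \<rat>" by (rule AE_not_in)
    then show "AE u in unit_lborel. u \<notin> ?B \<longrightarrow> eventually (\<lambda>m. u \<notin> ?E m) sequentially"
    proof (rule AE_mp, intro AE_I2 impI)
      fix u assume u: "u \<in> space unit_lborel" "u \<notin> {0..<1} \<inter> \<rat>" "u \<notin> ?B"
      then have u': "u \<in> {0..<1}" "u \<notin> \<rat>" "typical ?N (1 + u)" by (auto simp: space_unit_lborel)
      have "1 + u \<notin> \<rat>"
      proof
        assume "1 + u \<in> \<rat>"
        then have "(1 + u) - 1 \<in> \<rat>" by (intro Rats_diff Rats_1)
        with u'(2) show False by simp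
      qed
      moreover have "u \<noteq> 0" using u'(2) by auto
      then have "1 < 1 + u" using u'(1) by auto
      ultimately have "eventually (\<lambda>m. certificate ?N m (nat \<lfloor>2 ^ m * (1 + u :: real)\<rfloor>)) sequentially"
        using u'(3) by (intro eventually_certificate)
      then show "eventually (\<lambda>m. u \<notin> ?E m) sequentially" by (rule eventually_mono) simp
    qed
    show "measure unit_lborel ?B < 1 / (16 * 4 ^ n)" by (rule measure_not_typical_shift_le)
  qed
  then obtain m where "measure unit_lborel (?E m) < 1 / (16 * 4 ^ n)" by blast
  then have "real (card {s \<in> {2 ^ m..<2 ^ m + 2 ^ m}. \<not> certificate ?N m s}) / 2 ^ m < 1 / (16 * 4 ^ n)"
    unfolding measure_dyadic[where P = "\<lambda>s. \<not> certificate ?N m s" and m = m] .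
  then have "real (16 * 4 ^ n * card {s \<in> {2 ^ m..<2 ^ m + 2 ^ m}. \<not> certificate ?N m s}) \<le> real (2 ^ m)"
    by (simp add: field_simps)
  then show ?thesis unfolding of_nat_le_iff by blast
qed

section \<open>Normality of typical points\<close>

text \<open>Between J^2 and (J + 1)^2 a count that grows by at most 1 per step changes by at most 2
  J, which is negligible against J^2.\<close>

lemma tendsto_mean_if_squares:
  fixes S :: "nat \<Rightarrow> nat"
  assumes S: "\<And>N. S N \<le> S (Suc N)" "\<And>N. S (Suc N) \<le> Suc (S N)"
    and near: "\<And>n j. n0 \<le> n \<Longrightarrow> j \<in> {64 ^ n..<64 ^ Suc n} \<Longrightarrow> near_mean n (j\<^sup>2) (S (j\<^sup>2)) p"
  shows "(\<lambda>N. real (S N) / real N) \<longlonglongrightarrow> p"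
proof -
  have S_diff: "S M \<le> S (M + k) \<and> S (M + k) \<le> S M + k" for M k
    by (induction k) (use S in \<open>auto intro: le_trans\<close>)
  define a where "a j = \<bar>real (S (j\<^sup>2)) / real (j\<^sup>2) - p\<bar>" for j
  have a: "a \<longlonglongrightarrow> 0"
  proof (rule LIMSEQ_I)
    fix \<epsilon> :: real assume "0 < \<epsilon>"
    then obtain n where n: "1 / real (Suc n) < \<epsilon>" using nat_approx_posE by blast
    have "norm (a j - 0) < \<epsilon>" if j: "64 ^ (n + n0) \<le> j" for j
    proof -
      have "1 \<le> (64 :: nat) ^ (n + n0)" by simp
      with j have j1: "1 \<le> j" by linarith
      then obtain k where k: "64 ^ k \<le> j" "j < 64 ^ (k + 1)" using ex_power_ivl1[of 64 j] by auto
      have "64 ^ (n + n0) < (64 :: nat) ^ (k + 1)" using j k by linarith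
      then have kn: "n + n0 < k + 1" by (rule power_less_imp_less_exp[rotated]) simp
      have "near_mean k (j\<^sup>2) (S (j\<^sup>2)) p" using near[of k j] kn k by simp
      then have "\<bar>real (S (j\<^sup>2)) - real (j\<^sup>2) * p\<bar> \<le> real (j\<^sup>2) / real (Suc k)" by (simp add: near_mean_def)
      moreover have "a j = \<bar>real (S (j\<^sup>2)) - real (j\<^sup>2) * p\<bar> / real (j\<^sup>2)"
      proof -
        have "real (S (j\<^sup>2)) / real (j\<^sup>2) - p = (real (S (j\<^sup>2)) - real (j\<^sup>2) * p) / real (j\<^sup>2)"
          using j1 by (simp add: diff_divide_distrib)
        then show ?thesis unfolding a_def by (simp add: abs_divide)
      qed
      ultimately have "a j \<le> real (j\<^sup>2) / real (Suc k) / real (j\<^sup>2)"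
        using divide_right_mono[of _ _ "real (j\<^sup>2)"] by (metis of_nat_0_le_iff)
      also have "\<dots> = 1 / real (Suc k)" using j1 by simp
      also have "\<dots> \<le> 1 / real (Suc n)" using kn by (intro divide_left_mono) auto
      finally show ?thesis using n by (simp add: a_def)
    qed
    then show "\<exists>no. \<forall>j\<ge>no. norm (a j - 0) < \<epsilon>" by blast
  qed
  define j where "j N = nat \<lfloor>sqrt (real N)\<rfloor>" for N
  have jj: "(j N)\<^sup>2 \<le> N" "N < (Suc (j N))\<^sup>2" for N
  proof -
    have "real (j N) \<le> sqrt (real N)" "sqrt (real N) < real (Suc (j N))" unfolding j_def by (auto simp: of_nat_nat) linarith
    then have "(real (j N))\<^sup>2 \<le> (sqrt (real N))\<^sup>2" "(sqrt (real N))\<^sup>2 < (real (Suc (j N)))\<^sup>2"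
      by (intro power_mono power_strict_mono; simp)+
    then have "real ((j N)\<^sup>2) \<le> real N" "real N < real ((Suc (j N))\<^sup>2)" by simp_all
    then show "(j N)\<^sup>2 \<le> N" "N < (Suc (j N))\<^sup>2" unfolding of_nat_le_iff of_nat_less_iff .
  qed
  have j_lim: "filterlim j at_top sequentially"
    unfolding filterlim_at_top eventually_sequentially
  proof (intro allI exI impI)
    fix Z N :: nat assume "Z\<^sup>2 \<le> N"
    with jj(2)[of N] have "Z\<^sup>2 < (Suc (j N))\<^sup>2" by linarith
    then have "Z < Suc (j N)" by (rule power_less_imp_less_base) simp
    then show "Z \<le> j N" by simp
  qed
  have bound: "norm (real (S N) / real N - p) \<le> a (j N) + (2 + 2 * \<bar>p\<bar>) * (1 / real (j N))" if "1 \<le> N" for N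
  proof -
    define J where "J = j N"
    have J: "J\<^sup>2 \<le> N" "N < (Suc J)\<^sup>2" using jj unfolding J_def by auto
    have J1: "1 \<le> J"
    proof (rule ccontr)
      assume "\<not> 1 \<le> J"
      then have "J = 0" by simp
      then show False using J(2) that by simp
    qed
    obtain k where k: "N = J\<^sup>2 + k" using J(1) le_Suc_ex by blast
    have k2: "real k \<le> 2 * real J" using J(2) unfolding k by (simp add: power2_eq_square)
    have Jpos: "0 < real J" using J1 by simp
    have N: "(real J)\<^sup>2 \<le> real N" by (simp add: k)
    have N': "0 < real N" using that by simp
    have 1: "\<bar>real (S N) - real (S (J\<^sup>2))\<bar> \<le> real k" using S_diff[of "J\<^sup>2" k] unfolding k[symmetric] by linarith
    have 2: "\<bar>real (S (J\<^sup>2)) - real (J\<^sup>2) * p\<bar> = (real J)\<^sup>2 * a J"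
    proof -
      have "real (S (J\<^sup>2)) - real (J\<^sup>2) * p = real (J\<^sup>2) * (real (S (J\<^sup>2)) / real (J\<^sup>2) - p)"
        using Jpos by (simp add: right_diff_distrib)
      then show ?thesis unfolding a_def by (simp add: abs_mult)
    qed
    have 3: "\<bar>real N * p - real (J\<^sup>2) * p\<bar> = real k * \<bar>p\<bar>" unfolding k by (simp add: left_diff_distrib[symmetric] abs_mult)
    have "\<bar>real (S N) - real N * p\<bar> \<le> real k + (real J)\<^sup>2 * a J + real k * \<bar>p\<bar>" using 1 2 3 by linarith
    also have "\<dots> \<le> real N * a J + 2 * real J * (1 + \<bar>p\<bar>)"
    proof -
      have "(real J)\<^sup>2 * a J \<le> real N * a J" using N N' by (intro mult_right_mono) (auto simp: a_def)
      moreover have "real k * (1 + \<bar>p\<bar>) \<le> 2 * real J * (1 + \<bar>p\<bar>)" using k2 by (intro mult_right_mono) auto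
      ultimately show ?thesis by (simp add: distrib_left)
    qed
    finally have "\<bar>real (S N) - real N * p\<bar> / real N \<le> (real N * a J + 2 * real J * (1 + \<bar>p\<bar>)) / real N"
      using N N' by (intro divide_right_mono) auto
    also have "\<dots> = a J + 2 * real J * (1 + \<bar>p\<bar>) / real N" using N N' by (simp add: add_divide_distrib)
    also have "2 * real J * (1 + \<bar>p\<bar>) / real N \<le> 2 * real J * (1 + \<bar>p\<bar>) / (real J)\<^sup>2"
      using N N' Jpos by (intro divide_left_mono) auto
    also have "\<dots> = (2 + 2 * \<bar>p\<bar>) * (1 / real J)" using Jpos by (simp add: power2_eq_square field_simps)
    finally have "\<bar>real (S N) - real N * p\<bar> / real N \<le> a J + (2 + 2 * \<bar>p\<bar>) * (1 / real J)" by simp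
    moreover have "real (S N) / real N - p = (real (S N) - real N * p) / real N" using N N' by (simp add: diff_divide_distrib)
    ultimately show ?thesis using N N' unfolding J_def by (simp add: abs_divide)
  qed
  have "(\<lambda>N. a (j N) + (2 + 2 * \<bar>p\<bar>) * (1 / real (j N))) \<longlonglongrightarrow> 0 + (2 + 2 * \<bar>p\<bar>) * 0"
    by (intro tendsto_intros filterlim_compose[OF a j_lim] filterlim_compose[OF lim_1_over_n j_lim])
  then have "(\<lambda>N. a (j N) + (2 + 2 * \<bar>p\<bar>) * (1 / real (j N))) \<longlonglongrightarrow> 0" by simp
  then have "(\<lambda>N. real (S N) / real N - p) \<longlonglongrightarrow> 0"
    by (rule Lim_null_comparison[rotated]) (use bound in \<open>auto simp: eventually_sequentially intro!: exI[of _ 1]\<close>)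
  then show ?thesis by (rule LIM_zero_cancel)
qed

section \<open>Digit and block frequencies in terms of visits\<close>

lemma card_less_Suc_Collect: "card {i. i < Suc N \<and> P i} = card {i. i < N \<and> P i} + of_bool (P N)"
proof -
  have "{i. i < Suc N \<and> P i} = {i. i < N \<and> P i} \<union> (if P N then {N} else {})" by (auto simp: less_Suc_eq)
  then show ?thesis by simp
qed

lemma card_Collect_shift: "card {j \<in> {1..N}. P j} = card {i. i < N \<and> P (Suc i)}"
proof -
  have "{j \<in> {1..N}. P j} = Suc ` {i. i < N \<and> P (Suc i)}"
  proof (intro set_eqI iffI)
    fix j assume "j \<in> {j \<in> {1..N}. P j}"
    then show "j \<in> Suc ` {i. i < N \<and> P (Suc i)}" by (cases j) auto
  qed auto
  then show ?thesis by (simp add: card_image)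
qed

lemma base_digit_Suc:
  "int (base_digit b x (Suc i)) = \<lfloor>real b ^ Suc i * x\<rfloor> mod int b" if "0 < b"
proof -
  have "real b ^ Suc i * frac x = real b ^ Suc i * x + of_int (- (int b * int b ^ i * \<lfloor>x\<rfloor>))"
    by (simp add: frac_def algebra_simps)
  then have "\<lfloor>real b ^ Suc i * frac x\<rfloor> = \<lfloor>real b ^ Suc i * x\<rfloor> + int b * (- (int b ^ i * \<lfloor>x\<rfloor>))"
    by linarith
  then have "\<lfloor>real b ^ Suc i * frac x\<rfloor> mod int b = \<lfloor>real b ^ Suc i * x\<rfloor> mod int b"
    by (simp only: mod_mult_self2)
  then show ?thesis using that by (simp add: base_digit_def)
qed

lemma absolutely_normal_if_digit_visits:
  assumes "\<And>b d. 2 \<le> b \<Longrightarrow> d < b \<Longrightarrow> (\<lambda>N. real (digit_visits b d x N) / real N) \<longlonglongrightarrow> 1 / real b"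
  shows "absolutely_normal x"
proof -
  have "simply_normal b x" if "2 \<le> b" for b
  proof -
    have "card {j \<in> {1..N}. base_digit b x j = d} = digit_visits b d x N" for N d
    proof -
      have "base_digit b x (Suc i) = d \<longleftrightarrow> \<lfloor>real b ^ Suc i * x\<rfloor> mod int b = int d" for i
        using base_digit_Suc[of b x i] that by (metis less_le_trans of_nat_eq_iff zero_less_numeral)
      then show ?thesis unfolding card_Collect_shift digit_visits_def by simp
    qed
    then show ?thesis using assms[OF that] by (simp add: simply_normal_def)
  qed
  moreover have "2 \<le> b ^ k" if "2 \<le> b" "1 \<le> k" for b k :: nat
    using that power_increasing[of 1 k b] by simp
  ultimately show ?thesis unfolding absolutely_normal_def base_normal_def by blast
qed

lemma complete_quotient_frac:
  "complete_quotient x (n + Suc k) = complete_quotient (frac (complete_quotient x n)) (Suc k)"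
  by (induction k) auto

text \<open>Prepending a digit \<open>a\<close> applies the decreasing map t to 1 / (a + t), which
  swaps the end points and keeps them rational. Rationality matters because visits are controlled
  only for intervals \<open>[0, d / b)\<close>.\<close>

lemma cf_cylinder_interval:
  assumes "\<forall>a\<in>set v. a > 0"
  shows "\<exists>\<alpha>\<in>\<rat>. \<exists>\<beta>\<in>\<rat>. 0 \<le> \<alpha> \<and> \<alpha> \<le> \<beta> \<and> \<beta> \<le> 1 \<and> (\<forall>t. t \<notin> \<rat> \<longrightarrow> t \<in> cf_cylinder v \<longleftrightarrow> \<alpha> < t \<and> t < \<beta>)"
  using assms
proof (induction v)
  case Nil
  show ?case by (intro bexI[of _ 0] bexI[of _ 1]) (auto simp: cf_cylinder_def)
next
  case (Cons a v)
  then obtain \<alpha> \<beta> where ab: "\<alpha> \<in> \<rat>" "\<beta> \<in> \<rat>" "0 \<le> \<alpha>" "\<alpha> \<le> \<beta>" "\<beta> \<le> 1"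
    "\<And>t. t \<notin> \<rat> \<Longrightarrow> t \<in> cf_cylinder v \<longleftrightarrow> \<alpha> < t \<and> t < \<beta>" by auto
  have a: "1 \<le> real a" using Cons.prems by simp
  have iff: "t \<in> cf_cylinder (a # v) \<longleftrightarrow> 1 / (real a + \<beta>) < t \<and> t < 1 / (real a + \<alpha>)" if t: "t \<notin> \<rat>" for t
  proof (cases "0 < t \<and> t < 1")
    case True
    define y where "y = frac (1 / t)"
    note inv = irrational_inverse[OF t]
    have y: "y \<notin> \<rat>" unfolding y_def by (rule irrational_frac[OF inv])
    have y01: "0 < y" "y < 1" using frac_pos_if_irrational[OF inv] frac_lt_1 by (auto simp: y_def)
    have digit0: "cf_digit t 1 = \<lfloor>1 / t\<rfloor>" using True by (simp add: cf_digit_def frac_eq)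
    have digit: "cf_digit t (Suc i + 1) = cf_digit y (i + 1)" for i
      using complete_quotient_frac[of t 1 i] True by (simp add: cf_digit_def y_def frac_eq)
    have "t \<in> cf_cylinder (a # v) \<longleftrightarrow> cf_digit t 1 = int a \<and> (\<forall>i<length v. cf_digit t (Suc i + 1) = int (v ! i))"
      using True unfolding cf_cylinder_def by (simp add: All_less_Suc2)
    also have "\<dots> \<longleftrightarrow> \<lfloor>1 / t\<rfloor> = int a \<and> y \<in> cf_cylinder v"
      using y01 unfolding digit0 digit cf_cylinder_def by auto
    also have "\<dots> \<longleftrightarrow> \<lfloor>1 / t\<rfloor> = int a \<and> \<alpha> < y \<and> y < \<beta>" using ab(6)[OF y] by simp
    also have "\<dots> \<longleftrightarrow> real a + \<alpha> < 1 / t \<and> 1 / t < real a + \<beta>"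
    proof
      assume "\<lfloor>1 / t\<rfloor> = int a \<and> \<alpha> < y \<and> y < \<beta>"
      then show "real a + \<alpha> < 1 / t \<and> 1 / t < real a + \<beta>" by (auto simp: y_def frac_def)
    next
      assume *: "real a + \<alpha> < 1 / t \<and> 1 / t < real a + \<beta>"
      then have "real a < 1 / t" "1 / t < real a + 1" using ab(3,5) by linarith+
      then have "\<lfloor>1 / t\<rfloor> = int a" by (simp add: floor_eq_iff)
      with * show "\<lfloor>1 / t\<rfloor> = int a \<and> \<alpha> < y \<and> y < \<beta>" by (simp add: y_def frac_def)
    qed
    also have "\<dots> \<longleftrightarrow> 1 / (real a + \<beta>) < t \<and> t < 1 / (real a + \<alpha>)"
    proof -
      have "0 < real a + \<alpha>" "0 < real a + \<beta>" using a ab by linarith+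
      then show ?thesis using True by (auto simp: field_simps)
    qed
    finally show ?thesis .
  next
    case False
    have "\<not> (1 / (real a + \<beta>) < t \<and> t < 1 / (real a + \<alpha>))"
    proof
      assume *: "1 / (real a + \<beta>) < t \<and> t < 1 / (real a + \<alpha>)"
      have "0 < 1 / (real a + \<beta>)" "1 / (real a + \<alpha>) \<le> 1" using a ab by (auto simp: divide_le_eq_1)
      with * False show False by linarith
    qed
    moreover have "t \<notin> cf_cylinder (a # v)" using False by (auto simp: cf_cylinder_def)
    ultimately show ?thesis by blast
  qed
  show ?case
  proof (intro bexI conjI)
    show "\<forall>t. t \<notin> \<rat> \<longrightarrow> t \<in> cf_cylinder (a # v) \<longleftrightarrow> 1 / (real a + \<beta>) < t \<and> t < 1 / (real a + \<alpha>)"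
      using iff by blast
    show "1 / (real a + \<beta>) \<le> 1 / (real a + \<alpha>)" using a ab by (intro divide_left_mono) (auto intro!: mult_pos_pos)
    show "1 / (real a + \<alpha>) \<le> 1" using a ab by (simp add: divide_le_eq_1)
    show "0 \<le> 1 / (real a + \<beta>)" using a ab by simp
    show "1 / (real a + \<alpha>) \<in> \<rat>" "1 / (real a + \<beta>) \<in> \<rat>" using ab by (auto intro!: Rats_divide Rats_add)
  qed
qed

lemma borel_measurable_complete_quotient[measurable]: "(\<lambda>t. complete_quotient t n) \<in> borel_measurable borel"
proof (induction n)
  case (Suc n)
  note [measurable] = Suc
  show ?case unfolding complete_quotient.simps frac_def by measurable
qed simp

lemma sets_cf_cylinder: "cf_cylinder v \<in> sets borel"
proof -
  have "Measurable.pred borel (\<lambda>t. cf_digit t (i + 1) = int (v ! i))" for i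
  proof -
    have "(\<lambda>t. \<lfloor>complete_quotient t (i + 1)\<rfloor>) \<in> measurable borel (count_space UNIV)" by measurable
    then show ?thesis unfolding cf_digit_def by (rule measurable_compose) auto
  qed
  then have "Measurable.pred borel (\<lambda>t. \<forall>i\<in>{..<length v}. cf_digit t (i + 1) = int (v ! i))"
    by (intro pred_intros_finite) auto
  then have "{0<..<1} \<inter> {t \<in> space borel. \<forall>i\<in>{..<length v}. cf_digit t (i + 1) = int (v ! i)} \<in> sets borel"
    unfolding pred_def by (intro sets.Int) auto
  moreover have "cf_cylinder v = {0<..<1} \<inter> {t \<in> space borel. \<forall>i\<in>{..<length v}. cf_digit t (i + 1) = int (v ! i)}"
    by (auto simp: cf_cylinder_def)
  ultimately show ?thesis by simp
qed

lemma cf_normal_if_cf_visits: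
  assumes x: "x \<notin> \<rat>"
    and lim: "\<And>r. r \<in> \<rat> \<Longrightarrow> 0 \<le> r \<Longrightarrow> r \<le> 1 \<Longrightarrow> (\<lambda>N. real (cf_visits r x N) / real N) \<longlonglongrightarrow> log 2 (1 + r)"
  shows "cf_normal x"
  unfolding cf_normal_def
proof (intro allI impI)
  fix v :: "nat list" assume v: "v \<noteq> [] \<and> (\<forall>a\<in>set v. a > 0)"
  obtain \<alpha> \<beta> where ab: "\<alpha> \<in> \<rat>" "\<beta> \<in> \<rat>" "0 \<le> \<alpha>" "\<alpha> \<le> \<beta>" "\<beta> \<le> 1"
    "\<And>t. t \<notin> \<rat> \<Longrightarrow> t \<in> cf_cylinder v \<longleftrightarrow> \<alpha> < t \<and> t < \<beta>"
    using cf_cylinder_interval[of v] v by blast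
  have measure: "measure gauss_measure (cf_cylinder v) = log 2 (1 + \<beta>) - log 2 (1 + \<alpha>)"
    using ab by (intro measure_gauss_measure_interval sets_cf_cylinder) (auto simp: cf_cylinder_def)
  let ?y = "\<lambda>k. frac (complete_quotient x k)"
  have y: "?y k \<notin> \<rat>" "0 < ?y k" "?y k < 1" for k
  proof -
    note irr = irrational_complete_quotient[OF x, of k]
    show "?y k \<notin> \<rat>" using irr by (rule irrational_frac)
    show "0 < ?y k" "?y k < 1" using frac_pos_if_irrational[OF irr] frac_lt_1 by auto
  qed
  \<comment> \<open>A block starting at position \<open>Suc k\<close> is read off the fractional
    part at time \<open>k\<close>. That number is irrational, hence different from
    \<open>\<alpha>\<close>, so \<open>\<alpha> < ?y k\<close> may be written as
    \<open>\<not> ?y k < \<alpha>\<close>.\<close>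
  have block: "(\<forall>i<length v. cf_digit x (Suc k + i) = int (v ! i)) \<longleftrightarrow> ?y k < \<beta> \<and> \<not> ?y k < \<alpha>" for k
  proof -
    have "cf_digit x (Suc k + i) = cf_digit (?y k) (i + 1)" for i
      using complete_quotient_frac[of x k i] by (simp add: cf_digit_def)
    then have "(\<forall>i<length v. cf_digit x (Suc k + i) = int (v ! i)) \<longleftrightarrow> ?y k \<in> cf_cylinder v"
      using y[of k] by (simp add: cf_cylinder_def)
    also have "\<dots> \<longleftrightarrow> \<alpha> < ?y k \<and> ?y k < \<beta>" using ab(6)[OF y(1)] .
    also have "\<dots> \<longleftrightarrow> ?y k < \<beta> \<and> \<not> ?y k < \<alpha>" using y(1)[of k] ab(1) by (metis linorder_neqE not_less_iff_gr_or_eq)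
    finally show ?thesis .
  qed
  have count: "real (card {j \<in> {1..N}. \<forall>i<length v. cf_digit x (j + i) = int (v ! i)}) =
    real (cf_visits \<beta> x N) - real (cf_visits \<alpha> x N)" for N
  proof -
    have "card {j \<in> {1..N}. \<forall>i<length v. cf_digit x (j + i) = int (v ! i)} =
      card ({k. k < N \<and> ?y k < \<beta>} - {k. k < N \<and> ?y k < \<alpha>})"
      unfolding card_Collect_shift block by (intro arg_cong[where f = card]) auto
    also have "\<dots> = card {k. k < N \<and> ?y k < \<beta>} - card {k. k < N \<and> ?y k < \<alpha>}"
      using ab(4) by (intro card_Diff_subset) auto
    finally have *: "card {j \<in> {1..N}. \<forall>i<length v. cf_digit x (j + i) = int (v ! i)} = cf_visits \<beta> x N - cf_visits \<alpha> x N"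
      unfolding cf_visits_def .
    have "cf_visits \<alpha> x N \<le> cf_visits \<beta> x N"
      unfolding cf_visits_def using ab(4) by (intro card_mono) auto
    then show ?thesis unfolding * by (rule of_nat_diff)
  qed
  have "(\<lambda>N. real (cf_visits \<beta> x N) / real N - real (cf_visits \<alpha> x N) / real N) \<longlonglongrightarrow> log 2 (1 + \<beta>) - log 2 (1 + \<alpha>)"
    using ab by (intro tendsto_diff lim) auto
  then show "(\<lambda>n. real (card {j \<in> {1..n}. \<forall>i<length v. cf_digit x (j + i) = int (v ! i)}) / real n)
       \<longlonglongrightarrow> measure gauss_measure (cf_cylinder v)"
    unfolding count measure diff_divide_distrib .
qed

text \<open>For a rational number, positive digits would keep all remainders of Euclid's algorithm
  positive, although they strictly decrease.\<close>

lemma irrational_if_cf_digits_pos: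
  assumes x: "0 < x" and pos: "\<And>i. 1 \<le> \<lfloor>complete_quotient x i\<rfloor>"
  shows "x \<notin> \<rat>"
proof
  assume "x \<in> \<rat>"
  then obtain p q where q: "q \<noteq> 0" and "\<bar>x\<bar> = real p / real q" by (elim Rats_abs_nat_div_natE)
  then have pq: "x = real p / real q" using x by simp
  have digit: "1 \<le> euclid p q i div euclid p q (Suc i)" for i
    using pos[of i] unfolding pq floor_complete_quotient_rational by linarith
  have nz: "0 < euclid p q (Suc i)" for i
    using digit[of i] by (cases "euclid p q (Suc i) = 0") auto
  have "euclid p q (Suc i) + i \<le> q" for i
  proof (induction i)
    case (Suc i)
    have "euclid p q (Suc (Suc i)) < euclid p q (Suc i)" using mod_less_divisor[OF nz] by simp
    then show ?case using Suc by simp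
  qed simp
  from this[of q] nz[of q] show False by simp
qed

lemma Rats_unit_nat_fractionE:
  assumes "r \<in> \<rat>" "0 \<le> r" "r < 1"
  obtains d b :: nat where "2 \<le> b" "d < b" "r = real d / real b"
proof -
  obtain m n where n: "n \<noteq> 0" and r: "\<bar>r\<bar> = real m / real n" using assms(1) by (elim Rats_abs_nat_div_natE)
  \<comment> \<open>Doubling both terms of the fraction ensures \<open>2 \<le> b\<close> even when
    the denominator is 1.\<close>
  have "r = real (2 * m) / real (2 * n)" using r assms(2) n by simp
  moreover have "real m < real n" using r assms n by (simp add: divide_less_eq_1)
  ultimately show ?thesis using n by (intro that[of "2 * n" "2 * m"]) auto
qed

lemma digit_visits_Suc: "digit_visits b d x N \<le> digit_visits b d x (Suc N)" "digit_visits b d x (Suc N) \<le> Suc (digit_visits b d x N)"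
  and cf_visits_Suc: "cf_visits r x N \<le> cf_visits r x (Suc N)" "cf_visits r x (Suc N) \<le> Suc (cf_visits r x N)"
  by (simp_all add: digit_visits_def cf_visits_def card_less_Suc_Collect)

context
  fixes x :: real
  assumes irr: "x \<notin> \<rat>" and gt_1: "1 < x" and typical: "\<And>n. stage_shift \<le> n \<Longrightarrow> typical n x"
begin

lemma tendsto_digit_visits:
  assumes "2 \<le> b" "d < b"
  shows "(\<lambda>N. real (digit_visits b d x N) / real N) \<longlonglongrightarrow> 1 / real b"
    and "(\<lambda>N. real (digit_visits b d (1 / x) N) / real N) \<longlonglongrightarrow> 1 / real b"
    and "(\<lambda>N. real (cf_visits (real d / real b) x N) / real N) \<longlonglongrightarrow> log 2 (1 + real d / real b)"
proof -
  have near: "typical_at n (j\<^sup>2) b d x" if "max stage_shift b \<le> n" "j \<in> {64 ^ n..<64 ^ Suc n}" for n j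
    using typical[of n] that assms unfolding typical_def by simp
  note lim = tendsto_mean_if_squares[where ?n0.0 = "max stage_shift b"]
  show "(\<lambda>N. real (digit_visits b d x N) / real N) \<longlonglongrightarrow> 1 / real b"
    by (rule lim) (use near in \<open>auto simp only: digit_visits_Suc typical_at_def\<close>)
  show "(\<lambda>N. real (digit_visits b d (1 / x) N) / real N) \<longlonglongrightarrow> 1 / real b"
    by (rule lim) (use near in \<open>auto simp only: digit_visits_Suc typical_at_def\<close>)
  show "(\<lambda>N. real (cf_visits (real d / real b) x N) / real N) \<longlonglongrightarrow> log 2 (1 + real d / real b)"
    by (rule lim) (use near in \<open>auto simp only: cf_visits_Suc typical_at_def\<close>)
qed

lemma tendsto_cf_visits:
  assumes r: "r \<in> \<rat>" "0 \<le> r" "r \<le> 1"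
  shows "(\<lambda>N. real (cf_visits r x N) / real N) \<longlonglongrightarrow> log 2 (1 + r)"
proof (cases "r = 1")
  \<comment> \<open>1 is not of the form \<open>d / b\<close> with \<open>d < b\<close>, but every
    time is a visit then, and \<open>log 2 (1 + 1) = 1\<close>.\<close>
  case True
  have "cf_visits r x N = N" for N by (simp add: cf_visits_def True frac_lt_1)
  moreover have "(\<lambda>N. real N / real N) \<longlonglongrightarrow> 1"
    by (rule tendsto_eventually) (auto simp: eventually_sequentially intro!: exI[of _ 1])
  ultimately show ?thesis using True by simp
next
  case False
  with r obtain b d where "2 \<le> b" "d < b" "r = real d / real b" by (elim Rats_unit_nat_fractionE) auto
  then show ?thesis using tendsto_digit_visits(3) by simp
qed

lemma complete_quotient_inverse: "complete_quotient (1 / x) (Suc i) = complete_quotient x i"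
proof (induction i)
  case 0
  have "frac (1 / x) = 1 / x" using gt_1 by (simp add: frac_eq)
  then show ?case by simp
qed simp

text \<open>Up to time \<open>N + 1\<close> the orbit of \<open>1 / x\<close> makes the visits of
  \<open>x\<close> up to time \<open>N\<close> and at most one more, at time 0.\<close>

lemma tendsto_cf_visits_inverse:
  assumes r: "r \<in> \<rat>" "0 \<le> r" "r \<le> 1"
  shows "(\<lambda>N. real (cf_visits r (1 / x) N) / real N) \<longlonglongrightarrow> log 2 (1 + r)"
proof (rule LIMSEQ_offset[of _ 1])
  define c :: real where "c = of_bool (frac (1 / x) < r)"
  have visits: "real (cf_visits r (1 / x) (N + 1)) = real (cf_visits r x N) + c" for N
  proof -
    have "{i. i < N + 1 \<and> frac (complete_quotient (1 / x) i) < r} =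
      (if frac (1 / x) < r then {0} else {}) \<union> Suc ` {i. i < N \<and> frac (complete_quotient x i) < r}" (is "?A = ?B")
    proof (intro set_eqI)
      fix i show "i \<in> ?A \<longleftrightarrow> i \<in> ?B"
        using complete_quotient_inverse by (cases i) (auto simp del: complete_quotient.simps(2))
    qed
    moreover have "card ?B = of_bool (frac (1 / x) < r) + card (Suc ` {i. i < N \<and> frac (complete_quotient x i) < r})"
      by (subst card_Un_disjoint) auto
    ultimately show ?thesis by (simp add: cf_visits_def c_def card_image)
  qed
  have "(\<lambda>N. real (cf_visits r x N) / real N * (real N / real (N + 1)) + c / real (N + 1)) \<longlonglongrightarrow> log 2 (1 + r) * 1 + 0"
    by (intro tendsto_add tendsto_mult tendsto_cf_visits r LIMSEQ_n_over_Suc_n[unfolded Suc_eq_plus1]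
        LIMSEQ_ignore_initial_segment[OF lim_const_over_n])
  moreover have "real (cf_visits r x N) / real N * (real N / real (N + 1)) + c / real (N + 1) =
      real (cf_visits r (1 / x) (N + 1)) / real (N + 1)" for N
    unfolding visits by (cases "N = 0") (auto simp: cf_visits_def add_divide_distrib)
  ultimately show "(\<lambda>N. real (cf_visits r (1 / x) (N + 1)) / real (N + 1)) \<longlonglongrightarrow> log 2 (1 + r)"
    by simp
qed

lemma normal_if_typical:
  "cf_normal x" "cf_normal (1 / x)" "absolutely_normal x" "absolutely_normal (1 / x)"
  using cf_normal_if_cf_visits[OF irr tendsto_cf_visits]
    cf_normal_if_cf_visits[OF irrational_inverse[OF irr] tendsto_cf_visits_inverse]
    absolutely_normal_if_digit_visits[OF tendsto_digit_visits(1)]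
    absolutely_normal_if_digit_visits[OF tendsto_digit_visits(2)] by blast+

end

text \<open>The bits of \<open>x\<close> are the parities of \<open>s\<close>. A bit of
  \<open>1 / x\<close> is found by waiting until the scaled reciprocals of both end points have the
  same integer part. This happens because the scaled \<open>1 / x\<close> is irrational and so keeps
  a distance from the integers.\<close>

lemma computable_real_if_dyadic_approximation:
  assumes s: "rec 1 (\<lambda>e. s (e 0))" and x: "x \<notin> \<rat>" "0 < x"
    and lower: "\<And>n. real (s n) / 2 ^ n \<le> x" and upper: "\<And>n. x \<le> real (Suc (s n)) / 2 ^ n"
    and pos: "\<And>n. 0 < s n"
  shows "computable_real x" "computable_real (1 / x)"
proof -
  have rec_s: "rec k (\<lambda>e. s (a e))" if "rec k a" for k a using rec_comp1[OF s that] .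
  have bounds: "real (s n) \<le> 2 ^ n * x" "2 ^ n * x < real (s n) + 1" for n
  proof -
    show "real (s n) \<le> 2 ^ n * x" using lower[of n] by (simp add: divide_le_eq mult.commute)
    have "2 ^ n * x \<le> real (s n) + 1" using upper[of n] by (simp add: le_divide_eq mult.commute)
    moreover have "2 ^ n * x \<noteq> real (s n) + 1"
    proof
      assume "2 ^ n * x = real (s n) + 1"
      then have "x = (real (s n) + 1) / 2 ^ n" by (simp add: field_simps)
      then have "x \<in> \<rat>" by (auto intro!: Rats_divide Rats_add Rats_power)
      then show False using x by simp
    qed
    ultimately show "2 ^ n * x < real (s n) + 1" by simp
  qed
  have "base_digit 2 x (Suc n) = s (Suc n) mod 2" for n
  proof -
    have "\<lfloor>2 ^ Suc n * x\<rfloor> = int (s (Suc n))" using bounds[of "Suc n"] by (simp add: floor_eq_iff)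
    then have "int (base_digit 2 x (Suc n)) = int (s (Suc n) mod 2)"
      using base_digit_Suc[of 2 x n] by (simp add: of_nat_mod)
    then show ?thesis by simp
  qed
  moreover have "computable (\<lambda>n. s (Suc n) mod 2)"
    by (intro computable_if_rec rec_intros rec_s) auto
  ultimately show "computable_real x" unfolding computable_real_def by auto

  let ?q = "\<lambda>n N k. 2 ^ Suc n * 2 ^ N div (k :: nat)"
  have floor_q: "\<lfloor>2 ^ Suc n * (1 / (real k / 2 ^ N))\<rfloor> = int (?q n N k)" for n N k
    using floor_divide_of_nat_eq[of "2 ^ Suc n * 2 ^ N" k, where ?'a = real] by simp
  have q_eq: "\<lfloor>2 ^ Suc n * (1 / x)\<rfloor> = int (?q n N (s N))" if "?q n N (s N) = ?q n N (Suc (s N))" for n N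
  proof -
    have "0 < real (s N) / 2 ^ N" "0 < real (Suc (s N)) / 2 ^ N" using pos[of N] by auto
    then have "1 / x \<le> 1 / (real (s N) / 2 ^ N)" "1 / (real (Suc (s N)) / 2 ^ N) \<le> 1 / x"
      using lower[of N] upper[of N] x(2) by (auto intro!: divide_left_mono mult_pos_pos simp del: divide_divide_eq_right)
    then have "\<lfloor>2 ^ Suc n * (1 / x)\<rfloor> \<le> \<lfloor>2 ^ Suc n * (1 / (real (s N) / 2 ^ N))\<rfloor>"
      "\<lfloor>2 ^ Suc n * (1 / (real (Suc (s N)) / 2 ^ N))\<rfloor> \<le> \<lfloor>2 ^ Suc n * (1 / x)\<rfloor>"
      by (intro floor_mono mult_left_mono; simp)+
    then show ?thesis unfolding floor_q using that by linarith
  qed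
  have ex: "\<exists>N. of_bool (?q n N (s N) \<noteq> ?q n N (Suc (s N))) = (0 :: nat)" for n
  proof -
    let ?f = "\<lambda>y. 2 ^ Suc n * (1 / y) :: real"
    have "?f x \<notin> \<rat>" using irrational_of_int_mult_iff[OF irrational_inverse[OF x(1)], of 2 "Suc n"] by simp
    then have "eventually (\<lambda>y. \<lfloor>?f y\<rfloor> = \<lfloor>?f x\<rfloor>) (nhds x)"
      using x by (intro eventually_floor_eq) (auto intro!: continuous_intros)
    then have "eventually (\<lambda>N. \<lfloor>?f (real (s N) / 2 ^ N)\<rfloor> = \<lfloor>?f x\<rfloor> \<and> \<lfloor>?f (real (Suc (s N)) / 2 ^ N)\<rfloor> = \<lfloor>?f x\<rfloor>) sequentially"
      using tendsto_dyadic[OF lower upper] unfolding filterlim_iff by (intro eventually_conj) blast+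
    then obtain N where "\<lfloor>?f (real (s N) / 2 ^ N)\<rfloor> = \<lfloor>?f (real (Suc (s N)) / 2 ^ N)\<rfloor>"
      unfolding eventually_sequentially by (metis order_refl)
    then have "?q n N (s N) = ?q n N (Suc (s N))" unfolding floor_q by simp
    then show ?thesis by auto
  qed
  define T where "T n = (LEAST N. of_bool (?q n N (s N) \<noteq> ?q n N (Suc (s N))) = (0 :: nat))" for n
  have rec_T: "rec k (\<lambda>e. T (a e))" if "rec k a" for k a
  proof (rule rec_comp1[OF _ that])
    show "rec 1 (\<lambda>e. T (e 0))"
      unfolding T_def by (intro rec_Least ex rec_intros rec_s) auto
  qed
  have "base_digit 2 (1 / x) (Suc n) = ?q n (T n) (s (T n)) mod 2" for n
  proof -
    have "?q n (T n) (s (T n)) = ?q n (T n) (Suc (s (T n)))"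
      using LeastI_ex[OF ex[of n]] unfolding T_def[symmetric] by simp
    from q_eq[OF this] have "int (base_digit 2 (1 / x) (Suc n)) = int (?q n (T n) (s (T n)) mod 2)"
      using base_digit_Suc[of 2 "1 / x" n] by (simp only: of_nat_mod of_nat_numeral zero_less_numeral)
    then show ?thesis by (simp only: of_nat_eq_iff)
  qed
  moreover have "computable (\<lambda>n. ?q n (T n) (s (T n)) mod 2)"
    by (intro computable_if_rec rec_intros rec_s rec_T) auto
  ultimately show "computable_real (1 / x)" unfolding computable_real_def by auto
qed

theorem theorem1:
  "\<exists>x::real. x > 0 \<and>
     cf_normal x \<and> cf_normal (1 / x) \<and>
     absolutely_normal x \<and> absolutely_normal (1 / x) \<and>
     computable_real x \<and> computable_real (1 / x)"
proof -
  have "rec 3 (\<lambda>e. of_bool (certificate (e 0 + stage_shift) (e 1) (e 2)))"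
    by (rule rec_comp3[where F = "\<lambda>a b c. of_bool (certificate a b c)", OF rec_certificate]) (intro rec_intros; simp)+
  from computable_avoidance[OF this certificate_density]
  obtain s m where s0: "s 0 = (1 :: nat)" and s_div: "\<And>n. s (Suc n) div 2 = s n" and rec_s: "rec 1 (\<lambda>e. s (e 0))"
    and cert: "\<And>n. certificate (n + stage_shift) (m n) (s (m n))" by blast
  define l where "l n = real (s n) / 2 ^ n" for n
  define u where "u n = real (Suc (s n)) / 2 ^ n" for n
  \<comment> \<open>Each interval is one of the two halves of its predecessor, so the end points are
    monotone.\<close>
  have step: "2 * s n \<le> s (Suc n)" "Suc (s (Suc n)) \<le> 2 * Suc (s n)" for n
    using s_div[of n] by auto
  have half: "(\<lambda>m. 1 / 2 ^ m :: real) \<longlonglongrightarrow> 0"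
    using LIMSEQ_power_zero[of "1 / 2 :: real"] by (simp add: power_divide)
  have "\<exists>x. ((\<forall>n. l n \<le> x) \<and> l \<longlonglongrightarrow> x) \<and> ((\<forall>n. x \<le> u n) \<and> u \<longlonglongrightarrow> x)"
  proof (rule nested_sequence_unique)
    have "real (2 * s n) / 2 ^ Suc n \<le> real (s (Suc n)) / 2 ^ Suc n" for n
      using step(1)[of n] by (intro divide_right_mono) simp_all
    then show "\<forall>n. l n \<le> l (Suc n)" by (simp add: l_def)
    have "real (Suc (s (Suc n))) / 2 ^ Suc n \<le> real (2 * Suc (s n)) / 2 ^ Suc n" for n
      using step(2)[of n] by (intro divide_right_mono) (simp_all only: of_nat_le_iff zero_le_power zero_le_numeral)
    moreover have "real (2 * k) / 2 ^ Suc n = real k / 2 ^ n" for k n by simp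
    ultimately have "real (Suc (s (Suc n))) / 2 ^ Suc n \<le> real (Suc (s n)) / 2 ^ n" for n by metis
    then show "\<forall>n. u (Suc n) \<le> u n" by (simp add: u_def)
    show "\<forall>n. l n \<le> u n" by (simp add: l_def u_def divide_right_mono)
    have "l n - u n = - (1 / 2 ^ n)" for n by (simp add: l_def u_def add_divide_distrib)
    then show "(\<lambda>n. l n - u n) \<longlonglongrightarrow> 0" using tendsto_minus[OF half] by simp
  qed
  then obtain x where lower: "\<And>n. l n \<le> x" and upper: "\<And>n. x \<le> u n" by blast
  have s_pos: "0 < s n" for n
  proof (induction n)
    case (Suc n)
    then show ?case using step(1)[of n] by simp
  qed (simp add: s0)
  have x1: "1 \<le> x" using lower[of 0] by (simp add: l_def s0)
  \<comment> \<open>Certificates are sound on closed intervals, so they apply to the limit before it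
    is known not to be an end point.\<close>
  have sound: "typical (n + stage_shift) x" "cf_digits_pos (n + stage_shift) x" for n
    using certificate_sound[OF cert s_pos] lower upper unfolding l_def u_def by blast+
  have irr: "x \<notin> \<rat>"
  proof (rule irrational_if_cf_digits_pos)
    fix i
    have "i \<le> horizon (i + stage_shift)"
    proof -
      have "i < 64 ^ i" by (rule power_gt_expt) simp
      also have "\<dots> \<le> 64 ^ Suc (i + stage_shift)" by (intro power_increasing) auto
      also have "\<dots> \<le> horizon (i + stage_shift)" unfolding horizon_def by (rule self_le_power) auto
      finally show ?thesis by simp
    qed
    then show "1 \<le> \<lfloor>complete_quotient x i\<rfloor>" using sound(2)[of i] unfolding cf_digits_pos_def by auto
  qed (use x1 in simp)
  have gt_1: "1 < x" using x1 irr by (cases "x = 1") auto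
  have typical: "typical n x" if "stage_shift \<le> n" for n using sound(1)[of "n - stage_shift"] that by simp
  have "computable_real x" "computable_real (1 / x)"
    using computable_real_if_dyadic_approximation[OF rec_s irr _ lower[unfolded l_def] upper[unfolded u_def] s_pos] gt_1
    by simp_all
  then show ?thesis using normal_if_typical[OF irr gt_1 typical] gt_1 by (intro exI[of _ x]) simp
qed

end
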